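(* Let $\alpha>0$ and let $X=\{X_t\}_{t\in T}$ be an $\alpha$-Fréchet process with a minimal representation with standardized support $\{f_t\}_{t\in T}\subset L_+^\alpha(S_{I,N},\lambda_{I,N})$. Put $S_I=S_{I,N}\cap(0,1)$, $S_N=S_{I,N}\cap\mathbb N$, $\lambda_I=\lambda_{I,N}|_{S_I}$, $\lambda_N=\lambda_{I,N}|_{S_N}$, $f_t^I=f_t\mathbf 1_{S_I}$, $f_t^N=f_t\mathbf 1_{S_N}$, and $$X_t^I=\int^e_{S_I}f_t^I\,dM_\alpha,\qquad X_t^N=\int^e_{S_N}f_t^N\,dM_\alpha,$$ where $M_\alpha$ is an $\alpha$-Fréchet random sup-measure with control measure $\lambda_{I,N}$, so that $$\{X_t\}_{t\in T}\stackrel d=\{X_t^I\vee X_t^N\}_{t\in T}.\qquad( * )$$ Then: (i) The decomposition $( * )$ is unique in distribution: the laws of $\{X^I_t\}_{t\in T}$ and $\{X^N_t\}_{t\in T}$ do not depend on the choice of the minimal representation with standardized support of $X$. (ii) The processes $X^I=\{X_t^I\}_{t\in T}$ and $X^N=\{X_t^N\}_{t\in T}$ are independent and have standardized supports $S_I$ and $S_N$, respectively. (iii) The functions $\{f_t^I\}_{t\in T}\subset L_+^\alpha(S_I,\lambda_I)$ and $\{f_t^N\}_{t\in T}\subset L_+^\alpha(S_N,\lambda_N)$ provide minimal representations of $X^I$ and $X^N$, respectively.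
   Context: A random variable is $\alpha$-Fréchet with scale $\sigma>0$ if its distribution function is $\exp(-\sigma^\alpha x^{-\alpha})$, $x>0$; a process is $\alpha$-Fréchet if all $\max_{j\le n}a_jX_{t_j}$, $a_j>0$, are $\alpha$-Fréchet (scale $0$, i.e. the constant $0$, is allowed for the components of the decomposition). $L_+^\alpha(S,\mu)$ is the set of measurable $f:S\to[0,\infty)$ with $\int_Sf^\alpha d\mu<\infty$, with metric $\rho_{\mu,\alpha}(f,g)=\int_S|f^\alpha-g^\alpha|d\mu$. An $\alpha$-Fréchet random sup-measure $M_\alpha$ with control measure $\mu$ is a process indexed by measurable sets, independent over disjoint sets, a.s. $\sigma$-sup-additive over disjoint sets, with $M_\alpha(A)$ $\alpha$-Fréchet of scale $\mu(A)^{1/\alpha}$. The extremal integral $\int^e_Sf\,dM_\alpha$ equals $\bigvee_ia_iM_\alpha(A_i)$ for $f=\sum_ia_i\mathbf 1_{A_i}$ ($A_i$ disjoint, $a_i\ge0$), and is extended to $L_+^\alpha(S,\mu)$ by continuity in probability. $\{f_t\}\subset L_+^\alpha(S,\mu)$ is a spectral representation of $X$ if $\{X_t\}\stackrel d=\{\int_S^ef_t\,dM_\alpha\}$, equivalently $P(X_{t_i}\le x_i,\,1\le i\le n)=\exp\{-\int_S(\bigvee_ix_i^{-1}f_{t_i})^\alpha d\mu\}$ for all $n$, $t_i\in T$, $x_i>0$. $\mathrm{supp}\{f_t:t\in T\}$ is $\{f_0\neq0\}$ (mod $\mu$) for any $f_0$ in the $\rho_{\mu,\alpha}$-closure of the max-linear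 combinations $\bigvee_{i\le n}a_if_{t_i}$ ($a_i>0$) with $\mu(\{g\neq0\}\setminus\{f_0\neq0\})=0$ for all $g$ in that closure. $\rho(\{f_t\})$ is the $\sigma$-field generated by the ratios $f_t/f_{t'}$ with values in $[0,\infty]$ ($0/0:=0$). A spectral representation is minimal if $\mathrm{supp}\{f_t:t\in T\}=S$ $\mu$-a.e. and for every measurable $B\subset S$ there is $A\in\rho(\{f_t\})$ with $\mu(A\Delta B)=0$. It has standardized support if, up to null sets, $(S,\mu)=(S_{I,N},\lambda_{I,N})$ for some $I\in\{0,1\}$, $N\in\{0,1,\dots\}\cup\{\infty\}$: $S_{I,N}\subset(0,1)\cup\mathbb N$, with $S_{I,N}\cap(0,1)=\emptyset$ if $I=0$, $(0,1)$ if $I=1$; $S_{I,N}\cap\mathbb N=\emptyset$, $\{1,\dots,N\}$, or $\mathbb N$ according as $N=0$, $N\in\mathbb N$, $N=\infty$; $\lambda_{I,N}$ is Lebesgue measure on the part in $(0,1)$ and counting measure on the part in $\mathbb N$. The pair $(I,N)$ depends only on the process, and $S_{I,N}$ is called the standardized support of $X$. *)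

theory Defs
  imports "HOL-Probability.Probability" "HOL-Library.Extended_Nat"
begin

text \<open>
  Throughout, \<open>P\<close>, \<open>Q\<close> are probability spaces, \<open>T\<close> is the index set of a process
  \<open>X t \<omega>\<close>, \<open>\<alpha>\<close> is the Frechet exponent and \<open>\<mu>\<close> is the (control) measure.
  Nonempty finite tuples \<open>t\<^sub>1, \<dots>, t\<^sub>n\<close> with positive coefficients are encoded by a nonempty
  finite \<open>F \<subseteq> T\<close> and a coefficient function positive on \<open>F\<close>; this loses nothing, since
  repeated indices merge under the maximum.
\<close>

section \<open>Frechet variables and processes\<close>

text \<open>For \<open>\<sigma> = 0\<close> the two conditions say that \<open>Z\<close> is almost surely \<open>0\<close> (recall \<open>0 powr \<alpha> = 0\<close>).\<close>

definition frechet_rv :: "'w measure \<Rightarrow> real \<Rightarrow> real \<Rightarrow> ('w \<Rightarrow> real) \<Rightarrow> bool" where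
  "frechet_rv P \<alpha> \<sigma> Z \<longleftrightarrow>
     0 \<le> \<sigma> \<and> Z \<in> borel_measurable P \<and> (AE \<omega> in P. 0 \<le> Z \<omega>) \<and>
     (\<forall>x>0. measure P {\<omega> \<in> space P. Z \<omega> \<le> x} = exp (- (\<sigma> powr \<alpha> * x powr (- \<alpha>))))"

definition frechet_process :: "'w measure \<Rightarrow> real \<Rightarrow> 't set \<Rightarrow> ('t \<Rightarrow> 'w \<Rightarrow> real) \<Rightarrow> bool" where
  "frechet_process P \<alpha> T X \<longleftrightarrow>
     (\<forall>F a. finite F \<and> F \<noteq> {} \<and> F \<subseteq> T \<and> (\<forall>t\<in>F. 0 < a t) \<longrightarrow>
        (\<exists>\<sigma>>0. frechet_rv P \<alpha> \<sigma> (\<lambda>\<omega>. MAX t\<in>F. a t * X t \<omega>)))"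

text \<open>The same notion with scale \<open>0\<close> allowed.\<close>

definition frechet_process0 :: "'w measure \<Rightarrow> real \<Rightarrow> 't set \<Rightarrow> ('t \<Rightarrow> 'w \<Rightarrow> real) \<Rightarrow> bool" where
  "frechet_process0 P \<alpha> T X \<longleftrightarrow>
     (\<forall>F a. finite F \<and> F \<noteq> {} \<and> F \<subseteq> T \<and> (\<forall>t\<in>F. 0 < a t) \<longrightarrow>
        (\<exists>\<sigma>\<ge>0. frechet_rv P \<alpha> \<sigma> (\<lambda>\<omega>. MAX t\<in>F. a t * X t \<omega>)))"

definition process_law :: "'w measure \<Rightarrow> 't set \<Rightarrow> ('t \<Rightarrow> 'w \<Rightarrow> real) \<Rightarrow> ('t \<Rightarrow> real) measure" where
  "process_law P T X = distr P (PiM T (\<lambda>_. borel)) (\<lambda>\<omega>. \<lambda>t\<in>T. X t \<omega>)"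

definition indep_processes ::
    "'w measure \<Rightarrow> 't set \<Rightarrow> ('t \<Rightarrow> 'w \<Rightarrow> real) \<Rightarrow> ('t \<Rightarrow> 'w \<Rightarrow> real) \<Rightarrow> bool" where
  "indep_processes P T X Y \<longleftrightarrow>
     prob_space.indep_var P (PiM T (\<lambda>_. borel)) (\<lambda>\<omega>. \<lambda>t\<in>T. X t \<omega>)
                            (PiM T (\<lambda>_. borel)) (\<lambda>\<omega>. \<lambda>t\<in>T. Y t \<omega>)"

section \<open>Extremal integrals\<close>

definition Lplus :: "real \<Rightarrow> 's measure \<Rightarrow> ('s \<Rightarrow> real) set" where
  "Lplus \<alpha> \<mu> = {f \<in> borel_measurable \<mu>. (\<forall>s\<in>space \<mu>. 0 \<le> f s) \<and> integrable \<mu> (\<lambda>s. f s powr \<alpha>)}"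

definition rho :: "real \<Rightarrow> 's measure \<Rightarrow> ('s \<Rightarrow> real) \<Rightarrow> ('s \<Rightarrow> real) \<Rightarrow> real" where
  "rho \<alpha> \<mu> f g = (\<integral>s. \<bar>f s powr \<alpha> - g s powr \<alpha>\<bar> \<partial>\<mu>)"

text \<open>
  A random sup-measure is indexed by all measurable sets and takes values in \<open>[0, \<infinity>]\<close>;
  on sets of infinite control measure (infinite scale) it is almost surely infinite.
  Sequences of disjoint sets cover finite families (pad with \<open>{}\<close>).
\<close>

definition random_sup_measure ::
    "'w measure \<Rightarrow> real \<Rightarrow> 's measure \<Rightarrow> ('s set \<Rightarrow> 'w \<Rightarrow> ennreal) \<Rightarrow> bool" where
  "random_sup_measure P \<alpha> \<mu> M \<longleftrightarrow>
     (\<forall>A\<in>sets \<mu>. M A \<in> borel_measurable P) \<and>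
     (\<forall>A. range A \<subseteq> sets \<mu> \<and> disjoint_family A \<longrightarrow>
        prob_space.indep_vars P (\<lambda>_::nat. borel) (\<lambda>i. M (A i)) UNIV) \<and>
     (\<forall>A. range A \<subseteq> sets \<mu> \<and> disjoint_family A \<longrightarrow>
        (AE \<omega> in P. M (\<Union>i::nat. A i) \<omega> = (SUP i. M (A i) \<omega>))) \<and>
     (\<forall>A\<in>sets \<mu>. emeasure \<mu> A < \<infinity> \<longrightarrow>
        (AE \<omega> in P. M A \<omega> < \<infinity>) \<and>
        frechet_rv P \<alpha> (measure \<mu> A powr (1 / \<alpha>)) (\<lambda>\<omega>. enn2real (M A \<omega>))) \<and>
     (\<forall>A\<in>sets \<mu>. emeasure \<mu> A = \<infinity> \<longrightarrow> (AE \<omega> in P. M A \<omega> = \<infinity>))"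

text \<open>\<open>\<Sum>\<^sub>i a\<^sub>i indicator A\<^sub>i\<close> and its extremal integral \<open>\<Or>\<^sub>i a\<^sub>i M(A\<^sub>i)\<close>, \<open>i < n\<close>. In \<open>ennreal\<close>, \<open>0 * \<infinity> = 0\<close>.\<close>

definition simple_fun :: "nat \<Rightarrow> (nat \<Rightarrow> real) \<Rightarrow> (nat \<Rightarrow> 's set) \<Rightarrow> 's \<Rightarrow> real" where
  "simple_fun n a A s = (\<Sum>i<n. a i * indicator (A i) s)"

definition simple_extremal_integral ::
    "('s set \<Rightarrow> 'w \<Rightarrow> ennreal) \<Rightarrow> nat \<Rightarrow> (nat \<Rightarrow> real) \<Rightarrow> (nat \<Rightarrow> 's set) \<Rightarrow> 'w \<Rightarrow> ennreal" where
  "simple_extremal_integral M n a A \<omega> = (SUP i\<in>{..<n}. ennreal (a i) * M (A i) \<omega>)"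

text \<open>
  \<open>Y\<close> is a version of the extremal integral of \<open>f\<close> over \<open>(S, \<mu>)\<close>: the limit in probability
  of the extremal integrals of simple functions \<open>g\<^sub>k\<close> in \<open>Lplus\<close> converging to \<open>f\<close> in the metric.
  The integrals of the \<open>g\<^sub>k\<close> are almost surely finite, so \<open>enn2real\<close> acts as a mere coercion.
  Only the values \<open>M A\<close>, \<open>A \<in> sets \<mu>\<close>, enter; hence integration over a
  measurable subset \<open>D\<close> is integration with respect to \<open>restrict_space \<mu> D\<close>.
\<close>

definition has_extremal_integral ::
    "'w measure \<Rightarrow> real \<Rightarrow> 's measure \<Rightarrow> ('s set \<Rightarrow> 'w \<Rightarrow> ennreal) \<Rightarrow> ('s \<Rightarrow> real) \<Rightarrow> ('w \<Rightarrow> real) \<Rightarrow> bool"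
  where
  "has_extremal_integral P \<alpha> \<mu> M f Y \<longleftrightarrow>
     f \<in> Lplus \<alpha> \<mu> \<and> Y \<in> borel_measurable P \<and>
     (\<exists>n a A.
        (\<forall>k. \<forall>i<n k. 0 \<le> a k i \<and> A k i \<in> sets \<mu>) \<and>
        (\<forall>k. disjoint_family_on (A k) {..<n k}) \<and>
        (\<forall>k. simple_fun (n k) (a k) (A k) \<in> Lplus \<alpha> \<mu>) \<and>
        (\<lambda>k::nat. rho \<alpha> \<mu> (simple_fun (n k) (a k) (A k)) f) \<longlonglongrightarrow> 0 \<and>
        (\<forall>\<epsilon>>0. (\<lambda>k. measure P {\<omega> \<in> space P.
            \<bar>enn2real (simple_extremal_integral M (n k) (a k) (A k) \<omega>) - Y \<omega>\<bar> > \<epsilon>}) \<longlonglongrightarrow> 0))"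

section \<open>Spectral representations and minimality\<close>

definition spectral_rep ::
    "'w measure \<Rightarrow> real \<Rightarrow> 't set \<Rightarrow> ('t \<Rightarrow> 'w \<Rightarrow> real) \<Rightarrow> 's measure \<Rightarrow> ('t \<Rightarrow> 's \<Rightarrow> real) \<Rightarrow> bool" where
  "spectral_rep P \<alpha> T X \<mu> f \<longleftrightarrow>
     frechet_process0 P \<alpha> T X \<and> (\<forall>t\<in>T. f t \<in> Lplus \<alpha> \<mu>) \<and>
     (\<forall>F x. finite F \<and> F \<noteq> {} \<and> F \<subseteq> T \<and> (\<forall>t\<in>F. 0 < x t) \<longrightarrow>
        measure P {\<omega> \<in> space P. \<forall>t\<in>F. X t \<omega> \<le> x t} =
        exp (- (\<integral>s. (MAX t\<in>F. inverse (x t) * f t s) powr \<alpha> \<partial>\<mu>)))"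

definition max_linear_combs :: "'t set \<Rightarrow> ('t \<Rightarrow> 's \<Rightarrow> real) \<Rightarrow> ('s \<Rightarrow> real) set" where
  "max_linear_combs T f =
     {(\<lambda>s. MAX t\<in>F. a t * f t s) | F a. finite F \<and> F \<noteq> {} \<and> F \<subseteq> T \<and> (\<forall>t\<in>F. 0 < a t)}"

definition max_linear_closure ::
    "real \<Rightarrow> 's measure \<Rightarrow> 't set \<Rightarrow> ('t \<Rightarrow> 's \<Rightarrow> real) \<Rightarrow> ('s \<Rightarrow> real) set" where
  "max_linear_closure \<alpha> \<mu> T f =
     {g \<in> Lplus \<alpha> \<mu>. \<forall>\<epsilon>>0. \<exists>h\<in>max_linear_combs T f. rho \<alpha> \<mu> h g < \<epsilon>}"

definition is_support :: "real \<Rightarrow> 's measure \<Rightarrow> 't set \<Rightarrow> ('t \<Rightarrow> 's \<Rightarrow> real) \<Rightarrow> 's set \<Rightarrow> bool" where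
  "is_support \<alpha> \<mu> T f A \<longleftrightarrow>
     (\<exists>f0\<in>max_linear_closure \<alpha> \<mu> T f.
        (\<forall>g\<in>max_linear_closure \<alpha> \<mu> T f. {s \<in> space \<mu>. g s \<noteq> 0} - {s \<in> space \<mu>. f0 s \<noteq> 0} \<in> null_sets \<mu>) \<and>
        sym_diff A {s \<in> space \<mu>. f0 s \<noteq> 0} \<in> null_sets \<mu>)"

text \<open>In \<open>ennreal\<close>, \<open>0 / 0 = 0\<close> and \<open>x / 0 = \<infinity>\<close> for \<open>x > 0\<close>.\<close>

definition ratio_sigma_field :: "'s measure \<Rightarrow> 't set \<Rightarrow> ('t \<Rightarrow> 's \<Rightarrow> real) \<Rightarrow> 's set set" where
  "ratio_sigma_field \<mu> T f =
     sigma_sets (space \<mu>)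
       {(\<lambda>s. ennreal (f t s) / ennreal (f t' s)) -` B \<inter> space \<mu> | t t' B.
          t \<in> T \<and> t' \<in> T \<and> B \<in> sets borel}"

definition minimal_rep ::
    "'w measure \<Rightarrow> real \<Rightarrow> 't set \<Rightarrow> ('t \<Rightarrow> 'w \<Rightarrow> real) \<Rightarrow> 's measure \<Rightarrow> ('t \<Rightarrow> 's \<Rightarrow> real) \<Rightarrow> bool" where
  "minimal_rep P \<alpha> T X \<mu> f \<longleftrightarrow>
     spectral_rep P \<alpha> T X \<mu> f \<and>
     is_support \<alpha> \<mu> T f (space \<mu>) \<and>
     (\<forall>B\<in>sets \<mu>. \<exists>A\<in>ratio_sigma_field \<mu> T f. sym_diff A B \<in> null_sets \<mu>)"

section \<open>Standardized support\<close>

text \<open>The index \<open>I \<in> {0, 1}\<close> is a Boolean (\<open>True\<close> for \<open>1\<close>); the positive integers sit inside \<open>real\<close>.\<close>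

definition std_support :: "bool \<Rightarrow> enat \<Rightarrow> real set" where
  "std_support I N = (if I then {0<..<1} else {}) \<union> real ` {n. 1 \<le> n \<and> enat n \<le> N}"

definition std_support_cont :: "bool \<Rightarrow> enat \<Rightarrow> real set" where
  "std_support_cont I N = std_support I N \<inter> {0<..<1}"

definition std_support_disc :: "bool \<Rightarrow> enat \<Rightarrow> real set" where
  "std_support_disc I N = std_support I N \<inter> real ` {1..}"

definition leb_count :: "real measure" where
  "leb_count = measure_of UNIV (sets borel)
     (\<lambda>A. emeasure lborel (A \<inter> {0<..<1}) + emeasure (count_space UNIV) (A \<inter> real ` {1..}))"

definition std_measure :: "bool \<Rightarrow> enat \<Rightarrow> real measure" where
  "std_measure I N = restrict_space leb_count (std_support I N)"

lemma sets_leb_count [simp, measurable_cong]: "sets leb_count = sets borel"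
  using sets.sigma_sets_eq[of "borel :: real measure"] by (simp add: leb_count_def)

lemma space_leb_count [simp]: "space leb_count = UNIV"
  by (simp add: leb_count_def)

lemma real_pos_nats_borel [measurable]: "real ` K \<in> sets borel"
  by (rule sets.countable) (simp_all add: countable_image)

lemma emeasure_leb_count:
  assumes "A \<in> sets borel"
  shows "emeasure leb_count A =
    emeasure lborel (A \<inter> {0<..<1}) + emeasure (count_space UNIV) (A \<inter> real ` {1..})"
proof (rule emeasure_measure_of[OF leb_count_def])
  show "countably_additive (sets leb_count)
    (\<lambda>A. emeasure lborel (A \<inter> {0<..<1}) + emeasure (count_space UNIV) (A \<inter> real ` {1..}))"
  proof (rule countably_additiveI)
    fix B :: "nat \<Rightarrow> real set"
    assume B: "range B \<subseteq> sets leb_count" "disjoint_family B"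
    have d: "disjoint_family (\<lambda>i. B i \<inter> C)" for C
      using B(2) by (auto simp: disjoint_family_on_def)
    have "(\<Sum>i. emeasure lborel (B i \<inter> {0<..<1}) + emeasure (count_space UNIV) (B i \<inter> real ` {1..}))
      = (\<Sum>i. emeasure lborel (B i \<inter> {0<..<1})) + (\<Sum>i. emeasure (count_space UNIV) (B i \<inter> real ` {1..}))"
      by (rule suminf_add[symmetric]) auto
    also have "(\<Sum>i. emeasure lborel (B i \<inter> {0<..<1})) = emeasure lborel (\<Union>i. B i \<inter> {0<..<1})"
      using B d by (intro suminf_emeasure) auto
    also have "(\<Sum>i. emeasure (count_space UNIV) (B i \<inter> real ` {1..}))
        = emeasure (count_space UNIV) (\<Union>i. B i \<inter> real ` {1..})"
      using d by (intro suminf_emeasure) auto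
    finally show "(\<Sum>i. emeasure lborel (B i \<inter> {0<..<1}) + emeasure (count_space UNIV) (B i \<inter> real ` {1..}))
      = emeasure lborel ((\<Union>i. B i) \<inter> {0<..<1}) + emeasure (count_space UNIV) ((\<Union>i. B i) \<inter> real ` {1..})"
      by simp
  qed
qed (use assms in \<open>auto simp: positive_def\<close>)

lemma std_support_borel [measurable]: "std_support I N \<in> sets borel"
  unfolding std_support_def by (intro sets.Un real_pos_nats_borel) auto

lemma space_std_measure [simp]: "space (std_measure I N) = std_support I N"
  by (simp add: std_measure_def space_restrict_space)

lemma emeasure_std_measure:
  assumes "A \<in> sets borel" "A \<subseteq> std_support I N"
  shows "emeasure (std_measure I N) A =
    emeasure lborel (A \<inter> {0<..<1}) + emeasure (count_space UNIV) (A \<inter> real ` {1..})"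
  using assms by (simp add: std_measure_def emeasure_restrict_space emeasure_leb_count)

definition std_measure_cont :: "bool \<Rightarrow> enat \<Rightarrow> real measure" where
  "std_measure_cont I N = restrict_space (std_measure I N) (std_support_cont I N)"

definition std_measure_disc :: "bool \<Rightarrow> enat \<Rightarrow> real measure" where
  "std_measure_disc I N = restrict_space (std_measure I N) (std_support_disc I N)"

definition has_standardized_support ::
    "'w measure \<Rightarrow> real \<Rightarrow> 't set \<Rightarrow> ('t \<Rightarrow> 'w \<Rightarrow> real) \<Rightarrow> real set \<Rightarrow> bool" where
  "has_standardized_support P \<alpha> T X A \<longleftrightarrow>
     (\<exists>I N f. A = std_support I N \<and> minimal_rep P \<alpha> T X (std_measure I N) f)"

definition cont_part :: "bool \<Rightarrow> enat \<Rightarrow> ('t \<Rightarrow> real \<Rightarrow> real) \<Rightarrow> 't \<Rightarrow> real \<Rightarrow> real" where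
  "cont_part I N f t s = f t s * indicator (std_support_cont I N) s"

definition disc_part :: "bool \<Rightarrow> enat \<Rightarrow> ('t \<Rightarrow> real \<Rightarrow> real) \<Rightarrow> 't \<Rightarrow> real \<Rightarrow> real" where
  "disc_part I N f t s = f t s * indicator (std_support_disc I N) s"

text \<open>
  \<open>XI t\<close> and \<open>XN t\<close> are versions of the extremal integrals of the two parts of \<open>f t\<close> with
  respect to one random sup-measure \<open>M\<close> on \<open>Q\<close> with control measure \<open>std_measure I N\<close>.
\<close>

definition std_components ::
    "'w measure \<Rightarrow> real \<Rightarrow> 't set \<Rightarrow> bool \<Rightarrow> enat \<Rightarrow> ('t \<Rightarrow> real \<Rightarrow> real) \<Rightarrow>
     (real set \<Rightarrow> 'w \<Rightarrow> ennreal) \<Rightarrow> ('t \<Rightarrow> 'w \<Rightarrow> real) \<Rightarrow> ('t \<Rightarrow> 'w \<Rightarrow> real) \<Rightarrow> bool" where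
  "std_components Q \<alpha> T I N f M XI XN \<longleftrightarrow>
     random_sup_measure Q \<alpha> (std_measure I N) M \<and>
     (\<forall>t\<in>T. has_extremal_integral Q \<alpha> (std_measure_cont I N) M (cont_part I N f t) (XI t)) \<and>
     (\<forall>t\<in>T. has_extremal_integral Q \<alpha> (std_measure_disc I N) M (disc_part I N f t) (XN t))"

end

theory Submission
  imports Defs
begin

text \<open>
  By the definition of a spectral representation, the joint distribution function of the process at a
  level \<open>x\<close> is \<open>exp (- E x)\<close>, where the exponent \<open>E x\<close> is the integral of
  \<open>\<Or>\<^sub>t x\<^sub>t\<^sup>-\<^sup>\<alpha> f\<^sub>t\<^sup>\<alpha>\<close>. Everything is read off from exponents.

  Independence and the law of the maximum. A finite family of extremal integrals has the distribution
  function given by the exponent of its integrands: this is clear for simple functions, once overlapping sets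
  are replaced by disjoint ones, and it survives limits in probability
  (\<open>extremal_integrals_spectral_rep\<close>). Integrands over the continuous and the
  discrete part have disjoint supports, so for them the maximum in the exponent is a sum and the joint distribution
  function is a product (\<open>extremal_integrals_disjoint\<close>). A law on the product space is
  determined by these functions (\<open>nonneg_process_law_eqI\<close>). Minimality passes to measurable
  parts of the base space (\<open>minimal_rep_restrict\<close>), and the two parts of a standardized space are
  standardized spaces themselves.

  Uniqueness. Two minimal representations of the same process have equal exponents. The task is to
  see that the integral over the discrete part alone is determined. The idea is to push
  everything to a space that both representations share: fix a positive integrable reference function \<open>u\<close>,
  the weighted supremum of countably many \<open>f\<^sub>t\<^sup>\<alpha>\<close>, and map \<open>s\<close> to the normalized vector
  \<open>(f\<^sub>t(s)\<^sup>\<alpha> / u(s))\<^sub>t\<close>. The image of the measure with density \<open>u\<close> is a finite measure on the product space;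
  differentiating \<open>c \<mapsto> \<integral> max W (c u)\<close> for finite weighted maxima \<open>W\<close> expresses its distribution
  function through exponents, so it is the same for both representations (\<open>spectral_measure_eq\<close>).
  Minimality says that the map is injective up to null sets, in the sense that every measurable set of the base space is
  almost everywhere a preimage (\<open>minimal_rep_pullback\<close>). Hence points of positive measure correspond to sets of the
  image that cannot be split, a notion that depends only on the null sets of the image measure, while the diffuse part
  contains no such sets of positive measure. One set of the image space therefore cuts out the discrete part on both sides
  (\<open>common_atomic_part\<close>).
\<close>

section \<open>Finite maxima\<close>

text \<open>
  For nonnegative families this agrees with \<^term>\<open>MAX j\<in>F. h j\<close>, but it also makes sense for
  \<open>F = {}\<close>; that case is needed when an index set \<open>F <+> G\<close> is split into its two sides.
\<close>

definition max0 :: "'j set \<Rightarrow> ('j \<Rightarrow> real) \<Rightarrow> real" where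
  "max0 F h = Max (insert 0 (h ` F))"

lemma max0_empty [simp]: "max0 {} h = 0"
  by (simp add: max0_def)

lemma max0_insert: "finite F \<Longrightarrow> max0 (insert j F) h = max (h j) (max0 F h)"
  unfolding max0_def by (cases "F = {}") (auto simp: insert_commute max.commute)

lemma max0_nonneg [simp]: "finite F \<Longrightarrow> 0 \<le> max0 F h"
  by (simp add: max0_def)

lemma max0_le_iff: "finite F \<Longrightarrow> max0 F h \<le> r \<longleftrightarrow> 0 \<le> r \<and> (\<forall>j\<in>F. h j \<le> r)"
  by (simp add: max0_def)

lemma le_max0: "finite F \<Longrightarrow> j \<in> F \<Longrightarrow> h j \<le> max0 F h"
  by (simp add: max0_def)

lemma max0_cong: "(\<And>j. j \<in> F \<Longrightarrow> h j = k j) \<Longrightarrow> max0 F h = max0 F k"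
  unfolding max0_def by (metis (mono_tags, lifting) image_cong)

lemma max0_zero: "finite F \<Longrightarrow> max0 F (\<lambda>j. 0) = 0"
  by (simp add: antisym max0_le_iff)

lemma Max_eq_max0:
  assumes "finite F" "F \<noteq> {}" "\<And>j. j \<in> F \<Longrightarrow> 0 \<le> h j"
  shows "(MAX j\<in>F. h j) = max0 F h"
proof -
  obtain j where "j \<in> F" using assms by auto
  then have "0 \<le> (MAX j\<in>F. h j)" using assms by (auto simp: Max_ge_iff)
  then show ?thesis
    using assms by (simp add: max0_def)
qed

lemma max0_mult: "finite F \<Longrightarrow> 0 \<le> c \<Longrightarrow> max0 F (\<lambda>j. c * h j) = c * max0 F h"
proof (induction F rule: finite_induct)
  case (insert j F)
  then show ?case by (simp add: max0_insert max_mult_distrib_left)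
qed simp

lemma max0_powr:
  assumes "finite F" "\<And>j. j \<in> F \<Longrightarrow> 0 \<le> h j" "0 < \<alpha>"
  shows "max0 F h powr \<alpha> = max0 F (\<lambda>j. h j powr \<alpha>)"
  using assms(1,2)
proof (induction F rule: finite_induct)
  case (insert j F)
  have mono: "max a b powr \<alpha> = max (a powr \<alpha>) (b powr \<alpha>)" if "0 \<le> a" "0 \<le> b" for a b
  proof (cases "a \<le> b")
    case True
    then have "a powr \<alpha> \<le> b powr \<alpha>" using that \<open>0 < \<alpha>\<close> by (intro powr_mono2) auto
    with True show ?thesis by (simp only: max_absorb2)
  next
    case False
    then have "b powr \<alpha> \<le> a powr \<alpha>" using that \<open>0 < \<alpha>\<close> by (intro powr_mono2) auto
    with False show ?thesis by (simp only: max_absorb1 not_le less_imp_le)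
  qed
  have "max (h j) (max0 F h) powr \<alpha> = max (h j powr \<alpha>) (max0 F h powr \<alpha>)"
    using insert.prems insert.hyps(1) by (intro mono) auto
  then show ?case using insert by (simp add: max0_insert)
qed (use \<open>0 < \<alpha>\<close> in simp)

text \<open>
  Taking \<open>\<alpha>\<close>-th powers turns the integrand of a spectral representation into a maximum that is
  linear in the powers \<open>f\<^sub>t\<^sup>\<alpha>\<close>; every integral below is computed in this form.
\<close>

lemma Max_powr_eq_max0:
  assumes "finite F" "F \<noteq> {}" "\<And>j. j \<in> F \<Longrightarrow> 0 \<le> y j" "\<And>j. j \<in> F \<Longrightarrow> 0 \<le> h j" "0 < \<alpha>"
  shows "(MAX j\<in>F. y j * h j) powr \<alpha> = max0 F (\<lambda>j. y j powr \<alpha> * h j powr \<alpha>)"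
  using assms by (simp add: Max_eq_max0 max0_powr powr_mult cong: max0_cong)

text \<open>
  This Lipschitz bound transfers \<^const>\<open>rho\<close>-convergence from single functions to finite maxima.
\<close>

lemma max0_diff_le_sum:
  assumes "finite F"
  shows "\<bar>max0 F h - max0 F k\<bar> \<le> (\<Sum>j\<in>F. \<bar>h j - k j\<bar>)"
  using assms
proof (induction F rule: finite_induct)
  case (insert j F)
  then show ?case by (simp add: max0_insert)
qed simp

lemma max0_measurable [measurable (raw)]:
  assumes "finite F" "\<And>j. j \<in> F \<Longrightarrow> (\<lambda>s. h s j) \<in> borel_measurable \<mu>"
  shows "(\<lambda>s. max0 F (h s)) \<in> borel_measurable \<mu>"
  using assms
  by (induction F rule: finite_induct) (auto simp: max0_insert)

lemma max0_integrable:
  assumes "finite F" "\<And>j. j \<in> F \<Longrightarrow> integrable \<mu> (\<lambda>s. h s j)"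
  shows "integrable \<mu> (\<lambda>s. max0 F (h s))"
  using assms
  by (induction F rule: finite_induct) (auto simp: max0_insert)

section \<open>Laws of nonnegative processes\<close>

lemma sets_all_le:
  fixes Z :: "'t \<Rightarrow> 'a \<Rightarrow> real"
  assumes "finite F" "\<And>t. t \<in> F \<Longrightarrow> Z t \<in> borel_measurable m"
  shows "{\<omega> \<in> space m. \<forall>t\<in>F. Z t \<omega> \<le> x t} \<in> sets m"
proof (rule sets.sets_Collect_finite_All)
  show "{\<omega> \<in> space m. Z t \<omega> \<le> x t} \<in> sets m" if "t \<in> F" for t
    using assms(2)[OF that] by simp
qed (rule assms(1))

text \<open>
  The half-spaces form a generator that is stable under intersection, so a finite measure on the
  product space is determined by its joint distribution functions.
\<close>

lemma sets_PiM_halfspaces: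
  fixes T :: "'t set"
  defines "\<Omega> \<equiv> space (PiM T (\<lambda>_. borel :: real measure))"
  shows "sets (PiM T (\<lambda>_. borel)) =
    sigma_sets \<Omega> {{z \<in> \<Omega>. \<forall>t\<in>F. z t \<le> x t} | F (x :: 't \<Rightarrow> real). finite F \<and> F \<subseteq> T}"
    (is "?L = sigma_sets \<Omega> ?G")
proof
  have G: "?G \<subseteq> Pow \<Omega>" by auto
  let ?N = "sigma \<Omega> ?G"
  have spN: "space ?N = \<Omega>" using G by simp
  have setsN: "sets ?N = sigma_sets \<Omega> ?G" using G by simp
  have "(\<lambda>z t. z t) \<in> measurable ?N (PiM T (\<lambda>_. borel :: real measure))"
  proof (rule measurable_PiM_single')
    fix t assume t: "t \<in> T"
    show "(\<lambda>z. z t) \<in> borel_measurable ?N"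
    proof (subst borel_measurable_iff_le, intro allI)
      fix a :: real
      have "{w \<in> \<Omega>. \<forall>s\<in>{t}. w s \<le> (\<lambda>_. a) s} \<in> ?G"
        using t by (intro CollectI exI[of _ "{t}"] exI[of _ "\<lambda>_. a"]) auto
      then show "{w \<in> space ?N. w t \<le> a} \<in> sets ?N"
        unfolding spN setsN by (intro sigma_sets.Basic) simp
    qed
  qed (use spN in \<open>simp add: \<Omega>_def space_PiM\<close>)
  then have id: "(\<lambda>z. z) \<in> measurable ?N (PiM T (\<lambda>_. borel :: real measure))"
    by simp
  show "?L \<subseteq> sigma_sets \<Omega> ?G"
  proof
    fix A assume A: "A \<in> ?L"
    then have "A \<subseteq> \<Omega>" unfolding \<Omega>_def by (rule sets.sets_into_space)
    with measurable_sets[OF id A] show "A \<in> sigma_sets \<Omega> ?G"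
      unfolding setsN spN by (simp add: Int_absorb2)
  qed
  show "sigma_sets \<Omega> ?G \<subseteq> ?L"
    unfolding \<Omega>_def
  proof (rule sets.sigma_sets_subset, safe)
    fix F and x :: "'t \<Rightarrow> real" assume "finite F" "F \<subseteq> T"
    then show "{z \<in> space (PiM T (\<lambda>_. borel :: real measure)). \<forall>t\<in>F. z t \<le> x t} \<in> ?L"
      by (intro sets_all_le[where Z="\<lambda>t z. z t"] measurable_component_singleton) auto
  qed
qed

lemma measure_all_le_negative:
  fixes Z :: "'t \<Rightarrow> 'a \<Rightarrow> real"
  assumes "finite F" "\<And>t. t \<in> F \<Longrightarrow> Z t \<in> borel_measurable m"
    and "t \<in> F" "x t < 0" "AE \<omega> in m. 0 \<le> Z t \<omega>"
  shows "measure m {\<omega> \<in> space m. \<forall>t\<in>F. Z t \<omega> \<le> x t} = 0"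
proof -
  have "AE \<omega> in m. \<not> (\<forall>t\<in>F. Z t \<omega> \<le> x t)"
    using assms(5) by eventually_elim (use assms(3,4) in force)
  moreover have "{\<omega> \<in> space m. \<forall>t\<in>F. Z t \<omega> \<le> x t} \<in> sets m"
    using sets_all_le assms(1,2) .
  ultimately have "{\<omega> \<in> space m. \<forall>t\<in>F. Z t \<omega> \<le> x t} \<in> null_sets m"
    by (subst AE_iff_null_sets) (simp_all only: mem_Collect_eq, auto elim: eventually_mono)
  then show ?thesis by (simp add: measure_eq_0_null_sets)
qed

text \<open>
  Distribution functions are only prescribed at positive levels; right-continuity reaches
  level \<open>0\<close>.
\<close>

lemma measure_all_le_right_limit:
  fixes Z :: "'t \<Rightarrow> 'a \<Rightarrow> real"
  assumes "finite_measure m" "finite F" "\<And>t. t \<in> F \<Longrightarrow> Z t \<in> borel_measurable m"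
  shows "(\<lambda>n. measure m {\<omega> \<in> space m. \<forall>t\<in>F. Z t \<omega> \<le> x t + 1 / real (Suc n)})
     \<longlonglongrightarrow> measure m {\<omega> \<in> space m. \<forall>t\<in>F. Z t \<omega> \<le> x t}"
proof -
  interpret finite_measure m by fact
  let ?A = "\<lambda>n. {\<omega> \<in> space m. \<forall>t\<in>F. Z t \<omega> \<le> x t + 1 / real (Suc n)}"
  have "(\<lambda>n. measure m (?A n)) \<longlonglongrightarrow> measure m (\<Inter>n. ?A n)"
  proof (rule finite_Lim_measure_decseq)
    show "range ?A \<subseteq> sets m" using sets_all_le[OF assms(2,3)] by auto
    show "decseq ?A"
    proof (rule decseq_SucI, safe)
      fix n \<omega> t assume a: "\<forall>t\<in>F. Z t \<omega> \<le> x t + 1 / real (Suc (Suc n))" "t \<in> F"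
      have "1 / real (Suc (Suc n)) \<le> 1 / real (Suc n)" by (simp add: frac_le)
      with a show "Z t \<omega> \<le> x t + 1 / real (Suc n)" by force
    qed
  qed
  moreover have "(\<Inter>n. ?A n) = {\<omega> \<in> space m. \<forall>t\<in>F. Z t \<omega> \<le> x t}"
  proof safe
    fix \<omega> t assume a: "\<omega> \<in> (\<Inter>n. ?A n)" "t \<in> F"
    have "(\<lambda>n. x t + 1 / real (Suc n)) \<longlonglongrightarrow> x t + 0"
      by (intro tendsto_add tendsto_const LIMSEQ_Suc[OF lim_1_over_n])
    then have "Z t \<omega> \<le> x t + 0"
      by (rule LIMSEQ_le_const) (use a in auto)
    then show "Z t \<omega> \<le> x t" by simp
  next
    fix \<omega> n t assume "\<forall>t\<in>F. Z t \<omega> \<le> x t" "t \<in> F"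
    then have "Z t \<omega> + 0 \<le> x t + 1 / real (Suc n)" by (intro add_mono) auto
    then show "Z t \<omega> \<le> x t + 1 / real (Suc n)" by simp
  qed auto
  ultimately show ?thesis by simp
qed

text \<open>
  A process that is almost surely nonnegative has distribution function \<open>0\<close> at negative levels and is
  right-continuous at \<open>0\<close>, so positive levels suffice. The measures are merely finite, and the
  lemma is used for probability measures as well as for spectral measures; the family \<open>F = {}\<close>
  compares the total masses.
\<close>

lemma nonneg_process_law_eqI:
  fixes Z :: "'t \<Rightarrow> 'a \<Rightarrow> real" and Z' :: "'t \<Rightarrow> 'b \<Rightarrow> real"
  assumes fin: "finite_measure m" "finite_measure m'"
    and Z: "\<And>t. t \<in> T \<Longrightarrow> Z t \<in> borel_measurable m" "\<And>t. t \<in> T \<Longrightarrow> AE \<omega> in m. 0 \<le> Z t \<omega>"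
    and Z': "\<And>t. t \<in> T \<Longrightarrow> Z' t \<in> borel_measurable m'" "\<And>t. t \<in> T \<Longrightarrow> AE \<omega> in m'. 0 \<le> Z' t \<omega>"
    and eq: "\<And>F x. finite F \<Longrightarrow> F \<subseteq> T \<Longrightarrow> (\<And>t. t \<in> F \<Longrightarrow> 0 < x t) \<Longrightarrow>
      measure m {\<omega> \<in> space m. \<forall>t\<in>F. Z t \<omega> \<le> x t} = measure m' {\<omega> \<in> space m'. \<forall>t\<in>F. Z' t \<omega> \<le> x t}"
  shows "distr m (PiM T (\<lambda>_. borel)) (\<lambda>\<omega>. \<lambda>t\<in>T. Z t \<omega>) = distr m' (PiM T (\<lambda>_. borel)) (\<lambda>\<omega>. \<lambda>t\<in>T. Z' t \<omega>)"
    (is "?D = ?D'")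
proof -
  interpret m: finite_measure m by fact
  interpret m': finite_measure m' by fact
  let ?Pi = "PiM T (\<lambda>_. borel :: real measure)"
  have meas [measurable]: "(\<lambda>\<omega>. \<lambda>t\<in>T. Z t \<omega>) \<in> measurable m ?Pi" "(\<lambda>\<omega>. \<lambda>t\<in>T. Z' t \<omega>) \<in> measurable m' ?Pi"
    using Z(1) Z'(1) by (auto intro!: measurable_restrict)
  have all: "measure m {\<omega> \<in> space m. \<forall>t\<in>F. Z t \<omega> \<le> x t} = measure m' {\<omega> \<in> space m'. \<forall>t\<in>F. Z' t \<omega> \<le> x t}"
    if F: "finite F" "F \<subseteq> T" for F and x :: "'t \<Rightarrow> real"
  proof (cases "\<exists>t\<in>F. x t < 0")
    case True
    then obtain t where t: "t \<in> F" "x t < 0" by auto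
    have "measure m {\<omega> \<in> space m. \<forall>t\<in>F. Z t \<omega> \<le> x t} = 0"
      by (rule measure_all_le_negative[of F Z m t x]) (use t F in \<open>auto intro: Z\<close>)
    moreover have "measure m' {\<omega> \<in> space m'. \<forall>t\<in>F. Z' t \<omega> \<le> x t} = 0"
      by (rule measure_all_le_negative[of F Z' m' t x]) (use t F in \<open>auto intro: Z'\<close>)
    ultimately show ?thesis by simp
  next
    case False
    have "0 < x t + 1 / real (Suc n)" if "t \<in> F" for t n
      using False that by (intro add_nonneg_pos) (auto simp: not_less)
    then have "measure m {\<omega> \<in> space m. \<forall>t\<in>F. Z t \<omega> \<le> x t + 1 / real (Suc n)} =
        measure m' {\<omega> \<in> space m'. \<forall>t\<in>F. Z' t \<omega> \<le> x t + 1 / real (Suc n)}" for n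
      using eq[OF F, of "\<lambda>t. x t + 1 / real (Suc n)"] by blast
    then show ?thesis
      using measure_all_le_right_limit[OF fin(1) F(1), of Z x] measure_all_le_right_limit[OF fin(2) F(1), of Z' x]
        F Z(1) Z'(1) by (simp add: LIMSEQ_unique subset_eq)
  qed
  let ?G = "{{z \<in> space ?Pi. \<forall>t\<in>F. z t \<le> x t} | F (x :: 't \<Rightarrow> real). finite F \<and> F \<subseteq> T}"
  show ?thesis
  proof (rule measure_eqI_generator_eq)
    show "Int_stable ?G"
    proof (rule Int_stableI, clarify)
      fix F F' :: "'t set" and x x' :: "'t \<Rightarrow> real"
      assume F: "finite F" "F \<subseteq> T" "finite F'" "F' \<subseteq> T"
      let ?y = "\<lambda>t. if t \<in> F then if t \<in> F' then min (x t) (x' t) else x t else x' t"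
      have "{z \<in> space ?Pi. \<forall>t\<in>F. z t \<le> x t} \<inter> {z \<in> space ?Pi. \<forall>t\<in>F'. z t \<le> x' t}
          = {z \<in> space ?Pi. \<forall>t\<in>F \<union> F'. z t \<le> ?y t}"
        by (auto split: if_splits)
      then show "\<exists>Fa xa. {z \<in> space ?Pi. \<forall>t\<in>F. z t \<le> x t} \<inter> {z \<in> space ?Pi. \<forall>t\<in>F'. z t \<le> x' t}
          = {z \<in> space ?Pi. \<forall>t\<in>Fa. z t \<le> xa t} \<and> finite Fa \<and> Fa \<subseteq> T"
        using F by (intro exI[of _ "F \<union> F'"] exI[of _ ?y]) simp
    qed
    show "?G \<subseteq> Pow (space ?Pi)" by auto
    show "sets ?D = sigma_sets (space ?Pi) ?G" "sets ?D' = sigma_sets (space ?Pi) ?G"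
      using sets_PiM_halfspaces[of T] by auto
    show "range (\<lambda>_::nat. space ?Pi) \<subseteq> ?G" by (auto intro!: exI[of _ "{}"])
    show "emeasure ?D (space ?Pi) \<noteq> \<infinity>"
      by (subst emeasure_distr) (auto simp: m.emeasure_eq_measure)
  next
    fix A assume A: "A \<in> ?G"
    then obtain F x where F: "finite F" "F \<subseteq> T" and Ax: "A = {z \<in> space ?Pi. \<forall>t\<in>F. z t \<le> x t}"
      by auto
    have "A \<in> sets ?Pi" using A sets_PiM_halfspaces[of T] by (auto intro: sigma_sets.Basic)
    moreover have "(\<lambda>\<omega>. \<lambda>t\<in>T. Z t \<omega>) -` A \<inter> space m = {\<omega> \<in> space m. \<forall>t\<in>F. Z t \<omega> \<le> x t}"
      "(\<lambda>\<omega>. \<lambda>t\<in>T. Z' t \<omega>) -` A \<inter> space m' = {\<omega> \<in> space m'. \<forall>t\<in>F. Z' t \<omega> \<le> x t}"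
      using F unfolding Ax by (auto simp: space_PiM subset_eq)
    ultimately show "emeasure ?D A = emeasure ?D' A"
      using all[OF F, of x] by (simp add: emeasure_distr m.emeasure_eq_measure m'.emeasure_eq_measure)
  qed auto
qed

section \<open>Random sup-measures on half-spaces\<close>

text \<open>
  \<open>B\<close> is the disjoint union of \<open>A\<close> and \<open>B - A\<close>, and the measure of a union is a supremum.
\<close>

lemma random_sup_measure_mono:
  assumes "random_sup_measure P \<alpha> \<mu> M" "A \<in> sets \<mu>" "B \<in> sets \<mu>" "A \<subseteq> B"
  shows "AE \<omega> in P. M A \<omega> \<le> M B \<omega>"
proof -
  let ?C = "binaryset A (B - A)"
  have "range ?C \<subseteq> sets \<mu>" "disjoint_family ?C"
    using assms by (auto simp: range_binaryset_eq disjoint_family_on_def binaryset_def)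
  with assms(1) have "AE \<omega> in P. M (\<Union>i. ?C i) \<omega> = (SUP i. M (?C i) \<omega>)"
    unfolding random_sup_measure_def by blast
  moreover have "(\<Union>i. ?C i) = B" using assms(4) by (auto simp: UN_binaryset_eq)
  ultimately have "AE \<omega> in P. M B \<omega> = (SUP i. M (?C i) \<omega>)" by simp
  then show ?thesis
  proof eventually_elim
    case (elim \<omega>)
    have "M (?C 0) \<omega> \<le> (SUP i. M (?C i) \<omega>)" by (rule SUP_upper) simp
    then show ?case using elim by (simp add: binaryset_def)
  qed
qed

lemma random_sup_measure_tail:
  assumes "prob_space P" "0 < \<alpha>" "random_sup_measure P \<alpha> \<mu> M"
    and "A \<in> sets \<mu>" "emeasure \<mu> A < \<infinity>" "0 < c"
  shows "measure P (M A -` {..ennreal c} \<inter> space P) = exp (- (measure \<mu> A * c powr (- \<alpha>)))"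
proof -
  interpret prob_space P by fact
  have M [measurable]: "M A \<in> borel_measurable P" 
    and fin: "AE \<omega> in P. M A \<omega> < \<infinity>"
    and fr: "frechet_rv P \<alpha> (measure \<mu> A powr (1 / \<alpha>)) (\<lambda>\<omega>. enn2real (M A \<omega>))"
    using assms unfolding random_sup_measure_def by auto
  have "M A -` {..ennreal c} \<inter> space P = {\<omega> \<in> space P. M A \<omega> \<le> ennreal c}" by auto
  moreover have "measure P {\<omega> \<in> space P. M A \<omega> \<le> ennreal c} = measure P {\<omega> \<in> space P. enn2real (M A \<omega>) \<le> c}"
  proof (rule finite_measure_eq_AE)
    show "AE \<omega> in P. \<omega> \<in> {\<omega> \<in> space P. M A \<omega> \<le> ennreal c} \<longleftrightarrow> \<omega> \<in> {\<omega> \<in> space P. enn2real (M A \<omega>) \<le> c}"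
      using fin
    proof eventually_elim
      case (elim \<omega>)
      then show ?case using \<open>0 < c\<close> by (cases "M A \<omega>") auto
    qed
  qed auto
  ultimately show ?thesis
    using fr assms(2,6) unfolding frechet_rv_def by (simp add: powr_powr)
qed

text \<open>
  Independence is available only for disjoint sets. If the constraints are ordered by increasing
  level, then the part of a set that lies in an earlier set is already subject to a stronger
  constraint. Hence the sets can be replaced by their disjoint differences, and the probability
  becomes a product of one-dimensional Frechet distribution functions. On the difference belonging to
  a level \<open>c\<close> the maximum of all \<open>c\<^sub>l\<^sup>-\<^sup>\<alpha>\<close> is just \<open>c\<^sup>-\<^sup>\<alpha>\<close>, which identifies the exponent.
\<close>

lemma random_sup_measure_halfspaces:
  fixes B :: "'l \<Rightarrow> 's set" and c :: "'l \<Rightarrow> real"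
  assumes P: "prob_space P" and \<alpha>: "0 < \<alpha>" and M: "random_sup_measure P \<alpha> \<mu> M"
    and L: "finite L" and B: "\<And>l. l \<in> L \<Longrightarrow> B l \<in> sets \<mu>" "\<And>l. l \<in> L \<Longrightarrow> emeasure \<mu> (B l) < \<infinity>"
    and c: "\<And>l. l \<in> L \<Longrightarrow> 0 < c l"
  shows "measure P {\<omega> \<in> space P. \<forall>l\<in>L. M (B l) \<omega> \<le> ennreal (c l)} =
    exp (- (\<integral>s. max0 L (\<lambda>l. c l powr (- \<alpha>) * indicator (B l) s) \<partial>\<mu>))"
proof (cases "L = {}")
  case True
  interpret prob_space P by fact
  from True show ?thesis by (simp add: prob_space)
next
  case False
  interpret prob_space P by fact
  obtain ys where ys: "set ys = L" using finite_list[OF L] by auto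
  \<comment> \<open>Sorting by level makes an earlier constraint the stronger one.\<close>
  define xs where "xs = sort_key c ys"
  have xs: "set xs = L" "sorted (map c xs)" by (simp_all add: xs_def ys)
  define n where "n = length xs"
  have n: "0 < n" using False xs(1) by (auto simp: n_def)
  define b where "b i = (if i < n then B (xs ! i) else {})" for i
  define d where "d i = c (xs ! i)" for i
  define D where "D = disjointed b"
  have xsL: "xs ! i \<in> L" if "i < n" for i using that xs(1) by (auto simp: n_def)
  have Lxs: "\<exists>i<n. xs ! i = l" if "l \<in> L" for l
    using that xs(1) by (metis in_set_conv_nth n_def)
  have d_pos: "0 < d i" if "i < n" for i using c[OF xsL[OF that]] by (simp add: d_def)
  have d_mono: "d i \<le> d j" if "i \<le> j" "j < n" for i j
    using sorted_nth_mono[OF xs(2), of i j] that by (simp add: d_def n_def)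
  have b_sets: "b i \<in> sets \<mu>" for i using B(1) xsL by (auto simp: b_def)
  then have rb: "range b \<subseteq> sets \<mu>" by auto
  have D_sets: "D i \<in> sets \<mu>" for i
    using sets.range_disjointed_sets[OF rb] by (auto simp: D_def)
  have D_disj: "disjoint_family D" by (simp add: D_def disjoint_family_disjointed)
  have D_sub: "D i \<subseteq> b i" for i by (simp add: D_def disjointed_subset)
  have D_fin: "emeasure \<mu> (D i) < \<infinity>" if "i < n" for i
    using emeasure_mono[OF D_sub b_sets, of i] B(2)[OF xsL[OF that]] that
    by (simp add: b_def order.strict_trans1)
  have M_meas: "M A \<in> borel_measurable P" if "A \<in> sets \<mu>" for A
    using M that unfolding random_sup_measure_def by blast

  have "AE \<omega> in P. (\<forall>i. M (D i) \<omega> \<le> M (b i) \<omega>)"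
    using random_sup_measure_mono[OF M D_sets b_sets D_sub] by (simp add: AE_all_countable)
  \<comment> \<open>The sequences below are padded with the empty set, whose value is bounded by that of the first set.\<close>
  moreover have "AE \<omega> in P. M {} \<omega> \<le> M (D 0) \<omega>"
    using random_sup_measure_mono[OF M _ D_sets[of 0]] by simp
  moreover have "AE \<omega> in P. (\<forall>i. M (b i) \<omega> \<le> (SUP j. M (if j \<le> i then D j else {}) \<omega>))"
    unfolding AE_all_countable
  proof
    fix i
    \<comment> \<open>The first \<open>i + 1\<close> differences cover \<open>b i\<close>, and their levels are at most \<open>d i\<close>.\<close>
    let ?E = "\<lambda>j. if j \<le> i then D j else {}"
    have "range ?E \<subseteq> sets \<mu>" "disjoint_family ?E"
      using D_sets D_disj by (auto simp: disjoint_family_on_def)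
    then have "AE \<omega> in P. M (\<Union>j. ?E j) \<omega> = (SUP j. M (?E j) \<omega>)"
      using M unfolding random_sup_measure_def by blast
    moreover have "(\<Union>j. ?E j) = (\<Union>j\<in>{0..<Suc i}. D j)"
      by (auto split: if_splits simp: less_Suc_eq_le Bex_def)
    then have "b i \<subseteq> (\<Union>j. ?E j)" unfolding D_def finite_UN_disjointed_eq by auto
    then have "AE \<omega> in P. M (b i) \<omega> \<le> M (\<Union>j. ?E j) \<omega>"
      using D_sets by (intro random_sup_measure_mono[OF M b_sets]) auto
    ultimately show "AE \<omega> in P. M (b i) \<omega> \<le> (SUP j. M (?E j) \<omega>)"
      by eventually_elim simp
  qed
  ultimately have "AE \<omega> in P. (\<forall>l\<in>L. M (B l) \<omega> \<le> ennreal (c l)) \<longleftrightarrow> (\<forall>i<n. M (D i) \<omega> \<le> ennreal (d i))"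
  proof eventually_elim
    case (elim \<omega>)
    show ?case
    proof safe
      fix i assume "\<forall>l\<in>L. M (B l) \<omega> \<le> ennreal (c l)" "i < n"
      then have "M (b i) \<omega> \<le> ennreal (d i)" using xsL by (auto simp: b_def d_def)
      then show "M (D i) \<omega> \<le> ennreal (d i)" using elim(1) order_trans by blast
    next
      fix l assume D: "\<forall>i<n. M (D i) \<omega> \<le> ennreal (d i)" and "l \<in> L"
      then obtain i where i: "i < n" "xs ! i = l" using Lxs by blast
      have "M (if j \<le> i then D j else {}) \<omega> \<le> ennreal (d i)" for j
      proof (cases "j \<le> i")
        case True
        then have "M (D j) \<omega> \<le> ennreal (d j)" using D i by auto
        also have "\<dots> \<le> ennreal (d i)" using d_mono[OF True i(1)] by (rule ennreal_leI)
        finally show ?thesis using True by simp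
      next
        case False
        have "M {} \<omega> \<le> ennreal (d 0)" using elim(2) D n order_trans by blast
        also have "\<dots> \<le> ennreal (d i)" using d_mono[of 0 i] i by (simp add: ennreal_leI)
        finally show ?thesis using False by simp
      qed
      then have "(SUP j. M (if j \<le> i then D j else {}) \<omega>) \<le> ennreal (d i)" by (intro SUP_least)
      then have "M (b i) \<omega> \<le> ennreal (d i)" using elim(3) order_trans by blast
      then show "M (B l) \<omega> \<le> ennreal (c l)" using i by (simp add: b_def d_def)
    qed
  qed
  then have "measure P {\<omega> \<in> space P. \<forall>l\<in>L. M (B l) \<omega> \<le> ennreal (c l)} =
      measure P (\<Inter>i\<in>{..<n}. M (D i) -` {..ennreal (d i)} \<inter> space P)"
  proof (intro finite_measure_eq_AE)
    show "{\<omega> \<in> space P. \<forall>l\<in>L. M (B l) \<omega> \<le> ennreal (c l)} \<in> sets P"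
      using M_meas[OF B(1)] by (intro sets.sets_Collect_finite_All L) measurable
    show "(\<Inter>i\<in>{..<n}. M (D i) -` {..ennreal (d i)} \<inter> space P) \<in> sets P"
      using n M_meas[OF D_sets] by (intro sets.finite_INT measurable_sets) auto
  qed (use n in \<open>auto elim!: eventually_mono\<close>)
  also have "\<dots> = (\<Prod>i<n. measure P (M (D i) -` {..ennreal (d i)} \<inter> space P))"
  proof (rule indep_varsD)
    show "indep_vars (\<lambda>_. borel) (\<lambda>i. M (D i)) UNIV"
      using M D_sets D_disj unfolding random_sup_measure_def by blast
  qed (use n in auto)
  also have "\<dots> = (\<Prod>i<n. exp (- (measure \<mu> (D i) * d i powr (- \<alpha>))))"
    using random_sup_measure_tail[OF P \<alpha> M D_sets D_fin d_pos] by (intro prod.cong) auto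
  also have "\<dots> = exp (- (\<Sum>i<n. d i powr (- \<alpha>) * measure \<mu> (D i)))"
    by (simp add: exp_sum[symmetric] sum_negf mult.commute)
  also have "(\<Sum>i<n. d i powr (- \<alpha>) * measure \<mu> (D i)) = (\<integral>s. (\<Sum>i<n. d i powr (- \<alpha>) * indicator (D i) s) \<partial>\<mu>)"
    using D_sets D_fin by (subst Bochner_Integration.integral_sum) auto
  also have "\<dots> = (\<integral>s. max0 L (\<lambda>l. c l powr (- \<alpha>) * indicator (B l) s) \<partial>\<mu>)"
  proof (intro Bochner_Integration.integral_cong refl)
    fix s
    show "(\<Sum>i<n. d i powr (- \<alpha>) * indicator (D i) s) = max0 L (\<lambda>l. c l powr (- \<alpha>) * indicator (B l) s)"
    proof (cases "\<exists>i<n. s \<in> D i")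
      case True
      then obtain i where i: "i < n" "s \<in> D i" by auto
      have nb: "s \<notin> b j" if "j < i" for j using i(2) that by (auto simp: D_def disjointed_def)
      have "(\<Sum>j<n. d j powr (- \<alpha>) * indicator (D j) s) = (\<Sum>j\<in>{i}. d j powr (- \<alpha>) * indicator (D j) s)"
        using i D_disj by (intro sum.mono_neutral_right)
          (auto simp: disjoint_family_on_def indicator_def)
      also have "\<dots> = d i powr (- \<alpha>)" using i by simp
      also have "\<dots> = max0 L (\<lambda>l. c l powr (- \<alpha>) * indicator (B l) s)"
      proof (rule antisym)
        have "s \<in> B (xs ! i)" using i D_sub[of i] by (auto simp: b_def split: if_splits)
        then show "d i powr (- \<alpha>) \<le> max0 L (\<lambda>l. c l powr (- \<alpha>) * indicator (B l) s)"
          using le_max0[OF L xsL[OF i(1)], of "\<lambda>l. c l powr (- \<alpha>) * indicator (B l) s"]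
          by (simp add: d_def)
        show "max0 L (\<lambda>l. c l powr (- \<alpha>) * indicator (B l) s) \<le> d i powr (- \<alpha>)"
          unfolding max0_le_iff[OF L]
        proof safe
          fix l assume "l \<in> L"
          then obtain j where j: "j < n" "xs ! j = l" using Lxs by blast
          show "c l powr (- \<alpha>) * indicator (B l) s \<le> d i powr (- \<alpha>)"
          proof (cases "s \<in> B l")
            case True
            then have "i \<le> j" using nb[of j] j by (auto simp: b_def not_less[symmetric])
            then have "d i \<le> c l" using d_mono[of i j] j by (simp add: d_def)
            then show ?thesis using True d_pos[OF i(1)] \<alpha> by (simp add: powr_mono2')
          qed simp
        qed simp
      qed
      finally show ?thesis .
    next
      case False
      have "s \<notin> (\<Union>i\<in>{0..<n}. D i)" using False by auto
      then have "s \<notin> b i" if "i < n" for i using that unfolding D_def finite_UN_disjointed_eq by auto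
      then have "indicator (B l) s = (0::real)" if "l \<in> L" for l
        using Lxs[OF that] by (auto simp: b_def)
      then have "max0 L (\<lambda>l. c l powr (- \<alpha>) * indicator (B l) s) = max0 L (\<lambda>l. 0)"
        by (intro max0_cong) simp
      then show ?thesis using False L by (simp add: max0_zero)
    qed
  qed
  finally show ?thesis .
qed

section \<open>Extremal integrals give spectral representations\<close>

text \<open>
  The negative logarithm of the distribution function at the level \<open>x\<close> of a process with spectral
  functions \<open>f\<close>.
\<close>

definition exponent :: "real \<Rightarrow> 's measure \<Rightarrow> ('j \<Rightarrow> 's \<Rightarrow> real) \<Rightarrow> 'j set \<Rightarrow> ('j \<Rightarrow> real) \<Rightarrow> real" where
  "exponent \<alpha> \<mu> f F x = (\<integral>s. max0 F (\<lambda>j. inverse (x j) powr \<alpha> * f j s powr \<alpha>) \<partial>\<mu>)"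

lemma exponent_empty [simp]: "exponent \<alpha> \<mu> f {} x = 0"
  by (simp add: exponent_def)

text \<open>
  Homogeneity of degree \<open>-\<alpha>\<close>.
\<close>

lemma exponent_scale:
  assumes "finite F" "0 < c" "\<And>j. j \<in> F \<Longrightarrow> 0 < x j"
  shows "exponent \<alpha> \<mu> f F (\<lambda>j. c * x j) = c powr (- \<alpha>) * exponent \<alpha> \<mu> f F x"
proof -
  have "max0 F (\<lambda>j. inverse (c * x j) powr \<alpha> * f j s powr \<alpha>) =
      c powr (- \<alpha>) * max0 F (\<lambda>j. inverse (x j) powr \<alpha> * f j s powr \<alpha>)" for s
  proof -
    have "inverse (c * x j) powr \<alpha> = c powr (- \<alpha>) * inverse (x j) powr \<alpha>" if "j \<in> F" for j
      using assms(2) assms(3)[OF that] by (simp add: inverse_powr powr_mult powr_minus)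
    then have "max0 F (\<lambda>j. inverse (c * x j) powr \<alpha> * f j s powr \<alpha>) =
      max0 F (\<lambda>j. c powr (- \<alpha>) * (inverse (x j) powr \<alpha> * f j s powr \<alpha>))"
      by (intro max0_cong) simp
    then show ?thesis using assms by (simp add: max0_mult)
  qed
  then show ?thesis by (simp add: exponent_def)
qed

lemma LplusD:
  assumes "f \<in> Lplus \<alpha> \<mu>"
  shows "f \<in> borel_measurable \<mu>" "\<And>s. s \<in> space \<mu> \<Longrightarrow> 0 \<le> f s" "integrable \<mu> (\<lambda>s. f s powr \<alpha>)"
  using assms by (auto simp: Lplus_def)

lemma exponent_eq_MAX:
  assumes "0 < \<alpha>" "finite F" "F \<noteq> {}" "\<And>t. t \<in> F \<Longrightarrow> f t \<in> Lplus \<alpha> \<mu>" "\<And>t. t \<in> F \<Longrightarrow> 0 < x t"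
  shows "(\<integral>s. (MAX t\<in>F. inverse (x t) * f t s) powr \<alpha> \<partial>\<mu>) = exponent \<alpha> \<mu> f F x"
  unfolding exponent_def using assms
  by (intro Bochner_Integration.integral_cong refl Max_powr_eq_max0)
    (auto intro: LplusD(2) less_imp_le)

lemma simple_fun_eq:
  assumes "disjoint_family_on A {..<n}" "i < n" "s \<in> A i"
  shows "simple_fun n a A s = a i"
proof -
  have "simple_fun n a A s = (\<Sum>j\<in>{i}. a j * indicator (A j) s)"
    unfolding simple_fun_def using assms
    by (intro sum.mono_neutral_right) (auto simp: disjoint_family_on_def indicator_def)
  then show ?thesis using assms by simp
qed

lemma simple_fun_eq_0: "(\<And>i. i < n \<Longrightarrow> s \<notin> A i) \<Longrightarrow> simple_fun n a A s = 0"
  by (simp add: simple_fun_def)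

text \<open>
  Finite scale is required for the Frechet law of \<open>M (A i)\<close>; it follows from integrability as soon
  as the coefficient is positive. Sets with coefficient \<open>0\<close> may have infinite measure.
\<close>

lemma simple_fun_finite_measure:
  assumes "simple_fun n a A \<in> Lplus \<alpha> \<mu>" "disjoint_family_on A {..<n}" 
    and "i < n" "A i \<in> sets \<mu>" "0 < a i"
  shows "emeasure \<mu> (A i) < \<infinity>"
proof -
  have "integrable \<mu> (\<lambda>s. a i powr \<alpha> * indicator (A i) s)"
  proof (rule Bochner_Integration.integrable_bound[OF LplusD(3)[OF assms(1)]])
    show "AE s in \<mu>. norm (a i powr \<alpha> * indicator (A i) s) \<le> norm (simple_fun n a A s powr \<alpha>)"
      using simple_fun_eq[OF assms(2,3)] by (auto simp: indicator_def)
  qed (use assms(4) in auto)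
  then show ?thesis
    using assms(4,5) by (simp add: integrable_indicator_iff less_top Int_absorb2[OF sets.sets_into_space])
qed

text \<open>
  A bound on the supremum is a bound on each \<open>M (A i)\<close> with a positive coefficient; finiteness
  rules out that \<^const>\<open>enn2real\<close> hides an infinite value.
\<close>

lemma simple_extremal_le_iff:
  assumes "\<And>i. i < n \<Longrightarrow> 0 \<le> a i" "\<And>i. i < n \<Longrightarrow> 0 < a i \<Longrightarrow> M (A i) \<omega> < \<infinity>" "0 < x"
  shows "enn2real (simple_extremal_integral M n a A \<omega>) \<le> x \<longleftrightarrow>
    (\<forall>i\<in>{i. i < n \<and> 0 < a i}. M (A i) \<omega> \<le> ennreal (x / a i))"
proof -
  have summand: "ennreal (a i) * M (A i) \<omega> \<le> ennreal x \<longleftrightarrow> (0 < a i \<longrightarrow> M (A i) \<omega> \<le> ennreal (x / a i))" if "i < n" for i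
  proof (cases "0 < a i")
    case True
    obtain r where r: "0 \<le> r" "M (A i) \<omega> = ennreal r" 
      using assms(2)[OF \<open>i < n\<close> True] by (cases "M (A i) \<omega>") auto
    then show ?thesis using True assms(3)
      by (simp add: ennreal_mult[symmetric] pos_le_divide_eq mult.commute)
  next
    case False
    then have "a i = 0" using assms(1)[OF that] by simp
    then show ?thesis by simp
  qed
  have "simple_extremal_integral M n a A \<omega> \<le> (\<Sum>i<n. ennreal (a i) * M (A i) \<omega>)"
    unfolding simple_extremal_integral_def by (intro SUP_least member_le_sum) auto
  also have "\<dots> < top"
  proof -
    have "ennreal (a i) * M (A i) \<omega> < top" if "i < n" for i
      using assms(1,2)[OF that] by (cases "0 < a i") (auto simp: ennreal_mult_less_top ennreal_eq_0_iff)
    then show ?thesis by simp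
  qed
  finally have fin: "simple_extremal_integral M n a A \<omega> < top" .
  then have "enn2real (simple_extremal_integral M n a A \<omega>) \<le> x \<longleftrightarrow> simple_extremal_integral M n a A \<omega> \<le> ennreal x"
    using assms(3) by (cases "simple_extremal_integral M n a A \<omega>") auto
  also have "\<dots> \<longleftrightarrow> (\<forall>i<n. ennreal (a i) * M (A i) \<omega> \<le> ennreal x)"
    unfolding simple_extremal_integral_def by (auto simp: SUP_le_iff)
  finally show ?thesis using summand by auto
qed

lemma simple_extremal_measurable:
  assumes "random_sup_measure P \<alpha> \<mu> M" "\<And>i. i < n \<Longrightarrow> A i \<in> sets \<mu>"
  shows "(\<lambda>\<omega>. enn2real (simple_extremal_integral M n a A \<omega>)) \<in> borel_measurable P"
proof -
  have [measurable]: "M (A i) \<in> borel_measurable P" if "i < n" for i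
    using assms that unfolding random_sup_measure_def by blast
  show ?thesis unfolding simple_extremal_integral_def
    by (rule borel_measurable_enn2real) (rule borel_measurable_SUP, auto)
qed

text \<open>
  The inequalities for several simple functions are together a finite list of constraints
  \<open>M (A j i) \<le> x j / a j i\<close>, to which the law on half-spaces applies. Sets belonging to different
  \<open>j\<close> may overlap.
\<close>

lemma simple_extremal_halfspaces:
  fixes n :: "'j \<Rightarrow> nat" and a :: "'j \<Rightarrow> nat \<Rightarrow> real" and A :: "'j \<Rightarrow> nat \<Rightarrow> 's set" and x :: "'j \<Rightarrow> real"
  assumes P: "prob_space P" and \<alpha>: "0 < \<alpha>" and M: "random_sup_measure P \<alpha> \<mu> M"
    and J: "finite J"
    and a: "\<And>j i. j \<in> J \<Longrightarrow> i < n j \<Longrightarrow> 0 \<le> a j i"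
    and A: "\<And>j i. j \<in> J \<Longrightarrow> i < n j \<Longrightarrow> A j i \<in> sets \<mu>"
    and disj: "\<And>j. j \<in> J \<Longrightarrow> disjoint_family_on (A j) {..<n j}"
    and L: "\<And>j. j \<in> J \<Longrightarrow> simple_fun (n j) (a j) (A j) \<in> Lplus \<alpha> \<mu>"
    and x: "\<And>j. j \<in> J \<Longrightarrow> 0 < x j"
  shows "measure P {\<omega> \<in> space P. \<forall>j\<in>J. enn2real (simple_extremal_integral M (n j) (a j) (A j) \<omega>) \<le> x j} =
    exp (- exponent \<alpha> \<mu> (\<lambda>j. simple_fun (n j) (a j) (A j)) J x)"
proof -
  interpret prob_space P by fact
  define K where "K = (SIGMA j:J. {i. i < n j \<and> 0 < a j i})"
  define B where "B = (\<lambda>(j, i). A j i)"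
  define c where "c = (\<lambda>(j, i). x j / a j i)"
  have K: "finite K" unfolding K_def using J by auto
  have B: "B l \<in> sets \<mu>" "emeasure \<mu> (B l) < \<infinity>" if "l \<in> K" for l
    using that A simple_fun_finite_measure[OF L disj _ A] by (auto simp: K_def B_def)
  have c: "0 < c l" if "l \<in> K" for l using that x by (auto simp: K_def c_def)
  have Mm: "M (B l) \<in> borel_measurable P" "AE \<omega> in P. M (B l) \<omega> < \<infinity>" if "l \<in> K" for l
    using M B[OF that] unfolding random_sup_measure_def by blast+
  have "AE \<omega> in P. \<forall>l\<in>K. M (B l) \<omega> < \<infinity>"
    using Mm K by (auto intro: AE_finite_allI)
  then have "AE \<omega> in P. (\<forall>j\<in>J. enn2real (simple_extremal_integral M (n j) (a j) (A j) \<omega>) \<le> x j) \<longleftrightarrow>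
      (\<forall>l\<in>K. M (B l) \<omega> \<le> ennreal (c l))"
  proof eventually_elim
    case (elim \<omega>)
    have "enn2real (simple_extremal_integral M (n j) (a j) (A j) \<omega>) \<le> x j \<longleftrightarrow>
       (\<forall>i\<in>{i. i < n j \<and> 0 < a j i}. M (A j i) \<omega> \<le> ennreal (x j / a j i))" if "j \<in> J" for j
      using that elim a x by (intro simple_extremal_le_iff) (auto simp: K_def B_def)
    then show ?case by (auto simp: K_def B_def c_def)
  qed
  then have "measure P {\<omega> \<in> space P. \<forall>j\<in>J. enn2real (simple_extremal_integral M (n j) (a j) (A j) \<omega>) \<le> x j} =
      measure P {\<omega> \<in> space P. \<forall>l\<in>K. M (B l) \<omega> \<le> ennreal (c l)}"
  proof (intro finite_measure_eq_AE)
    show "{\<omega> \<in> space P. \<forall>l\<in>K. M (B l) \<omega> \<le> ennreal (c l)} \<in> sets P"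
      using Mm(1) by (intro sets.sets_Collect_finite_All K) measurable
    show "{\<omega> \<in> space P. \<forall>j\<in>J. enn2real (simple_extremal_integral M (n j) (a j) (A j) \<omega>) \<le> x j} \<in> sets P"
      using A by (intro sets_all_le J simple_extremal_measurable[OF M]) auto
  qed (auto elim!: eventually_mono)
  also have "\<dots> = exp (- (\<integral>s. max0 K (\<lambda>l. c l powr (- \<alpha>) * indicator (B l) s) \<partial>\<mu>))"
    by (rule random_sup_measure_halfspaces[OF P \<alpha> M K B c])
  also have "(\<integral>s. max0 K (\<lambda>l. c l powr (- \<alpha>) * indicator (B l) s) \<partial>\<mu>) =
      exponent \<alpha> \<mu> (\<lambda>j. simple_fun (n j) (a j) (A j)) J x"
    unfolding exponent_def
  proof (intro Bochner_Integration.integral_cong refl)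
    fix s
    have ceq: "c (j, i) powr (- \<alpha>) = inverse (x j) powr \<alpha> * a j i powr \<alpha>" if "(j, i) \<in> K" for j i
      using that x[of j] by (auto simp: K_def c_def powr_minus powr_divide inverse_powr divide_simps)
    show "max0 K (\<lambda>l. c l powr (- \<alpha>) * indicator (B l) s) =
      max0 J (\<lambda>j. inverse (x j) powr \<alpha> * simple_fun (n j) (a j) (A j) s powr \<alpha>)" (is "?l = ?r")
    proof (rule antisym)
      show "?l \<le> ?r"
        unfolding max0_le_iff[OF K]
      proof safe
        fix j i assume ji: "(j, i) \<in> K"
        then have j: "j \<in> J" "i < n j" by (auto simp: K_def)
        show "c (j, i) powr (- \<alpha>) * indicator (B (j, i)) s \<le> ?r"
        proof (cases "s \<in> A j i")
          case True
          have "c (j, i) powr (- \<alpha>) * indicator (B (j, i)) s =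
              inverse (x j) powr \<alpha> * simple_fun (n j) (a j) (A j) s powr \<alpha>"
            using True by (simp add: ceq[OF ji] simple_fun_eq[OF disj[OF j(1)] j(2)] B_def)
          also have "\<dots> \<le> ?r" by (rule le_max0[OF J j(1)])
          finally show ?thesis .
        qed (use J in \<open>simp add: B_def\<close>)
      qed (use J in simp)
      show "?r \<le> ?l"
        unfolding max0_le_iff[OF J]
      proof safe
        fix j assume j: "j \<in> J"
        show "inverse (x j) powr \<alpha> * simple_fun (n j) (a j) (A j) s powr \<alpha> \<le> ?l"
        proof (cases "\<exists>i. i < n j \<and> s \<in> A j i \<and> 0 < a j i")
          case True
          then obtain i where i: "i < n j" "s \<in> A j i" "0 < a j i" by auto
          then have ji: "(j, i) \<in> K" using j by (simp add: K_def)
          have "inverse (x j) powr \<alpha> * simple_fun (n j) (a j) (A j) s powr \<alpha> = c (j, i) powr (- \<alpha>) * indicator (B (j, i)) s"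
            using i by (simp add: ceq[OF ji] simple_fun_eq[OF disj[OF j] i(1)] B_def)
          also have "\<dots> \<le> ?l" by (rule le_max0[OF K ji])
          finally show ?thesis .
        next
          case False
          have "simple_fun (n j) (a j) (A j) s = 0"
          proof (cases "\<exists>i<n j. s \<in> A j i")
            case True
            then obtain i where i: "i < n j" "s \<in> A j i" by auto
            then have "a j i = 0" using False a[OF j] by force
            then show ?thesis using simple_fun_eq[OF disj[OF j] i] by simp
          qed (auto intro: simple_fun_eq_0)
          then show ?thesis using K by simp
        qed
      qed (use K in simp)
    qed
  qed
  finally show ?thesis .
qed

lemma exponent_tendsto:
  assumes "finite F" 
    and g: "\<And>k t. t \<in> F \<Longrightarrow> g k t \<in> Lplus \<alpha> \<mu>" and f: "\<And>t. t \<in> F \<Longrightarrow> f t \<in> Lplus \<alpha> \<mu>"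
    and lim: "\<And>t. t \<in> F \<Longrightarrow> (\<lambda>k. rho \<alpha> \<mu> (g k t) (f t)) \<longlonglongrightarrow> 0"
  shows "(\<lambda>k::nat. exponent \<alpha> \<mu> (g k) F x) \<longlonglongrightarrow> exponent \<alpha> \<mu> f F x"
proof (rule Lim_null[THEN iffD2], rule Lim_null_comparison)
  have int: "integrable \<mu> (\<lambda>s. max0 F (\<lambda>j. inverse (x j) powr \<alpha> * h j s powr \<alpha>))"
    if "\<And>t. t \<in> F \<Longrightarrow> h t \<in> Lplus \<alpha> \<mu>" for h
    using that assms(1) by (intro max0_integrable) (auto intro: LplusD)
  show "\<forall>\<^sub>F k in sequentially. norm (exponent \<alpha> \<mu> (g k) F x - exponent \<alpha> \<mu> f F x) \<le>
      (\<Sum>t\<in>F. inverse (x t) powr \<alpha> * rho \<alpha> \<mu> (g k t) (f t))"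
  proof (rule always_eventually, rule allI)
    fix k
    have dint: "integrable \<mu> (\<lambda>s. inverse (x t) powr \<alpha> * \<bar>g k t s powr \<alpha> - f t s powr \<alpha>\<bar>)" if "t \<in> F" for t
      using LplusD(3)[OF g[OF that]] LplusD(3)[OF f[OF that]] by auto
    have "\<bar>exponent \<alpha> \<mu> (g k) F x - exponent \<alpha> \<mu> f F x\<bar> =
      \<bar>\<integral>s. max0 F (\<lambda>j. inverse (x j) powr \<alpha> * g k j s powr \<alpha>) - max0 F (\<lambda>j. inverse (x j) powr \<alpha> * f j s powr \<alpha>) \<partial>\<mu>\<bar>"
      unfolding exponent_def using int[of "g k"] int[of f] g f by simp
    also have "\<dots> \<le> (\<integral>s. \<bar>max0 F (\<lambda>j. inverse (x j) powr \<alpha> * g k j s powr \<alpha>) - max0 F (\<lambda>j. inverse (x j) powr \<alpha> * f j s powr \<alpha>)\<bar> \<partial>\<mu>)"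
      by (rule integral_abs_bound)
    also have "\<dots> \<le> (\<integral>s. (\<Sum>t\<in>F. inverse (x t) powr \<alpha> * \<bar>g k t s powr \<alpha> - f t s powr \<alpha>\<bar>) \<partial>\<mu>)"
    proof (rule integral_mono)
      show "integrable \<mu> (\<lambda>s. \<bar>max0 F (\<lambda>j. inverse (x j) powr \<alpha> * g k j s powr \<alpha>) - max0 F (\<lambda>j. inverse (x j) powr \<alpha> * f j s powr \<alpha>)\<bar>)"
        using int[of "g k"] int[of f] g f by simp
      show "integrable \<mu> (\<lambda>s. (\<Sum>t\<in>F. inverse (x t) powr \<alpha> * \<bar>g k t s powr \<alpha> - f t s powr \<alpha>\<bar>))"
        using dint by (rule Bochner_Integration.integrable_sum)
      show "\<bar>max0 F (\<lambda>j. inverse (x j) powr \<alpha> * g k j s powr \<alpha>) - max0 F (\<lambda>j. inverse (x j) powr \<alpha> * f j s powr \<alpha>)\<bar> \<le>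
          (\<Sum>t\<in>F. inverse (x t) powr \<alpha> * \<bar>g k t s powr \<alpha> - f t s powr \<alpha>\<bar>)" for s
        using max0_diff_le_sum[OF assms(1), of "\<lambda>j. inverse (x j) powr \<alpha> * g k j s powr \<alpha>" "\<lambda>j. inverse (x j) powr \<alpha> * f j s powr \<alpha>"]
        by (simp add: abs_mult right_diff_distrib[symmetric])
    qed
    also have "\<dots> = (\<Sum>t\<in>F. inverse (x t) powr \<alpha> * rho \<alpha> \<mu> (g k t) (f t))"
      unfolding rho_def using dint by (subst Bochner_Integration.integral_sum) auto
    finally show "norm (exponent \<alpha> \<mu> (g k) F x - exponent \<alpha> \<mu> f F x) \<le>
      (\<Sum>t\<in>F. inverse (x t) powr \<alpha> * rho \<alpha> \<mu> (g k t) (f t))" by simp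
  qed
  show "(\<lambda>k. \<Sum>t\<in>F. inverse (x t) powr \<alpha> * rho \<alpha> \<mu> (g k t) (f t)) \<longlonglongrightarrow> 0"
    using lim by (intro tendsto_null_sum tendsto_mult_right_zero) auto
qed

text \<open>
  If \<open>Y\<close> is close to \<open>Z\<close>, the event for \<open>Z\<close> is contained in a slightly larger event for \<open>Y\<close>.
\<close>

lemma measure_all_le_perturb:
  assumes "finite_measure P" "finite F"
    and Y: "\<And>t. t \<in> F \<Longrightarrow> Y t \<in> borel_measurable P" and Z: "\<And>t. t \<in> F \<Longrightarrow> Z t \<in> borel_measurable P"
    and le: "\<And>t. t \<in> F \<Longrightarrow> x t + e t \<le> y t"
  shows "measure P {\<omega> \<in> space P. \<forall>t\<in>F. Z t \<omega> \<le> x t} \<le>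
    measure P {\<omega> \<in> space P. \<forall>t\<in>F. Y t \<omega> \<le> (y t :: real)} + (\<Sum>t\<in>F. measure P {\<omega> \<in> space P. \<bar>Y t \<omega> - Z t \<omega>\<bar> > e t})"
proof -
  interpret finite_measure P by fact
  let ?E = "\<lambda>t. {\<omega> \<in> space P. \<bar>Y t \<omega> - Z t \<omega>\<bar> > e t}"
  have E: "?E t \<in> sets P" if "t \<in> F" for t using Y[OF that] Z[OF that] by measurable
  have "measure P {\<omega> \<in> space P. \<forall>t\<in>F. Z t \<omega> \<le> x t} \<le>
      measure P ({\<omega> \<in> space P. \<forall>t\<in>F. Y t \<omega> \<le> y t} \<union> (\<Union>t\<in>F. ?E t))"
  proof (rule finite_measure_mono)
    show "{\<omega> \<in> space P. \<forall>t\<in>F. Z t \<omega> \<le> x t} \<subseteq> {\<omega> \<in> space P. \<forall>t\<in>F. Y t \<omega> \<le> y t} \<union> (\<Union>t\<in>F. ?E t)"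
      using le by fastforce
    show "{\<omega> \<in> space P. \<forall>t\<in>F. Y t \<omega> \<le> y t} \<union> (\<Union>t\<in>F. ?E t) \<in> sets P"
      using E assms(2) by (intro sets.Un sets_all_le Y sets.finite_UN) auto
  qed
  also have "\<dots> \<le> measure P {\<omega> \<in> space P. \<forall>t\<in>F. Y t \<omega> \<le> y t} + measure P (\<Union>t\<in>F. ?E t)"
    using E assms(2) by (intro measure_Un_le sets_all_le Y sets.finite_UN) auto
  also have "measure P (\<Union>t\<in>F. ?E t) \<le> (\<Sum>t\<in>F. measure P (?E t))"
    using E assms(2) by (intro finite_measure_subadditive_finite) auto
  finally show ?thesis by simp
qed

text \<open>
  Convergence in probability gives convergence of distribution functions at continuity points.
  Enlarging and shrinking all levels by the common factors \<open>1 \<plusminus> \<delta>\<close> only multiplies the exponent by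
  \<open>(1 \<plusminus> \<delta>)\<^sup>-\<^sup>\<alpha>\<close>, so both bounds converge to the same value as \<open>\<delta>\<close> tends to \<open>0\<close>.
\<close>

lemma halfspaces_limit:
  assumes P: "prob_space P" and F: "finite F"
    and Y: "\<And>k t. t \<in> F \<Longrightarrow> Y k t \<in> borel_measurable P" and Z: "\<And>t. t \<in> F \<Longrightarrow> Z t \<in> borel_measurable P"
    and conv: "\<And>t \<epsilon>. t \<in> F \<Longrightarrow> 0 < \<epsilon> \<Longrightarrow> (\<lambda>k::nat. measure P {\<omega> \<in> space P. \<bar>Y k t \<omega> - Z t \<omega>\<bar> > \<epsilon>}) \<longlonglongrightarrow> 0"
    and x: "\<And>t. t \<in> F \<Longrightarrow> 0 < x t"
    and law: "\<And>k c. 0 < c \<Longrightarrow> measure P {\<omega> \<in> space P. \<forall>t\<in>F. Y k t \<omega> \<le> c * x t} = exp (- (c powr (- \<alpha>) * v k))"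
    and v: "v \<longlonglongrightarrow> w"
  shows "measure P {\<omega> \<in> space P. \<forall>t\<in>F. Z t \<omega> \<le> x t} = exp (- w)"
proof -
  interpret prob_space P by fact
  let ?p = "measure P {\<omega> \<in> space P. \<forall>t\<in>F. Z t \<omega> \<le> x t}"
  have err: "(\<lambda>k. \<Sum>t\<in>F. measure P {\<omega> \<in> space P. \<bar>Y k t \<omega> - Z t \<omega>\<bar> > \<delta> * x t}) \<longlonglongrightarrow> 0" if "0 < \<delta>" for \<delta>
    using conv x that by (intro tendsto_null_sum) auto
  have vc: "(\<lambda>k. exp (- (c powr (- \<alpha>) * v k))) \<longlonglongrightarrow> exp (- (c powr (- \<alpha>) * w))" for c
    using v by (intro tendsto_intros)
  have upper: "?p \<le> exp (- ((1 + \<delta>) powr (- \<alpha>) * w))" if \<delta>: "0 < \<delta>" for \<delta>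
  proof (rule LIMSEQ_le_const)
    show "(\<lambda>k. exp (- ((1 + \<delta>) powr (- \<alpha>) * v k)) + (\<Sum>t\<in>F. measure P {\<omega> \<in> space P. \<bar>Y k t \<omega> - Z t \<omega>\<bar> > \<delta> * x t}))
        \<longlonglongrightarrow> exp (- ((1 + \<delta>) powr (- \<alpha>) * w))"
      using tendsto_add[OF vc err[OF \<delta>]] by simp
    show "\<exists>N. \<forall>k\<ge>N. ?p \<le> exp (- ((1 + \<delta>) powr (- \<alpha>) * v k)) + (\<Sum>t\<in>F. measure P {\<omega> \<in> space P. \<bar>Y k t \<omega> - Z t \<omega>\<bar> > \<delta> * x t})"
    proof (intro exI allI impI)
      fix k
      have "?p \<le> measure P {\<omega> \<in> space P. \<forall>t\<in>F. Y k t \<omega> \<le> (1 + \<delta>) * x t} + (\<Sum>t\<in>F. measure P {\<omega> \<in> space P. \<bar>Y k t \<omega> - Z t \<omega>\<bar> > \<delta> * x t})"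
        by (rule measure_all_le_perturb) (use F Y Z finite_measure_axioms in \<open>auto simp: algebra_simps\<close>)
      then show "?p \<le> exp (- ((1 + \<delta>) powr (- \<alpha>) * v k)) + (\<Sum>t\<in>F. measure P {\<omega> \<in> space P. \<bar>Y k t \<omega> - Z t \<omega>\<bar> > \<delta> * x t})"
        using \<delta> by (subst (asm) law) auto
    qed
  qed
  have lower: "exp (- ((1 - \<delta>) powr (- \<alpha>) * w)) \<le> ?p" if \<delta>: "0 < \<delta>" "\<delta> < 1" for \<delta>
  proof (rule LIMSEQ_le_const2)
    show "(\<lambda>k. exp (- ((1 - \<delta>) powr (- \<alpha>) * v k)) - (\<Sum>t\<in>F. measure P {\<omega> \<in> space P. \<bar>Y k t \<omega> - Z t \<omega>\<bar> > \<delta> * x t}))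
        \<longlonglongrightarrow> exp (- ((1 - \<delta>) powr (- \<alpha>) * w))"
      using tendsto_diff[OF vc err[OF \<delta>(1)]] by simp
    show "\<exists>N. \<forall>k\<ge>N. exp (- ((1 - \<delta>) powr (- \<alpha>) * v k)) - (\<Sum>t\<in>F. measure P {\<omega> \<in> space P. \<bar>Y k t \<omega> - Z t \<omega>\<bar> > \<delta> * x t}) \<le> ?p"
    proof (intro exI allI impI)
      fix k
      have "measure P {\<omega> \<in> space P. \<forall>t\<in>F. Y k t \<omega> \<le> (1 - \<delta>) * x t} \<le> ?p + (\<Sum>t\<in>F. measure P {\<omega> \<in> space P. \<bar>Z t \<omega> - Y k t \<omega>\<bar> > \<delta> * x t})"
        by (rule measure_all_le_perturb) (use F Y Z finite_measure_axioms in \<open>auto simp: algebra_simps\<close>)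
      then show "exp (- ((1 - \<delta>) powr (- \<alpha>) * v k)) - (\<Sum>t\<in>F. measure P {\<omega> \<in> space P. \<bar>Y k t \<omega> - Z t \<omega>\<bar> > \<delta> * x t}) \<le> ?p"
        using \<delta> by (subst (asm) law) (auto simp: abs_minus_commute)
    qed
  qed
  have d: "(\<lambda>n. 1 / real (Suc (Suc n))) \<longlonglongrightarrow> 0"
    using LIMSEQ_Suc[OF LIMSEQ_Suc[OF lim_1_over_n]] .
  have "(\<lambda>n. exp (- ((1 + 1 / real (Suc (Suc n))) powr (- \<alpha>) * w))) \<longlonglongrightarrow> exp (- ((1 + 0) powr (- \<alpha>) * w))"
    using d by (intro tendsto_intros) auto
  then have "?p \<le> exp (- ((1 + 0) powr (- \<alpha>) * w))"
    by (rule LIMSEQ_le_const) (use upper in auto)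
  moreover have "(\<lambda>n. exp (- ((1 - 1 / real (Suc (Suc n))) powr (- \<alpha>) * w))) \<longlonglongrightarrow> exp (- ((1 - 0) powr (- \<alpha>) * w))"
    using d by (intro tendsto_intros) auto
  then have "exp (- ((1 - 0) powr (- \<alpha>) * w)) \<le> ?p"
    by (rule LIMSEQ_le_const2) (use lower in auto)
  ultimately show ?thesis by simp
qed

lemma limit_in_probability_nonneg:
  assumes P: "prob_space P" and Z: "Z \<in> borel_measurable P" and Y: "\<And>k. Y k \<in> borel_measurable P" "\<And>k \<omega>. 0 \<le> Y k \<omega>"
    and conv: "\<And>\<epsilon>. 0 < \<epsilon> \<Longrightarrow> (\<lambda>k::nat. measure P {\<omega> \<in> space P. \<bar>Y k \<omega> - Z \<omega>\<bar> > \<epsilon>}) \<longlonglongrightarrow> 0"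
  shows "AE \<omega> in P. 0 \<le> (Z \<omega> :: real)"
proof -
  interpret prob_space P by fact
  note [measurable] = Z Y(1)
  have null: "AE \<omega> in P. \<not> Z \<omega> < - \<epsilon>" if "0 < \<epsilon>" for \<epsilon>
  proof -
    have "measure P {\<omega> \<in> space P. Z \<omega> < - \<epsilon>} \<le> 0"
    proof (rule LIMSEQ_le_const[OF conv[OF that]], intro exI allI impI)
      fix k
      show "measure P {\<omega> \<in> space P. Z \<omega> < - \<epsilon>} \<le> measure P {\<omega> \<in> space P. \<bar>Y k \<omega> - Z \<omega>\<bar> > \<epsilon>}"
      proof (rule finite_measure_mono)
        show "{\<omega> \<in> space P. Z \<omega> < - \<epsilon>} \<subseteq> {\<omega> \<in> space P. \<bar>Y k \<omega> - Z \<omega>\<bar> > \<epsilon>}"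
          using Y(2)[of k] by (auto simp: abs_if) (smt (verit))+
      qed measurable
    qed
    then have "emeasure P {\<omega> \<in> space P. Z \<omega> < - \<epsilon>} = 0" by (simp only: measure_le_0_iff emeasure_eq_measure) simp
    then show ?thesis by (subst AE_iff_null) auto
  qed
  have "AE \<omega> in P. \<forall>n. \<not> Z \<omega> < - (1 / real (Suc n))"
    unfolding AE_all_countable using null by simp
  then show ?thesis
  proof eventually_elim
    case (elim \<omega>)
    have "(\<lambda>n. - (1 / real (Suc n))) \<longlonglongrightarrow> - 0"
      by (intro tendsto_minus LIMSEQ_Suc[OF lim_1_over_n])
    then have "- 0 \<le> Z \<omega>" by (rule LIMSEQ_le_const2) (use elim in \<open>auto simp: not_less\<close>)
    then show ?case by simp
  qed
qed

text \<open>
  The Frechet property of finite max-linear combinations is a consequence of the joint distribution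
  function, by homogeneity of the exponent.
\<close>

lemma spectral_repI:
  fixes T :: "'t set"
  assumes P: "prob_space P" and \<alpha>: "0 < \<alpha>"
    and f: "\<And>t. t \<in> T \<Longrightarrow> f t \<in> Lplus \<alpha> \<mu>"
    and X: "\<And>t. t \<in> T \<Longrightarrow> X t \<in> borel_measurable P" "\<And>t. t \<in> T \<Longrightarrow> AE \<omega> in P. 0 \<le> X t \<omega>"
    and law: "\<And>F x. finite F \<Longrightarrow> F \<subseteq> T \<Longrightarrow> (\<And>t. t \<in> F \<Longrightarrow> 0 < x t) \<Longrightarrow>
      measure P {\<omega> \<in> space P. \<forall>t\<in>F. X t \<omega> \<le> x t} = exp (- exponent \<alpha> \<mu> f F x)"
  shows "spectral_rep P \<alpha> T X \<mu> f"
  unfolding spectral_rep_def frechet_process0_def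
proof (intro conjI allI impI ballI f)
  fix F :: "'t set" and x :: "'t \<Rightarrow> real" assume "finite F \<and> F \<noteq> {} \<and> F \<subseteq> T \<and> (\<forall>t\<in>F. 0 < x t)"
  then show "measure P {\<omega> \<in> space P. \<forall>t\<in>F. X t \<omega> \<le> x t} = exp (- (\<integral>s. (MAX t\<in>F. inverse (x t) * f t s) powr \<alpha> \<partial>\<mu>))"
    by (subst exponent_eq_MAX[OF \<alpha>]) (auto intro!: law f)
next
  interpret prob_space P by fact
  fix F :: "'t set" and a :: "'t \<Rightarrow> real" assume "finite F \<and> F \<noteq> {} \<and> F \<subseteq> T \<and> (\<forall>t\<in>F. 0 < a t)"
  then have F: "finite F" "F \<noteq> {}" "F \<subseteq> T" and a: "\<And>t. t \<in> F \<Longrightarrow> 0 < a t" by auto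
  let ?e = "exponent \<alpha> \<mu> f F (\<lambda>t. inverse (a t))"
  have e: "0 \<le> ?e" unfolding exponent_def using F by (intro integral_nonneg_AE) auto
  show "\<exists>\<sigma>\<ge>0. frechet_rv P \<alpha> \<sigma> (\<lambda>\<omega>. MAX t\<in>F. a t * X t \<omega>)"
    unfolding frechet_rv_def
  proof (intro exI[of _ "?e powr (1 / \<alpha>)"] conjI allI impI)
    show "(\<lambda>\<omega>. MAX t\<in>F. a t * X t \<omega>) \<in> borel_measurable P"
      using F X(1) by (intro borel_measurable_Max borel_measurable_times) auto
    have "AE \<omega> in P. \<forall>t\<in>F. 0 \<le> X t \<omega>" using F X(2) by (intro AE_finite_allI) auto
    then show "AE \<omega> in P. 0 \<le> (MAX t\<in>F. a t * X t \<omega>)"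
    proof eventually_elim
      case (elim \<omega>)
      then have "0 \<le> a t * X t \<omega>" if "t \<in> F" for t using a[OF that] that by simp
      with F show ?case by (subst Max_ge_iff) auto
    qed
    fix x :: real assume x: "0 < x"
    have "(MAX t\<in>F. a t * X t \<omega>) \<le> x \<longleftrightarrow> (\<forall>t\<in>F. X t \<omega> \<le> x * inverse (a t))" for \<omega>
      using F a by (simp add: field_simps)
    then have "measure P {\<omega> \<in> space P. (MAX t\<in>F. a t * X t \<omega>) \<le> x} = exp (- exponent \<alpha> \<mu> f F (\<lambda>t. x * inverse (a t)))"
      using law[of F "\<lambda>t. x * inverse (a t)"] F a x by simp
    also have "exponent \<alpha> \<mu> f F (\<lambda>t. x * inverse (a t)) = (?e powr (1 / \<alpha>)) powr \<alpha> * x powr (- \<alpha>)"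
      using exponent_scale[OF F(1) x, of "\<lambda>t. inverse (a t)"] a e \<alpha> by (simp add: powr_powr mult.commute)
    finally show "measure P {\<omega> \<in> space P. (MAX t\<in>F. a t * X t \<omega>) \<le> x} = exp (- ((?e powr (1 / \<alpha>)) powr \<alpha> * x powr (- \<alpha>)))" .
  qed auto
qed

lemma spectral_repD:
  assumes P: "prob_space P" and \<alpha>: "0 < \<alpha>" and X: "spectral_rep P \<alpha> T X \<mu> f"
  shows "\<And>t. t \<in> T \<Longrightarrow> f t \<in> Lplus \<alpha> \<mu>"
    "\<And>t. t \<in> T \<Longrightarrow> X t \<in> borel_measurable P" "\<And>t. t \<in> T \<Longrightarrow> AE \<omega> in P. 0 \<le> X t \<omega>"
    "\<And>F x. finite F \<Longrightarrow> F \<subseteq> T \<Longrightarrow> (\<And>t. t \<in> F \<Longrightarrow> 0 < x t) \<Longrightarrow>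
      measure P {\<omega> \<in> space P. \<forall>t\<in>F. X t \<omega> \<le> x t} = exp (- exponent \<alpha> \<mu> f F x)"
proof -
  interpret prob_space P by fact
  show f: "f t \<in> Lplus \<alpha> \<mu>" if "t \<in> T" for t using X that by (simp add: spectral_rep_def)
  have fr: "\<exists>\<sigma>\<ge>0. frechet_rv P \<alpha> \<sigma> (X t)" if "t \<in> T" for t
  proof -
    have "frechet_process0 P \<alpha> T X" using X by (simp add: spectral_rep_def)
    from this[unfolded frechet_process0_def, rule_format, of "{t}" "\<lambda>_. 1"] that
    show ?thesis by simp
  qed
  show "X t \<in> borel_measurable P" "AE \<omega> in P. 0 \<le> X t \<omega>" if "t \<in> T" for t
    using fr[OF that] by (auto simp: frechet_rv_def)
  show "measure P {\<omega> \<in> space P. \<forall>t\<in>F. X t \<omega> \<le> x t} = exp (- exponent \<alpha> \<mu> f F x)"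
    if F: "finite F" "F \<subseteq> T" "\<And>t. t \<in> F \<Longrightarrow> 0 < x t" for F x
  proof (cases "F = {}")
    case True
    then show ?thesis by (simp add: prob_space)
  next
    case False
    have "measure P {\<omega> \<in> space P. \<forall>t\<in>F. X t \<omega> \<le> x t} = exp (- (\<integral>s. (MAX t\<in>F. inverse (x t) * f t s) powr \<alpha> \<partial>\<mu>))"
      using X F False unfolding spectral_rep_def by blast
    also have "(\<integral>s. (MAX t\<in>F. inverse (x t) * f t s) powr \<alpha> \<partial>\<mu>) = exponent \<alpha> \<mu> f F x"
      using F(2) by (intro exponent_eq_MAX[OF \<alpha> F(1) False f F(3)]) auto
    finally show ?thesis .
  qed
qed

text \<open>
  The joint law is known for simple functions, and both sides pass to the limit: the left one by
  convergence in probability, the exponent by \<^const>\<open>rho\<close>-convergence.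
\<close>

lemma extremal_integrals_spectral_rep:
  assumes P: "prob_space P" and \<alpha>: "0 < \<alpha>" and M: "random_sup_measure P \<alpha> \<mu> M"
    and Y: "\<And>t. t \<in> T \<Longrightarrow> has_extremal_integral P \<alpha> \<mu> M (f t) (Y t)"
  shows "spectral_rep P \<alpha> T Y \<mu> f"
proof (rule spectral_repI[OF P \<alpha>])
  show f: "f t \<in> Lplus \<alpha> \<mu>" and Ym: "Y t \<in> borel_measurable P" if "t \<in> T" for t
    using Y[OF that] by (auto simp: has_extremal_integral_def)
  have "\<forall>t\<in>T. \<exists>n a A.
        (\<forall>k. \<forall>i<n k. 0 \<le> a k i \<and> A k i \<in> sets \<mu>) \<and>
        (\<forall>k. disjoint_family_on (A k) {..<n k}) \<and>
        (\<forall>k. simple_fun (n k) (a k) (A k) \<in> Lplus \<alpha> \<mu>) \<and>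
        (\<lambda>k::nat. rho \<alpha> \<mu> (simple_fun (n k) (a k) (A k)) (f t)) \<longlonglongrightarrow> 0 \<and>
        (\<forall>\<epsilon>>0. (\<lambda>k. measure P {\<omega> \<in> space P.
            \<bar>enn2real (simple_extremal_integral M (n k) (a k) (A k) \<omega>) - Y t \<omega>\<bar> > \<epsilon>}) \<longlonglongrightarrow> 0)"
    using Y unfolding has_extremal_integral_def by blast
  then obtain n a A where
      a: "\<And>t k i. t \<in> T \<Longrightarrow> i < n t k \<Longrightarrow> 0 \<le> a t k i" and A: "\<And>t k i. t \<in> T \<Longrightarrow> i < n t k \<Longrightarrow> A t k i \<in> sets \<mu>"
    and disj: "\<And>t k. t \<in> T \<Longrightarrow> disjoint_family_on (A t k) {..<n t k}"
    and g: "\<And>t k. t \<in> T \<Longrightarrow> simple_fun (n t k) (a t k) (A t k) \<in> Lplus \<alpha> \<mu>"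
    and lim: "\<And>t. t \<in> T \<Longrightarrow> (\<lambda>k::nat. rho \<alpha> \<mu> (simple_fun (n t k) (a t k) (A t k)) (f t)) \<longlonglongrightarrow> 0"
    and conv: "\<And>t \<epsilon>. t \<in> T \<Longrightarrow> 0 < \<epsilon> \<Longrightarrow> (\<lambda>k. measure P {\<omega> \<in> space P.
            \<bar>enn2real (simple_extremal_integral M (n t k) (a t k) (A t k) \<omega>) - Y t \<omega>\<bar> > \<epsilon>}) \<longlonglongrightarrow> 0"
    by (simp only: bchoice_iff) blast
  let ?Y = "\<lambda>k t \<omega>. enn2real (simple_extremal_integral M (n t k) (a t k) (A t k) \<omega>)"
  have Ykm: "?Y k t \<in> borel_measurable P" if "t \<in> T" for t k
    using A[OF that] by (intro simple_extremal_measurable[OF M]) auto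
  show "AE \<omega> in P. 0 \<le> Y t \<omega>" if "t \<in> T" for t
    by (rule limit_in_probability_nonneg[where Y="\<lambda>k. ?Y k t", OF P Ym[OF that] Ykm[OF that] _ conv[OF that]]) auto
  fix F and x :: "_ \<Rightarrow> real"
  assume F: "finite F" "F \<subseteq> T" and x: "\<And>t. t \<in> F \<Longrightarrow> 0 < x t"
  then have FT: "t \<in> T" if "t \<in> F" for t using that by auto
  show "measure P {\<omega> \<in> space P. \<forall>t\<in>F. Y t \<omega> \<le> x t} = exp (- exponent \<alpha> \<mu> f F x)"
  proof (rule halfspaces_limit[OF P F(1) Ykm[OF FT] Ym[OF FT] conv[OF FT] x])
    show "(\<lambda>k. exponent \<alpha> \<mu> (\<lambda>t. simple_fun (n t k) (a t k) (A t k)) F x) \<longlonglongrightarrow> exponent \<alpha> \<mu> f F x"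
      by (rule exponent_tendsto[OF F(1) g[OF FT] f[OF FT] lim[OF FT]])
    fix k and c :: real assume c: "0 < c"
    show "measure P {\<omega> \<in> space P. \<forall>t\<in>F. ?Y k t \<omega> \<le> c * x t} =
        exp (- (c powr (- \<alpha>) * exponent \<alpha> \<mu> (\<lambda>t. simple_fun (n t k) (a t k) (A t k)) F x))"
      using simple_extremal_halfspaces[where n="\<lambda>t. n t k" and a="\<lambda>t. a t k" and A="\<lambda>t. A t k" and x="\<lambda>t. c * x t",
          OF P \<alpha> M F(1) a[OF FT] A[OF FT] disj[OF FT] g[OF FT]] x c
      by (simp add: exponent_scale[OF F(1) c x])
  qed auto
qed

section \<open>Parts of the base space and independence\<close>

lemma random_sup_measure_restrict:
  assumes "random_sup_measure P \<alpha> \<mu> M" "D \<in> sets \<mu>"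
  shows "random_sup_measure P \<alpha> (restrict_space \<mu> D) M"
proof -
  have iff: "A \<in> sets (restrict_space \<mu> D) \<longleftrightarrow> A \<subseteq> D \<and> A \<in> sets \<mu>" for A
    using assms(2) by (subst sets_restrict_space_iff) auto
  have sub: "sets (restrict_space \<mu> D) \<subseteq> sets \<mu>" using iff by auto
  have em: "emeasure (restrict_space \<mu> D) A = emeasure \<mu> A" if "A \<in> sets (restrict_space \<mu> D)" for A
    using that assms(2) unfolding iff by (intro emeasure_restrict_space) auto
  have me: "measure (restrict_space \<mu> D) A = measure \<mu> A" if "A \<in> sets (restrict_space \<mu> D)" for A
    using em[OF that] by (simp add: measure_def)
  show ?thesis
    unfolding random_sup_measure_def
  proof (intro conjI ballI allI impI)
    fix A assume A: "A \<in> sets (restrict_space \<mu> D)"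
    then have A': "A \<in> sets \<mu>" using sub by auto
    show "M A \<in> borel_measurable P" using assms(1) A' unfolding random_sup_measure_def by blast
    show "AE \<omega> in P. M A \<omega> = \<infinity>" if "emeasure (restrict_space \<mu> D) A = \<infinity>"
      using assms(1) A' that em[OF A] unfolding random_sup_measure_def by simp
    assume "emeasure (restrict_space \<mu> D) A < \<infinity>"
    then show "AE \<omega> in P. M A \<omega> < \<infinity>" 
      "frechet_rv P \<alpha> (measure (restrict_space \<mu> D) A powr (1 / \<alpha>)) (\<lambda>\<omega>. enn2real (M A \<omega>))"
      using assms(1) A' em[OF A] me[OF A] unfolding random_sup_measure_def by simp_all
  next
    fix A :: "nat \<Rightarrow> 'b set" assume "range A \<subseteq> sets (restrict_space \<mu> D) \<and> disjoint_family A"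
    then have "range A \<subseteq> sets \<mu> \<and> disjoint_family A" using sub by auto
    then show "prob_space.indep_vars P (\<lambda>_. borel) (\<lambda>i. M (A i)) UNIV"
      "AE \<omega> in P. M (\<Union>i. A i) \<omega> = (SUP i. M (A i) \<omega>)"
      using assms(1) unfolding random_sup_measure_def by blast+
  qed
qed

lemma Lplus_restrict_iff:
  assumes "D \<in> sets \<mu>" "\<And>s. s \<in> space \<mu> \<Longrightarrow> s \<notin> D \<Longrightarrow> f s = 0"
  shows "f \<in> Lplus \<alpha> (restrict_space \<mu> D) \<longleftrightarrow> f \<in> Lplus \<alpha> \<mu>"
proof -
  have D: "D \<inter> space \<mu> \<in> sets \<mu>" "D \<subseteq> space \<mu>" using assms(1) sets.sets_into_space by auto
  have "f \<in> borel_measurable (restrict_space \<mu> D) \<longleftrightarrow> f \<in> borel_measurable \<mu>"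
    unfolding borel_measurable_restrict_space_iff[OF D(1)]
    by (intro measurable_cong) (use assms(2) in \<open>auto simp: indicator_def\<close>)
  moreover have "integrable (restrict_space \<mu> D) (\<lambda>s. f s powr \<alpha>) \<longleftrightarrow> integrable \<mu> (\<lambda>s. f s powr \<alpha>)"
    unfolding integrable_restrict_space[OF D(1)]
    by (intro Bochner_Integration.integrable_cong) (use assms(2) in \<open>auto simp: indicator_def\<close>)
  moreover have "(\<forall>s\<in>space (restrict_space \<mu> D). 0 \<le> f s) \<longleftrightarrow> (\<forall>s\<in>space \<mu>. 0 \<le> f s)"
    using assms(2) D by (force simp: space_restrict_space)
  ultimately show ?thesis by (simp add: Lplus_def)
qed

lemma Lplus_restrict:
  assumes "D \<in> sets \<mu>" "f \<in> Lplus \<alpha> \<mu>"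
  shows "f \<in> Lplus \<alpha> (restrict_space \<mu> D)"
proof -
  have "integrable \<mu> (\<lambda>s. indicator D s *\<^sub>R f s powr \<alpha>)"
    using assms by (intro integrable_mult_indicator LplusD)
  moreover have "D \<inter> space \<mu> \<in> sets \<mu>" "D \<subseteq> space \<mu>" using assms(1) sets.sets_into_space by auto
  ultimately show ?thesis
    using assms(2) by (auto simp: Lplus_def integrable_restrict_space space_restrict_space intro: measurable_restrict_space1)
qed

text \<open>
  An integral over a part is the integral over the whole space of the function extended by zero, with
  the same approximating simple functions. This puts the integrals over different parts on a common
  base space.
\<close>

lemma has_extremal_integral_restrict:
  assumes D: "D \<in> sets \<mu>" and f0: "\<And>s. s \<in> space \<mu> \<Longrightarrow> s \<notin> D \<Longrightarrow> f s = 0"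
    and f: "has_extremal_integral P \<alpha> (restrict_space \<mu> D) M f Y"
  shows "has_extremal_integral P \<alpha> \<mu> M f Y"
proof -
  have iff: "A \<in> sets (restrict_space \<mu> D) \<longleftrightarrow> A \<subseteq> D \<and> A \<in> sets \<mu>" for A
    using D by (subst sets_restrict_space_iff) auto
  obtain n a A where
      a: "\<And>k i. i < n k \<Longrightarrow> 0 \<le> a k i" and A: "\<And>k i. i < n k \<Longrightarrow> A k i \<in> sets (restrict_space \<mu> D)"
    and disj: "\<And>k. disjoint_family_on (A k) {..<n k}"
    and g: "\<And>k. simple_fun (n k) (a k) (A k) \<in> Lplus \<alpha> (restrict_space \<mu> D)"
    and lim: "(\<lambda>k::nat. rho \<alpha> (restrict_space \<mu> D) (simple_fun (n k) (a k) (A k)) f) \<longlonglongrightarrow> 0"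
    and conv: "\<And>\<epsilon>. 0 < \<epsilon> \<Longrightarrow> (\<lambda>k. measure P {\<omega> \<in> space P.
            \<bar>enn2real (simple_extremal_integral M (n k) (a k) (A k) \<omega>) - Y \<omega>\<bar> > \<epsilon>}) \<longlonglongrightarrow> 0"
    using f unfolding has_extremal_integral_def by blast
  have g0: "simple_fun (n k) (a k) (A k) s = 0" if "s \<notin> D" for k s
    using A that by (intro simple_fun_eq_0) (auto simp: iff)
  have "rho \<alpha> (restrict_space \<mu> D) (simple_fun (n k) (a k) (A k)) f = rho \<alpha> \<mu> (simple_fun (n k) (a k) (A k)) f" for k
  proof -
    have "D \<inter> space \<mu> \<in> sets \<mu>" using D by auto
    then show ?thesis unfolding rho_def
      by (subst integral_restrict_space)
        (auto intro!: Bochner_Integration.integral_cong simp: f0 g0 indicator_def)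
  qed
  with lim have "(\<lambda>k::nat. rho \<alpha> \<mu> (simple_fun (n k) (a k) (A k)) f) \<longlonglongrightarrow> 0" by simp
  moreover have "simple_fun (n k) (a k) (A k) \<in> Lplus \<alpha> \<mu>" for k
    using g[of k] Lplus_restrict_iff[OF D, of "simple_fun (n k) (a k) (A k)" \<alpha>] g0 by auto
  moreover have "f \<in> Lplus \<alpha> \<mu>" "Y \<in> borel_measurable P"
    using f Lplus_restrict_iff[OF D f0] unfolding has_extremal_integral_def by auto
  ultimately show ?thesis
    unfolding has_extremal_integral_def using a A disj conv iff by blast
qed

lemma exponent_restrict:
  assumes "D \<in> sets \<mu>" "finite F"
  shows "exponent \<alpha> (restrict_space \<mu> D) f F x = (\<integral>s. indicator D s * max0 F (\<lambda>j. inverse (x j) powr \<alpha> * f j s powr \<alpha>) \<partial>\<mu>)"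
proof -
  have "D \<inter> space \<mu> \<in> sets \<mu>" using assms by auto
  then show ?thesis unfolding exponent_def by (subst integral_restrict_space) auto
qed

lemma exponent_cong:
  "(\<And>t s. t \<in> F \<Longrightarrow> s \<in> space \<mu> \<Longrightarrow> f t s = g t s) \<Longrightarrow> exponent \<alpha> \<mu> f F x = exponent \<alpha> \<mu> g F x"
  unfolding exponent_def by (intro Bochner_Integration.integral_cong max0_cong refl) auto

lemma exponent_integrable:
  assumes "finite F" "\<And>t. t \<in> F \<Longrightarrow> f t \<in> Lplus \<alpha> \<mu>"
  shows "integrable \<mu> (\<lambda>s. max0 F (\<lambda>j. y j * f j s powr \<alpha>))"
  using assms by (intro max0_integrable) (auto intro: LplusD)

lemma exponent_split:
  assumes DE: "D \<in> sets \<mu>" "E \<in> sets \<mu>" "D \<inter> E = {}" "D \<union> E = space \<mu>"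
    and F: "finite F" "\<And>t. t \<in> F \<Longrightarrow> f t \<in> Lplus \<alpha> \<mu>"
  shows "exponent \<alpha> \<mu> f F x = exponent \<alpha> (restrict_space \<mu> D) f F x + exponent \<alpha> (restrict_space \<mu> E) f F x"
proof -
  let ?h = "\<lambda>s. max0 F (\<lambda>j. inverse (x j) powr \<alpha> * f j s powr \<alpha>)"
  have int: "integrable \<mu> ?h" using exponent_integrable[OF F] .
  have "exponent \<alpha> \<mu> f F x = (\<integral>s. indicator D s * ?h s + indicator E s * ?h s \<partial>\<mu>)"
    unfolding exponent_def using DE by (intro Bochner_Integration.integral_cong refl) (auto simp: indicator_def)
  also have "\<dots> = exponent \<alpha> (restrict_space \<mu> D) f F x + exponent \<alpha> (restrict_space \<mu> E) f F x"
    unfolding exponent_restrict[OF DE(1) F(1)] exponent_restrict[OF DE(2) F(1)]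
    using integrable_mult_indicator[OF DE(1) int] integrable_mult_indicator[OF DE(2) int] by simp
  finally show ?thesis .
qed

lemma max0_Plus:
  assumes "finite F" "finite G"
  shows "max0 (F <+> G) h = max (max0 F (\<lambda>t. h (Inl t))) (max0 G (\<lambda>t. h (Inr t)))"
proof (rule antisym)
  have FG: "finite (F <+> G)" using assms by simp
  show "max0 (F <+> G) h \<le> max (max0 F (\<lambda>t. h (Inl t))) (max0 G (\<lambda>t. h (Inr t)))"
    unfolding max0_le_iff[OF FG] using assms le_max0[of F _ "\<lambda>t. h (Inl t)"] le_max0[of G _ "\<lambda>t. h (Inr t)"]
    by (auto simp: le_max_iff_disj)
  show "max (max0 F (\<lambda>t. h (Inl t))) (max0 G (\<lambda>t. h (Inr t))) \<le> max0 (F <+> G) h"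
    using assms FG by (auto simp: max0_le_iff intro: le_max0)
qed

text \<open>
  When the two families live on disjoint sets, at most one of the two maxima is nonzero at each point,
  so the maximum equals the sum.
\<close>

lemma exponent_Plus:
  assumes DE: "D \<in> sets \<mu>" "E \<in> sets \<mu>" "D \<inter> E = {}" 
    and F: "finite F" "\<And>t. t \<in> F \<Longrightarrow> f t \<in> Lplus \<alpha> \<mu>" "\<And>t s. s \<in> space \<mu> \<Longrightarrow> s \<notin> D \<Longrightarrow> f t s = 0"
    and G: "finite G" "\<And>t. t \<in> G \<Longrightarrow> g t \<in> Lplus \<alpha> \<mu>" "\<And>t s. s \<in> space \<mu> \<Longrightarrow> s \<notin> E \<Longrightarrow> g t s = 0"
  shows "exponent \<alpha> \<mu> (case_sum f g) (F <+> G) x =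
    exponent \<alpha> (restrict_space \<mu> D) f F (\<lambda>t. x (Inl t)) + exponent \<alpha> (restrict_space \<mu> E) g G (\<lambda>t. x (Inr t))"
proof -
  let ?h = "\<lambda>s. max0 F (\<lambda>j. inverse (x (Inl j)) powr \<alpha> * f j s powr \<alpha>)"
  let ?k = "\<lambda>s. max0 G (\<lambda>j. inverse (x (Inr j)) powr \<alpha> * g j s powr \<alpha>)"
  have int: "integrable \<mu> ?h" "integrable \<mu> ?k"
    using exponent_integrable[OF F(1,2)] exponent_integrable[OF G(1,2)] by auto
  have "exponent \<alpha> \<mu> (case_sum f g) (F <+> G) x = (\<integral>s. indicator D s * ?h s + indicator E s * ?k s \<partial>\<mu>)"
    unfolding exponent_def
  proof (intro Bochner_Integration.integral_cong refl)
    fix s assume s: "s \<in> space \<mu>"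
    have "max0 (F <+> G) (\<lambda>j. inverse (x j) powr \<alpha> * case_sum f g j s powr \<alpha>) = max (?h s) (?k s)"
      using max0_Plus[OF F(1) G(1)] by simp
    moreover have "?h s = 0" if "s \<notin> D" using F(1,3) s that by (simp add: max0_zero)
    moreover have "?k s = 0" if "s \<notin> E" using G(1,3) s that by (simp add: max0_zero)
    moreover have "0 \<le> ?h s" "0 \<le> ?k s" using F(1) G(1) by auto
    ultimately show "max0 (F <+> G) (\<lambda>j. inverse (x j) powr \<alpha> * case_sum f g j s powr \<alpha>) =
       indicator D s * ?h s + indicator E s * ?k s"
      using DE(3) by (cases "s \<in> D"; cases "s \<in> E") auto
  qed
  also have "\<dots> = exponent \<alpha> (restrict_space \<mu> D) f F (\<lambda>t. x (Inl t)) + exponent \<alpha> (restrict_space \<mu> E) g G (\<lambda>t. x (Inr t))"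
    unfolding exponent_restrict[OF DE(1) F(1)] exponent_restrict[OF DE(2) G(1)]
    using integrable_mult_indicator[OF DE(1) int(1)] integrable_mult_indicator[OF DE(2) int(2)] by simp
  finally show ?thesis .
qed

lemma Plus_vimage: "H \<subseteq> A <+> B \<Longrightarrow> H = (Inl -` H) <+> (Inr -` H)"
  by (auto simp: Plus_def)

lemma Ball_Plus: "(\<forall>t\<in>F <+> G. p t) \<longleftrightarrow> (\<forall>t\<in>F. p (Inl t)) \<and> (\<forall>t\<in>G. p (Inr t))"
  by (auto simp: Plus_def)

text \<open>
  Both sides of the product formula are distribution functions of processes indexed by \<open>T <+> T\<close>, one on
  \<open>Q\<close> and one on \<open>Q \<Otimes>\<^sub>M Q\<close>. So these processes have the same law, and cutting the
  index set in two identifies the joint law with the product of the marginal laws.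
\<close>

lemma indep_processesI:
  fixes Y Z :: "'t \<Rightarrow> 'q \<Rightarrow> real"
  assumes Q: "prob_space Q"
    and Y: "\<And>t. t \<in> T \<Longrightarrow> Y t \<in> borel_measurable Q" "\<And>t. t \<in> T \<Longrightarrow> AE \<omega> in Q. 0 \<le> Y t \<omega>"
    and Z: "\<And>t. t \<in> T \<Longrightarrow> Z t \<in> borel_measurable Q" "\<And>t. t \<in> T \<Longrightarrow> AE \<omega> in Q. 0 \<le> Z t \<omega>"
    and law: "\<And>F G x y. finite F \<Longrightarrow> F \<subseteq> T \<Longrightarrow> finite G \<Longrightarrow> G \<subseteq> T \<Longrightarrow>
       (\<And>t. t \<in> F \<Longrightarrow> 0 < x t) \<Longrightarrow> (\<And>t. t \<in> G \<Longrightarrow> 0 < y t) \<Longrightarrow>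
       measure Q {\<omega> \<in> space Q. (\<forall>t\<in>F. Y t \<omega> \<le> x t) \<and> (\<forall>t\<in>G. Z t \<omega> \<le> y t)} =
       measure Q {\<omega> \<in> space Q. \<forall>t\<in>F. Y t \<omega> \<le> x t} * measure Q {\<omega> \<in> space Q. \<forall>t\<in>G. Z t \<omega> \<le> y t}"
  shows "indep_processes Q T Y Z"
proof -
  interpret Q: prob_space Q by fact
  interpret QQ: pair_prob_space Q Q ..
  let ?Pi = "PiM T (\<lambda>_. borel :: real measure)"
  let ?Pi2 = "PiM (T <+> T) (\<lambda>_. borel :: real measure)"
  let ?W = "case_sum Y Z"
  let ?W' = "case_sum (\<lambda>t \<omega>. Y t (fst \<omega>)) (\<lambda>t \<omega>. Z t (snd \<omega>))"
  have Yr: "(\<lambda>\<omega>. \<lambda>t\<in>T. Y t \<omega>) \<in> measurable Q ?Pi" and Zr: "(\<lambda>\<omega>. \<lambda>t\<in>T. Z t \<omega>) \<in> measurable Q ?Pi"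
    using Y Z by (auto intro!: measurable_restrict)
  have W: "?W t \<in> borel_measurable Q" "AE \<omega> in Q. 0 \<le> ?W t \<omega>" if "t \<in> T <+> T" for t
    using that Y Z by auto
  have W': "?W' t \<in> borel_measurable (Q \<Otimes>\<^sub>M Q)" if "t \<in> T <+> T" for t
    using that Y(1) Z(1) by (auto intro: measurable_compose[OF measurable_fst] measurable_compose[OF measurable_snd])
  have W'_pos: "AE \<omega> in Q \<Otimes>\<^sub>M Q. 0 \<le> ?W' t \<omega>" if "t \<in> T <+> T" for t
  proof (rule QQ.AE_pair_measure)
    show "{\<omega> \<in> space (Q \<Otimes>\<^sub>M Q). 0 \<le> ?W' t \<omega>} \<in> sets (Q \<Otimes>\<^sub>M Q)"
      using W'[OF that] by measurable
    show "AE \<omega> in Q. AE \<omega>' in Q. 0 \<le> ?W' t (\<omega>, \<omega>')"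
      using that
    proof (cases t)
      case (Inl u)
      with that have "AE \<omega> in Q. 0 \<le> Y u \<omega>" using Y(2) by auto
      then show ?thesis using Inl by (auto elim: eventually_mono)
    qed (use that Z(2) in auto)
  qed
  have eq: "distr Q ?Pi2 (\<lambda>\<omega>. \<lambda>t\<in>T <+> T. ?W t \<omega>) = distr (Q \<Otimes>\<^sub>M Q) ?Pi2 (\<lambda>\<omega>. \<lambda>t\<in>T <+> T. ?W' t \<omega>)"
  proof (rule nonneg_process_law_eqI[OF Q.finite_measure_axioms QQ.P.finite_measure_axioms W W' W'_pos])
    fix H and x :: "'t + 't \<Rightarrow> real"
    assume H: "finite H" "H \<subseteq> T <+> T" and x: "\<And>t. t \<in> H \<Longrightarrow> 0 < x t"
    define F where "F = Inl -` H"
    define G where "G = Inr -` H"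
    have FG: "finite F" "finite G" "F \<subseteq> T" "G \<subseteq> T" "H = F <+> G"
      using H Plus_vimage[OF H(2)] unfolding F_def G_def by (auto intro!: finite_vimageI)
    let ?A = "{\<omega> \<in> space Q. \<forall>t\<in>F. Y t \<omega> \<le> x (Inl t)}" and ?B = "{\<omega> \<in> space Q. \<forall>t\<in>G. Z t \<omega> \<le> x (Inr t)}"
    have AB: "?A \<in> sets Q" "?B \<in> sets Q" using FG Y Z by (auto intro!: sets_all_le)
    have "measure Q {\<omega> \<in> space Q. \<forall>t\<in>H. ?W t \<omega> \<le> x t} = measure Q {\<omega> \<in> space Q. (\<forall>t\<in>F. Y t \<omega> \<le> x (Inl t)) \<and> (\<forall>t\<in>G. Z t \<omega> \<le> x (Inr t))}"
      unfolding FG(5) by (simp add: Ball_Plus)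
    also have "\<dots> = measure Q ?A * measure Q ?B"
      using FG x by (intro law) auto
    also have "\<dots> = measure (Q \<Otimes>\<^sub>M Q) (?A \<times> ?B)"
      using Q.emeasure_pair_measure_Times[OF AB] by (simp add: measure_def enn2real_mult)
    also have "?A \<times> ?B = {\<omega> \<in> space (Q \<Otimes>\<^sub>M Q). \<forall>t\<in>H. ?W' t \<omega> \<le> x t}"
      unfolding FG(5) Ball_Plus by (auto simp: space_pair_measure)
    finally show "measure Q {\<omega> \<in> space Q. \<forall>t\<in>H. ?W t \<omega> \<le> x t} = measure (Q \<Otimes>\<^sub>M Q) {\<omega> \<in> space (Q \<Otimes>\<^sub>M Q). \<forall>t\<in>H. ?W' t \<omega> \<le> x t}" .
  qed auto
  \<comment> \<open>Cutting the index set turns the law on \<open>T <+> T\<close> into a law of pairs.\<close>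
  let ?split = "\<lambda>z. (\<lambda>t\<in>T. z (Inl t), \<lambda>t\<in>T. z (Inr t))"
  have split: "?split \<in> measurable ?Pi2 (?Pi \<Otimes>\<^sub>M ?Pi)"
    by (intro measurable_Pair measurable_restrict measurable_component_singleton) auto
  have r1: "(\<lambda>\<omega>. \<lambda>t\<in>T <+> T. ?W t \<omega>) \<in> measurable Q ?Pi2" 
    and r2: "(\<lambda>\<omega>. \<lambda>t\<in>T <+> T. ?W' t \<omega>) \<in> measurable (Q \<Otimes>\<^sub>M Q) ?Pi2"
    by (intro measurable_restrict W(1), assumption) (intro measurable_restrict W', assumption)
  have "distr Q ?Pi (\<lambda>\<omega>. \<lambda>t\<in>T. Y t \<omega>) \<Otimes>\<^sub>M distr Q ?Pi (\<lambda>\<omega>. \<lambda>t\<in>T. Z t \<omega>) =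
      distr (Q \<Otimes>\<^sub>M Q) (?Pi \<Otimes>\<^sub>M ?Pi) (\<lambda>(\<omega>, \<omega>'). (\<lambda>t\<in>T. Y t \<omega>, \<lambda>t\<in>T. Z t \<omega>'))"
    by (intro pair_measure_distr Yr Zr prob_space_imp_sigma_finite Q.prob_space_distr)
  also have "\<dots> = distr (distr (Q \<Otimes>\<^sub>M Q) ?Pi2 (\<lambda>\<omega>. \<lambda>t\<in>T <+> T. ?W' t \<omega>)) (?Pi \<Otimes>\<^sub>M ?Pi) ?split"
    unfolding distr_distr[OF split r2] by (intro distr_cong refl) (auto simp: restrict_def fun_eq_iff)
  also have "\<dots> = distr (distr Q ?Pi2 (\<lambda>\<omega>. \<lambda>t\<in>T <+> T. ?W t \<omega>)) (?Pi \<Otimes>\<^sub>M ?Pi) ?split"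
    by (simp only: eq)
  also have "\<dots> = distr Q (?Pi \<Otimes>\<^sub>M ?Pi) (\<lambda>\<omega>. (\<lambda>t\<in>T. Y t \<omega>, \<lambda>t\<in>T. Z t \<omega>))"
    unfolding distr_distr[OF split r1] by (intro distr_cong refl) (auto simp: restrict_def fun_eq_iff)
  finally show ?thesis
    unfolding indep_processes_def Q.indep_var_distribution_eq using Yr Zr by simp
qed

text \<open>
  The two families are treated as one family of extremal integrals indexed by \<open>T <+> T\<close>, whose
  exponent is additive over the two sides.
\<close>

lemma extremal_integrals_disjoint:
  fixes f g :: "'t \<Rightarrow> 's \<Rightarrow> real"
  assumes P: "prob_space P" and \<alpha>: "0 < \<alpha>" and M: "random_sup_measure P \<alpha> \<mu> M"
    and DE: "D \<in> sets \<mu>" "E \<in> sets \<mu>" "D \<inter> E = {}" 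
    and f: "\<And>t s. s \<in> space \<mu> \<Longrightarrow> s \<notin> D \<Longrightarrow> f t s = 0" and g: "\<And>t s. s \<in> space \<mu> \<Longrightarrow> s \<notin> E \<Longrightarrow> g t s = 0"
    and Y: "\<And>t. t \<in> T \<Longrightarrow> has_extremal_integral P \<alpha> (restrict_space \<mu> D) M (f t) (Y t)"
    and Z: "\<And>t. t \<in> T \<Longrightarrow> has_extremal_integral P \<alpha> (restrict_space \<mu> E) M (g t) (Z t)"
    and F: "finite F" "F \<subseteq> T" "\<And>t. t \<in> F \<Longrightarrow> 0 < x t" and G: "finite G" "G \<subseteq> T" "\<And>t. t \<in> G \<Longrightarrow> 0 < y t"
  shows "measure P {\<omega> \<in> space P. (\<forall>t\<in>F. Y t \<omega> \<le> x t) \<and> (\<forall>t\<in>G. Z t \<omega> \<le> y t)} =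
     exp (- (exponent \<alpha> (restrict_space \<mu> D) f F x + exponent \<alpha> (restrict_space \<mu> E) g G y))"
proof -
  have Y': "has_extremal_integral P \<alpha> \<mu> M (f t) (Y t)" and Z': "has_extremal_integral P \<alpha> \<mu> M (g t) (Z t)" if "t \<in> T" for t
    using has_extremal_integral_restrict[OF DE(1) f Y[OF that]] has_extremal_integral_restrict[OF DE(2) g Z[OF that]] by auto
  have "spectral_rep P \<alpha> (T <+> T) (case_sum Y Z) \<mu> (case_sum f g)"
    by (rule extremal_integrals_spectral_rep[OF P \<alpha> M]) (auto simp: Y' Z')
  then have "measure P {\<omega> \<in> space P. \<forall>t\<in>F <+> G. case_sum Y Z t \<omega> \<le> case_sum x y t} = exp (- exponent \<alpha> \<mu> (case_sum f g) (F <+> G) (case_sum x y))"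
  proof (rule spectral_repD(4)[OF P \<alpha>])
    show "F <+> G \<subseteq> T <+> T" using F G by auto
    show "0 < case_sum x y t" if "t \<in> F <+> G" for t using that F G by auto
  qed (use F G in auto)
  moreover have "{\<omega> \<in> space P. \<forall>t\<in>F <+> G. case_sum Y Z t \<omega> \<le> case_sum x y t} =
    {\<omega> \<in> space P. (\<forall>t\<in>F. Y t \<omega> \<le> x t) \<and> (\<forall>t\<in>G. Z t \<omega> \<le> y t)}" by (simp add: Ball_Plus)
  moreover have "exponent \<alpha> \<mu> (case_sum f g) (F <+> G) (case_sum x y) =
      exponent \<alpha> (restrict_space \<mu> D) f F x + exponent \<alpha> (restrict_space \<mu> E) g G y"
    by (subst exponent_Plus[OF DE F(1) _ f G(1) _ g])
      (use F(2) G(2) Y' Z' in \<open>auto simp: has_extremal_integral_def\<close>)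
  ultimately show ?thesis by simp
qed

section \<open>Restricting a minimal representation\<close>

lemma ratio_sigma_field_restrict:
  assumes "A \<in> ratio_sigma_field \<mu> T f"
  shows "A \<inter> D \<in> ratio_sigma_field (restrict_space \<mu> D) T (\<lambda>t s. f t s * indicator D s)"
  using assms unfolding ratio_sigma_field_def
proof (induction rule: sigma_sets.induct)
  case (Basic A)
  then obtain t t' B where tB: "t \<in> T" "t' \<in> T" "B \<in> sets borel"
    and A: "A = (\<lambda>s. ennreal (f t s) / ennreal (f t' s)) -` B \<inter> space \<mu>" by auto
  have "A \<inter> D = (\<lambda>s. ennreal (f t s * indicator D s) / ennreal (f t' s * indicator D s)) -` B \<inter> space (restrict_space \<mu> D)"
    unfolding A by (auto simp: space_restrict_space)
  show ?case unfolding \<open>A \<inter> D = _\<close> using tB by (intro sigma_sets.Basic CollectI exI[of _ t] exI[of _ t'] exI[of _ B] conjI refl)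
next
  case Empty
  then show ?case by (simp add: sigma_sets.Empty)
next
  case (Compl A)
  have "(space \<mu> - A) \<inter> D = space (restrict_space \<mu> D) - A \<inter> D" by (auto simp: space_restrict_space)
  then show ?case using Compl.IH by (simp add: sigma_sets.Compl)
next
  case (Union A)
  have "(\<Union>i. A i) \<inter> D = (\<Union>i. A i \<inter> D)" by auto
  then show ?case using sigma_sets.Union[of "\<lambda>i. A i \<inter> D", OF Union.IH] by simp
qed

text \<open>
  Both parts of minimality restrict. A function \<open>f0\<close> of full support stays in the closure, since the metric
  decreases under restriction, and it still vanishes only on a null set; traces of
  the ratio \<open>\<sigma>\<close>-field on \<open>D\<close> are in the ratio \<open>\<sigma>\<close>-field of the restricted functions.
\<close>

lemma minimal_rep_restrict:
  assumes \<alpha>: "0 < \<alpha>" and D: "D \<in> sets \<mu>" and X: "minimal_rep P \<alpha> T X \<mu> f"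
    and Y: "spectral_rep Q \<alpha> T Y (restrict_space \<mu> D) (\<lambda>t s. f t s * indicator D s)"
  shows "minimal_rep Q \<alpha> T Y (restrict_space \<mu> D) (\<lambda>t s. f t s * indicator D s)"
proof -
  let ?\<mu> = "restrict_space \<mu> D" and ?f = "\<lambda>t s. f t s * indicator D s :: real"
  have Dsp: "D \<inter> space \<mu> \<in> sets \<mu>" "D \<subseteq> space \<mu>" using D sets.sets_into_space by auto
  have sp: "space ?\<mu> = D" using Dsp by (auto simp: space_restrict_space)
  have null: "A \<in> null_sets ?\<mu> \<longleftrightarrow> A \<subseteq> D \<and> A \<in> null_sets \<mu>" for A
    using D Dsp null_sets_restrict_space[of D \<mu> A] by auto
  have f: "f t \<in> Lplus \<alpha> \<mu>" if "t \<in> T" for t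
    using X that by (auto simp: minimal_rep_def spectral_rep_def)
  obtain f0 where f0: "f0 \<in> max_linear_closure \<alpha> \<mu> T f"
    and supp: "sym_diff (space \<mu>) {s \<in> space \<mu>. f0 s \<noteq> 0} \<in> null_sets \<mu>"
    using X unfolding minimal_rep_def is_support_def by auto
  have f0L: "f0 \<in> Lplus \<alpha> \<mu>" using f0 by (simp add: max_linear_closure_def)
  then have f0L': "f0 \<in> Lplus \<alpha> ?\<mu>" using Lplus_restrict[OF D] by blast
  have "sym_diff (space \<mu>) {s \<in> space \<mu>. f0 s \<noteq> 0} = {s \<in> space \<mu>. f0 s = 0}" by auto
  with supp have "{s \<in> space \<mu>. f0 s = 0} \<in> null_sets \<mu>" by simp
  then have "D \<inter> {s \<in> space \<mu>. f0 s = 0} \<in> null_sets \<mu>" using D by (rule null_set_Int1)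
  then have supp': "{s \<in> D. f0 s = 0} \<in> null_sets ?\<mu>"
    unfolding null using Dsp by (auto simp: Int_def conj_ac cong: conj_cong elim!: back_subst[where P="\<lambda>A. A \<in> null_sets \<mu>"])
  have f0': "f0 \<in> max_linear_closure \<alpha> ?\<mu> T ?f"
    unfolding max_linear_closure_def
  proof (intro CollectI conjI f0L' allI impI)
    fix \<epsilon> :: real assume "0 < \<epsilon>"
    then obtain F a where F: "finite F" "F \<noteq> {}" "F \<subseteq> T" and a: "\<forall>t\<in>F. 0 < a t"
      and rho: "rho \<alpha> \<mu> (\<lambda>s. MAX t\<in>F. a t * f t s) f0 < \<epsilon>"
      using f0 unfolding max_linear_closure_def max_linear_combs_def by blast
    let ?h = "\<lambda>s. MAX t\<in>F. a t * f t s" and ?h' = "\<lambda>s. MAX t\<in>F. a t * ?f t s"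
    have "integrable \<mu> (\<lambda>s. ?h s powr \<alpha>)"
    proof -
      have "integrable \<mu> (\<lambda>s. max0 F (\<lambda>t. a t powr \<alpha> * f t s powr \<alpha>))"
        using exponent_integrable[of F f \<alpha> \<mu> "\<lambda>t. a t powr \<alpha>"] F f by auto
      then show ?thesis
        using F a f LplusD(2)[OF f] by (subst Bochner_Integration.integrable_cong[OF refl Max_powr_eq_max0]) 
          (auto simp: \<alpha> less_imp_le subset_eq)
    qed
    then have int: "integrable \<mu> (\<lambda>s. \<bar>?h s powr \<alpha> - f0 s powr \<alpha>\<bar>)"
      using LplusD(3)[OF f0L] by simp
    have "rho \<alpha> ?\<mu> ?h' f0 = (\<integral>s. indicator D s * \<bar>?h s powr \<alpha> - f0 s powr \<alpha>\<bar> \<partial>\<mu>)"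
      unfolding rho_def integral_restrict_space[OF Dsp(1)]
      by (intro Bochner_Integration.integral_cong refl) (auto simp: indicator_def)
    also have "\<dots> \<le> rho \<alpha> \<mu> ?h f0"
      unfolding rho_def using int integrable_mult_indicator[OF D int]
      by (intro integral_mono) (auto simp: indicator_def)
    finally have "rho \<alpha> ?\<mu> ?h' f0 < \<epsilon>" using rho by simp
    moreover have "?h' \<in> max_linear_combs T ?f"
      unfolding max_linear_combs_def using F a by blast
    ultimately show "\<exists>h\<in>max_linear_combs T ?f. rho \<alpha> ?\<mu> h f0 < \<epsilon>" by blast
  qed
  have "is_support \<alpha> ?\<mu> T ?f (space ?\<mu>)"
    unfolding is_support_def
  proof (intro bexI[OF _ f0'] conjI ballI)
    fix g assume "g \<in> max_linear_closure \<alpha> ?\<mu> T ?f"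
    then have "g \<in> Lplus \<alpha> ?\<mu>" by (simp add: max_linear_closure_def)
    from LplusD(1)[OF this] LplusD(1)[OF f0L']
    have "{s \<in> space ?\<mu>. g s \<noteq> 0} - {s \<in> space ?\<mu>. f0 s \<noteq> 0} \<in> sets ?\<mu>"
      by measurable
    then show "{s \<in> space ?\<mu>. g s \<noteq> 0} - {s \<in> space ?\<mu>. f0 s \<noteq> 0} \<in> null_sets ?\<mu>"
      by (rule null_sets_subset[OF supp']) (simp only: sp, blast)
  next
    have "sym_diff (space ?\<mu>) {s \<in> space ?\<mu>. f0 s \<noteq> 0} = {s \<in> D. f0 s = 0}" unfolding sp by auto
    then show "sym_diff (space ?\<mu>) {s \<in> space ?\<mu>. f0 s \<noteq> 0} \<in> null_sets ?\<mu>" using supp' by simp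
  qed
  moreover have "\<exists>A\<in>ratio_sigma_field ?\<mu> T ?f. sym_diff A B \<in> null_sets ?\<mu>" if "B \<in> sets ?\<mu>" for B
  proof -
    have B: "B \<in> sets \<mu>" "B \<subseteq> D" using that D Dsp by (auto simp: sets_restrict_space_iff)
    then obtain A where A: "A \<in> ratio_sigma_field \<mu> T f" "sym_diff A B \<in> null_sets \<mu>"
      using X unfolding minimal_rep_def by blast
    have "sym_diff (A \<inter> D) B = sym_diff A B \<inter> D" using B by auto
    also have "\<dots> \<in> null_sets \<mu>" using A(2) D by (rule null_set_Int2)
    finally have "sym_diff (A \<inter> D) B \<in> null_sets ?\<mu>" unfolding null using B by auto
    with ratio_sigma_field_restrict[OF A(1)] show ?thesis by blast
  qed
  ultimately show ?thesis unfolding minimal_rep_def using Y by blast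
qed

section \<open>A reference function of full support\<close>

text \<open>
  A function \<open>f0\<close> in the closure is approximated by max-linear combinations that involve only countably many
  indices. Where all of these \<open>f t\<close> vanish, so do the combinations, and therefore \<open>f0\<close> almost
  everywhere.
\<close>

lemma support_countable_cover:
  fixes T :: "'t set"
  assumes \<alpha>: "0 < \<alpha>" and f: "\<And>t. t \<in> T \<Longrightarrow> f t \<in> Lplus \<alpha> \<mu>"
    and supp: "is_support \<alpha> \<mu> T f (space \<mu>)"
  shows "\<exists>T0. countable T0 \<and> T0 \<noteq> {} \<and> T0 \<subseteq> T \<and> (AE s in \<mu>. \<exists>t\<in>T0. 0 < f t s)"
proof -
  obtain f0 where f0: "f0 \<in> max_linear_closure \<alpha> \<mu> T f"
    and null: "sym_diff (space \<mu>) {s \<in> space \<mu>. f0 s \<noteq> 0} \<in> null_sets \<mu>"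
    using supp unfolding is_support_def by auto
  have f0L: "f0 \<in> Lplus \<alpha> \<mu>" using f0 by (simp add: max_linear_closure_def)
  have "AE s in \<mu>. s \<notin> sym_diff (space \<mu>) {s \<in> space \<mu>. f0 s \<noteq> 0}"
    using null by (rule AE_not_in)
  then have f0_pos: "AE s in \<mu>. f0 s \<noteq> 0" by (auto elim!: AE_mp intro!: AE_I2)
  have "\<forall>n. \<exists>F a. finite F \<and> F \<noteq> {} \<and> F \<subseteq> T \<and> (\<forall>t\<in>F. 0 < a t) \<and>
      rho \<alpha> \<mu> (\<lambda>s. MAX t\<in>F. a t * f t s) f0 < 1 / real (Suc n)"
  proof
    fix n
    have "0 < 1 / real (Suc n)" by simp
    then show "\<exists>F a. finite F \<and> F \<noteq> {} \<and> F \<subseteq> T \<and> (\<forall>t\<in>F. 0 < a t) \<and>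
      rho \<alpha> \<mu> (\<lambda>s. MAX t\<in>F. a t * f t s) f0 < 1 / real (Suc n)"
      using f0 unfolding max_linear_closure_def max_linear_combs_def by blast
  qed
  then obtain F a where F: "\<And>n. finite (F n)" "\<And>n. F n \<noteq> {}" "\<And>n. F n \<subseteq> T" and a: "\<And>n t. t \<in> F n \<Longrightarrow> 0 < a n t"
    and rho: "\<And>n. rho \<alpha> \<mu> (\<lambda>s. MAX t\<in>F n. a n t * f t s) f0 < 1 / real (Suc n)"
    by (simp only: choice_iff) blast
  define T0 where "T0 = (\<Union>n. F n)"
  have T0: "countable T0" "T0 \<noteq> {}" "T0 \<subseteq> T"
    using F by (auto simp: T0_def intro: countable_finite)
  \<comment> \<open>On \<open>Z\<close> every approximating combination vanishes, so the distance to \<open>f0\<close> bounds the integral of \<open>f0\<^sup>\<alpha>\<close> over \<open>Z\<close>.\<close>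
  define Z where "Z = {s \<in> space \<mu>. \<forall>t\<in>T0. f t s = 0}"
  have "{s \<in> space \<mu>. f t s \<noteq> 0} \<in> sets \<mu>" if "t \<in> T0" for t
  proof -
    have [measurable]: "f t \<in> borel_measurable \<mu>" using that T0(3) LplusD(1)[OF f] by auto
    show ?thesis by measurable
  qed
  then have "space \<mu> - (\<Union>t\<in>T0. {s \<in> space \<mu>. f t s \<noteq> 0}) \<in> sets \<mu>"
    using T0(1) by (intro sets.Diff sets.top sets.countable_UN') auto
  moreover have "space \<mu> - (\<Union>t\<in>T0. {s \<in> space \<mu>. f t s \<noteq> 0}) = Z" by (auto simp: Z_def)
  ultimately have Z: "Z \<in> sets \<mu>" by simp
  have intZ: "integrable \<mu> (\<lambda>s. indicator Z s * f0 s powr \<alpha>)"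
    using integrable_mult_indicator[OF Z LplusD(3)[OF f0L]] by simp
  have "(\<integral>s. indicator Z s * f0 s powr \<alpha> \<partial>\<mu>) \<le> 1 / real (Suc n)" for n
  proof -
    let ?h = "\<lambda>s. max0 (F n) (\<lambda>t. a n t powr \<alpha> * f t s powr \<alpha>)"
    have h: "(MAX t\<in>F n. a n t * f t s) powr \<alpha> = ?h s" if "s \<in> space \<mu>" for s
      using F(3)[of n] a that LplusD(2)[OF f] 
      by (intro Max_powr_eq_max0 F \<alpha>) (auto simp: less_imp_le subset_eq)
    have int: "integrable \<mu> (\<lambda>s. \<bar>?h s - f0 s powr \<alpha>\<bar>)"
      using exponent_integrable[of "F n" f \<alpha> \<mu>] F f LplusD(3)[OF f0L] by (auto simp: subset_eq)
    have "(\<integral>s. indicator Z s * f0 s powr \<alpha> \<partial>\<mu>) \<le> (\<integral>s. \<bar>?h s - f0 s powr \<alpha>\<bar> \<partial>\<mu>)"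
    proof (rule integral_mono[OF intZ int])
      fix s assume "s \<in> space \<mu>"
      show "indicator Z s * f0 s powr \<alpha> \<le> \<bar>?h s - f0 s powr \<alpha>\<bar>"
      proof (cases "s \<in> Z")
        case True
        then have "?h s = max0 (F n) (\<lambda>t. 0)" by (intro max0_cong) (auto simp: Z_def T0_def)
        then show ?thesis using True F by (simp add: max0_zero)
      qed simp
    qed
    also have "\<dots> = rho \<alpha> \<mu> (\<lambda>s. MAX t\<in>F n. a n t * f t s) f0"
      unfolding rho_def by (intro Bochner_Integration.integral_cong refl) (simp only: h)
    finally show ?thesis using rho[of n] by simp
  qed
  then have "(\<integral>s. indicator Z s * f0 s powr \<alpha> \<partial>\<mu>) \<le> 0"
    by (intro LIMSEQ_le_const[OF LIMSEQ_Suc[OF lim_1_over_n]]) auto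
  moreover have "0 \<le> (\<integral>s. indicator Z s * f0 s powr \<alpha> \<partial>\<mu>)"
    by (intro integral_nonneg_AE) auto
  ultimately have "(\<integral>s. indicator Z s * f0 s powr \<alpha> \<partial>\<mu>) = 0" by simp
  then have "AE s in \<mu>. indicator Z s * f0 s powr \<alpha> = 0"
    by (subst (asm) integral_nonneg_eq_0_iff_AE[OF intZ]) auto
  then have "AE s in \<mu>. \<exists>t\<in>T0. 0 < f t s"
    using f0_pos AE_space
  proof eventually_elim
    case (elim s)
    then have "s \<notin> Z" by auto
    then obtain t where "t \<in> T0" "f t s \<noteq> 0" using elim(3) by (auto simp: Z_def)
    moreover have "0 \<le> f t s" using \<open>t \<in> T0\<close> T0(3) elim(3) LplusD(2)[OF f] by auto
    ultimately show ?case by force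
  qed
  with T0 show ?thesis by blast
qed

text \<open>
  A weighted supremum \<open>\<Or>\<^sub>i b\<^sub>i f\<^sub>\<tau>\<^sub>i\<^sup>\<alpha>\<close> of countably many powers. It may be infinite on a null set, so
  it is formed in \<^typ>\<open>ennreal\<close>. A supremum is used rather than a sum because its maximum with
  further functions is a limit of finite maxima, and these have known integrals.
\<close>

definition reference :: "real \<Rightarrow> (nat \<Rightarrow> real) \<Rightarrow> (nat \<Rightarrow> 't) \<Rightarrow> ('t \<Rightarrow> 's \<Rightarrow> real) \<Rightarrow> 's \<Rightarrow> real" where
  "reference \<alpha> b \<tau> f s = enn2real (SUP i. ennreal (b i * f (\<tau> i) s powr \<alpha>))"

lemma reference_nonneg [simp]: "0 \<le> reference \<alpha> b \<tau> f s"
  by (simp add: reference_def)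

text \<open>
  Dominating the supremum by the series shows that it is integrable and almost everywhere finite.
\<close>

lemma reference_properties:
  fixes b :: "nat \<Rightarrow> real" and f :: "'t \<Rightarrow> 's \<Rightarrow> real"
  assumes f: "\<And>i. f (\<tau> i) \<in> Lplus \<alpha> \<mu>" and b: "\<And>i. 0 < b i"
    and summ: "summable (\<lambda>i. b i * (\<integral>s. f (\<tau> i) s powr \<alpha> \<partial>\<mu>))"
  shows "integrable \<mu> (reference \<alpha> b \<tau> f)"
    and "AE s in \<mu>. \<forall>i. b i * f (\<tau> i) s powr \<alpha> \<le> reference \<alpha> b \<tau> f s"
    and "AE s in \<mu>. (\<lambda>n. max0 {..<n} (\<lambda>i. b i * f (\<tau> i) s powr \<alpha>)) \<longlonglongrightarrow> reference \<alpha> b \<tau> f s"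
proof -
  let ?v = "\<lambda>i s. b i * f (\<tau> i) s powr \<alpha>"
  let ?S = "\<lambda>s. SUP i. ennreal (?v i s)"
  have fm [measurable]: "f (\<tau> i) \<in> borel_measurable \<mu>" for i using LplusD(1)[OF f] .
  have v0: "0 \<le> ?v i s" for i s using b[of i] by simp
  have "(\<integral>\<^sup>+s. ?S s \<partial>\<mu>) \<le> (\<integral>\<^sup>+s. (\<Sum>i. ennreal (?v i s)) \<partial>\<mu>)"
  proof (intro nn_integral_mono SUP_least)
    show "ennreal (?v i s) \<le> (\<Sum>i. ennreal (?v i s))" for i s
      using sum_le_suminf[of "\<lambda>i. ennreal (?v i s)" "{i}"] by simp
  qed
  also have "\<dots> = (\<Sum>i. \<integral>\<^sup>+s. ennreal (?v i s) \<partial>\<mu>)"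
    by (rule nn_integral_suminf) measurable
  also have "\<dots> = (\<Sum>i. ennreal (b i * (\<integral>s. f (\<tau> i) s powr \<alpha> \<partial>\<mu>)))"
    by (intro suminf_cong) (subst nn_integral_eq_integral, use LplusD(3)[OF f] v0 in auto)
  also have "\<dots> = ennreal (\<Sum>i. b i * (\<integral>s. f (\<tau> i) s powr \<alpha> \<partial>\<mu>))"
    using summ b by (intro suminf_ennreal2) (auto simp: less_imp_le)
  also have "\<dots> < \<infinity>" by simp
  finally have fin: "(\<integral>\<^sup>+s. ?S s \<partial>\<mu>) < \<infinity>" .
  then have AEfin: "AE s in \<mu>. ?S s \<noteq> \<infinity>"
    by (intro nn_integral_PInf_AE) auto
  show "integrable \<mu> (reference \<alpha> b \<tau> f)"
  proof (rule integrableI_nonneg)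
    show "reference \<alpha> b \<tau> f \<in> borel_measurable \<mu>" unfolding reference_def by measurable
    have "ennreal (reference \<alpha> b \<tau> f s) \<le> ?S s" for s
      unfolding reference_def by (simp add: ennreal_enn2real_if)
    then have "(\<integral>\<^sup>+s. ennreal (reference \<alpha> b \<tau> f s) \<partial>\<mu>) \<le> (\<integral>\<^sup>+s. ?S s \<partial>\<mu>)"
      by (intro nn_integral_mono)
    then show "(\<integral>\<^sup>+s. ennreal (reference \<alpha> b \<tau> f s) \<partial>\<mu>) < \<infinity>" using fin by (rule order.strict_trans1)
  qed auto
  have key: "ennreal (reference \<alpha> b \<tau> f s) = ?S s" if "?S s \<noteq> \<infinity>" for s
    unfolding reference_def
    by (rule ennreal_enn2real) (use that in \<open>simp only: top.not_eq_extremum infinity_ennreal_def\<close>)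
  have le: "?v i s \<le> reference \<alpha> b \<tau> f s" if "?S s \<noteq> \<infinity>" for i s
  proof -
    have "ennreal (?v i s) \<le> ennreal (reference \<alpha> b \<tau> f s)" unfolding key[OF that] by (rule SUP_upper) simp
    then show ?thesis by simp
  qed
  show "AE s in \<mu>. \<forall>i. ?v i s \<le> reference \<alpha> b \<tau> f s"
    using AEfin by eventually_elim (use le in blast)
  show "AE s in \<mu>. (\<lambda>n. max0 {..<n} (\<lambda>i. ?v i s)) \<longlonglongrightarrow> reference \<alpha> b \<tau> f s"
    using AEfin
  proof eventually_elim
    case (elim s)
    show ?case
    proof (rule increasing_tendsto)
      show "\<forall>\<^sub>F n in sequentially. max0 {..<n} (\<lambda>i. ?v i s) \<le> reference \<alpha> b \<tau> f s"
        using le[OF elim] by (simp add: max0_le_iff)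
      fix x assume x: "x < reference \<alpha> b \<tau> f s"
      show "\<forall>\<^sub>F n in sequentially. x < max0 {..<n} (\<lambda>i. ?v i s)"
      proof (cases "x < 0")
        case True
        have "x < max0 {..<n} (\<lambda>i. ?v i s)" for n
          using True max0_nonneg[of "{..<n}"] by (rule order.strict_trans2) simp
        then show ?thesis by simp
      next
        case False
        then have "ennreal x < ?S s" using x key[OF elim, symmetric] by (simp add: ennreal_less_iff)
        then obtain i where "ennreal x < ennreal (?v i s)" by (auto simp: less_SUP_iff)
        then have xi: "x < ?v i s" using False by (simp add: ennreal_less_iff)
        have "x < max0 {..<n} (\<lambda>i. ?v i s)" if "Suc i \<le> n" for n
          using xi le_max0[of "{..<n}" i "\<lambda>i. ?v i s"] that by simp
        then show ?thesis by (intro eventually_sequentiallyI[of "Suc i"])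
      qed
    qed
  qed
qed

section \<open>The exponents determine the normalized spectral measure\<close>

text \<open>
  Repeated indices merge, the largest coefficient winning.
\<close>

lemma max0_merge:
  assumes "finite J" "\<And>j. j \<in> J \<Longrightarrow> 0 \<le> h (\<sigma> j)"
  shows "max0 J (\<lambda>j. w j * h (\<sigma> j)) = max0 (\<sigma> ` J) (\<lambda>t. (MAX j\<in>{j\<in>J. \<sigma> j = t}. w j) * h t)"
    (is "?l = max0 _ (\<lambda>t. ?m t * h t)")
proof (rule antisym)
  have fin: "finite (\<sigma> ` J)" using assms by simp
  show "?l \<le> max0 (\<sigma> ` J) (\<lambda>t. ?m t * h t)"
    unfolding max0_le_iff[OF assms(1)]
  proof safe
    fix j assume j: "j \<in> J"
    have "w j * h (\<sigma> j) \<le> ?m (\<sigma> j) * h (\<sigma> j)"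
      using assms j by (intro mult_right_mono Max_ge) auto
    also have "\<dots> \<le> max0 (\<sigma> ` J) (\<lambda>t. ?m t * h t)"
      using le_max0[OF fin, of "\<sigma> j" "\<lambda>t. ?m t * h t"] j by simp
    finally show "w j * h (\<sigma> j) \<le> max0 (\<sigma> ` J) (\<lambda>t. ?m t * h t)" .
  qed (use fin in simp)
  show "max0 (\<sigma> ` J) (\<lambda>t. ?m t * h t) \<le> ?l"
    unfolding max0_le_iff[OF fin]
  proof safe
    fix j assume j: "j \<in> J"
    have "?m (\<sigma> j) \<in> w ` {i \<in> J. \<sigma> i = \<sigma> j}"
      using assms(1) j by (intro Max_in) auto
    then obtain i where i: "i \<in> J" "\<sigma> i = \<sigma> j" "?m (\<sigma> j) = w i" by auto
    then show "?m (\<sigma> j) * h (\<sigma> j) \<le> ?l"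
      using le_max0[OF assms(1) i(1), of "\<lambda>j. w j * h (\<sigma> j)"] by simp
  qed (use assms in simp)
qed

text \<open>
  Every finite weighted maximum of the powers, possibly with repeated indices, is the integrand of an
  exponent: the level for the weight \<open>m\<close> is \<open>m\<^sup>-\<^sup>1\<^sup>/\<^sup>\<alpha>\<close>.
\<close>

lemma weighted_max_eq_exponent:
  fixes h :: "'t \<Rightarrow> 's \<Rightarrow> real" and \<sigma> :: "'j \<Rightarrow> 't" and w :: "'j \<Rightarrow> real"
  assumes \<alpha>: "0 < \<alpha>" and J: "finite J" "\<And>j. j \<in> J \<Longrightarrow> 0 < w j"
  defines "m \<equiv> \<lambda>t. MAX j\<in>{j\<in>J. \<sigma> j = t}. w j"
  shows "(\<integral>s. max0 J (\<lambda>j. w j * h (\<sigma> j) s powr \<alpha>) \<partial>\<mu>) = exponent \<alpha> \<mu> h (\<sigma> ` J) (\<lambda>t. m t powr (- (1 / \<alpha>)))"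
    and "\<And>t. t \<in> \<sigma> ` J \<Longrightarrow> 0 < m t powr (- (1 / \<alpha>))"
proof -
  let ?x = "\<lambda>t. m t powr (- (1 / \<alpha>))"
  have m: "0 < m t" if "t \<in> \<sigma> ` J" for t
    using that J unfolding m_def by (subst Max_gr_iff) auto
  then show "0 < m t powr (- (1 / \<alpha>))" if "t \<in> \<sigma> ` J" for t using that by force
  have x: "inverse (?x t) powr \<alpha> = m t" if "t \<in> \<sigma> ` J" for t
    using m[OF that] \<alpha> by (simp add: powr_minus powr_powr)
  show "(\<integral>s. max0 J (\<lambda>j. w j * h (\<sigma> j) s powr \<alpha>) \<partial>\<mu>) = exponent \<alpha> \<mu> h (\<sigma> ` J) ?x"
    unfolding exponent_def
  proof (intro Bochner_Integration.integral_cong refl)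
    fix s
    have "max0 J (\<lambda>j. w j * h (\<sigma> j) s powr \<alpha>) = max0 (\<sigma> ` J) (\<lambda>t. m t * h t s powr \<alpha>)"
      unfolding m_def by (rule max0_merge[where h="\<lambda>t. h t s powr \<alpha>"]) (use J in auto)
    also have "\<dots> = max0 (\<sigma> ` J) (\<lambda>j. inverse (?x j) powr \<alpha> * h j s powr \<alpha>)"
      by (rule max0_cong) (simp only: x)
    finally show "max0 J (\<lambda>j. w j * h (\<sigma> j) s powr \<alpha>) = max0 (\<sigma> ` J) (\<lambda>j. inverse (?x j) powr \<alpha> * h j s powr \<alpha>)" .
  qed
qed

lemma weighted_exponent_eq:
  fixes f :: "'t \<Rightarrow> 's \<Rightarrow> real" and g :: "'t \<Rightarrow> 'r \<Rightarrow> real"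
  assumes \<alpha>: "0 < \<alpha>"
    and eq: "\<And>F x. finite F \<Longrightarrow> F \<subseteq> T \<Longrightarrow> (\<And>t. t \<in> F \<Longrightarrow> 0 < x t) \<Longrightarrow> exponent \<alpha> \<mu> f F x = exponent \<alpha> \<nu> g F x"
    and J: "finite J" "\<And>j. j \<in> J \<Longrightarrow> \<sigma> j \<in> T" "\<And>j. j \<in> J \<Longrightarrow> 0 < w j"
  shows "(\<integral>s. max0 J (\<lambda>j. w j * f (\<sigma> j) s powr \<alpha>) \<partial>\<mu>) = (\<integral>s. max0 J (\<lambda>j. w j * g (\<sigma> j) s powr \<alpha>) \<partial>\<nu>)"
proof -
  let ?x = "\<lambda>t. (MAX j\<in>{j\<in>J. \<sigma> j = t}. w j) powr (- (1 / \<alpha>))"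
  have "(\<integral>s. max0 J (\<lambda>j. w j * f (\<sigma> j) s powr \<alpha>) \<partial>\<mu>) = exponent \<alpha> \<mu> f (\<sigma> ` J) ?x"
    by (rule weighted_max_eq_exponent(1)[OF \<alpha> J(1)]) (rule J(3))
  also have "\<dots> = exponent \<alpha> \<nu> g (\<sigma> ` J) ?x"
  proof (rule eq)
    show "0 < ?x t" if "t \<in> \<sigma> ` J" for t
      using J(3) that by (rule weighted_max_eq_exponent(2)[OF \<alpha> J(1)])
  qed (use J in auto)
  also have "\<dots> = (\<integral>s. max0 J (\<lambda>j. w j * g (\<sigma> j) s powr \<alpha>) \<partial>\<nu>)"
    by (rule weighted_max_eq_exponent(1)[OF \<alpha> J(1), symmetric]) (rule J(3))
  finally show ?thesis .
qed

text \<open>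
  The reference function enters through its finite partial maxima, which are indexed by the right-hand
  side of \<open>F <+> {..<n}\<close>.
\<close>

lemma reference_max_limit:
  fixes f :: "'t \<Rightarrow> 's \<Rightarrow> real"
  assumes f: "\<And>t. t \<in> T \<Longrightarrow> f t \<in> Lplus \<alpha> \<mu>" and \<tau>: "\<And>i. \<tau> i \<in> T" and b: "\<And>i. 0 < b i"
    and summ: "summable (\<lambda>i. b i * (\<integral>s. f (\<tau> i) s powr \<alpha> \<partial>\<mu>))"
    and F: "finite F" "F \<subseteq> T" and c: "0 < c"
  shows "(\<lambda>n. \<integral>s. max0 (F <+> {..<n}) (\<lambda>j. case_sum y (\<lambda>i. c * b i) j * f (case_sum id \<tau> j) s powr \<alpha>) \<partial>\<mu>)
    \<longlonglongrightarrow> (\<integral>s. max (max0 F (\<lambda>t. y t * f t s powr \<alpha>)) (c * reference \<alpha> b \<tau> f s) \<partial>\<mu>)"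
proof -
  let ?u = "reference \<alpha> b \<tau> f" and ?W = "\<lambda>s. max0 F (\<lambda>t. y t * f t s powr \<alpha>)"
  let ?v = "\<lambda>n s. max0 {..<n} (\<lambda>i. b i * f (\<tau> i) s powr \<alpha>)"
  note ref = reference_properties[where f=f and \<tau>=\<tau> and b=b, OF f[OF \<tau>] b summ]
  have W: "integrable \<mu> ?W" using exponent_integrable[of F f \<alpha> \<mu> y] F f by auto
  have split: "max0 (F <+> {..<n}) (\<lambda>j. case_sum y (\<lambda>i. c * b i) j * f (case_sum id \<tau> j) s powr \<alpha>) =
      max (?W s) (c * ?v n s)" for n s
    using max0_Plus[OF F(1), of "{..<n}"] c
    by (simp add: max0_mult[symmetric] mult.assoc)
  have vm: "?v n \<in> borel_measurable \<mu>" for n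
    using LplusD(1)[OF f[OF \<tau>]] by (intro max0_measurable) auto
  show ?thesis
    unfolding split
  proof (rule integral_dominated_convergence[where w="\<lambda>s. ?W s + c * ?u s"])
    show "AE s in \<mu>. (\<lambda>n. max (?W s) (c * ?v n s)) \<longlonglongrightarrow> max (?W s) (c * ?u s)"
      using ref(3) by eventually_elim (intro tendsto_intros)
    show "AE s in \<mu>. norm (max (?W s) (c * ?v n s)) \<le> ?W s + c * ?u s" for n
      using ref(2)
    proof eventually_elim
      case (elim s)
      have "?v n s \<le> ?u s" using elim by (simp add: max0_le_iff)
      then have "c * ?v n s \<le> c * ?u s" using c by simp
      moreover have "0 \<le> ?W s" using F by simp
      moreover have "0 \<le> c * ?u s" "0 \<le> c * ?v n s" using c by auto
      ultimately show ?case by auto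
    qed
    show "integrable \<mu> (\<lambda>s. ?W s + c * ?u s)" using W ref(1) by simp
    show "(\<lambda>s. max (?W s) (c * ?u s)) \<in> borel_measurable \<mu>" using W ref(1) by measurable
    show "(\<lambda>s. max (?W s) (c * ?v n s)) \<in> borel_measurable \<mu>" for n using W vm by measurable
  qed
qed

text \<open>
  The derivative at \<open>c = 1\<close> from the right of \<open>c \<mapsto> \<integral> max W (c u)\<close>: the integrand grows at rate \<open>u\<close> where
  \<open>W \<le> u\<close> and is locally constant where \<open>W > u\<close>.
\<close>

lemma reference_indicator_limit:
  fixes u W :: "'s \<Rightarrow> real"
  assumes u: "integrable \<mu> u" "\<And>s. 0 \<le> u s" and W: "integrable \<mu> W"
  shows "(\<lambda>n. real (Suc n) * ((\<integral>s. max (W s) ((1 + 1 / real (Suc n)) * u s) \<partial>\<mu>) - (\<integral>s. max (W s) (1 * u s) \<partial>\<mu>)))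
    \<longlonglongrightarrow> (\<integral>s. u s * indicator {s. W s \<le> u s} s \<partial>\<mu>)"
proof -
  let ?c = "\<lambda>n. 1 + 1 / real (Suc n)"
  have [measurable]: "u \<in> borel_measurable \<mu>" "W \<in> borel_measurable \<mu>" using u W by auto
  have eq: "real (Suc n) * ((\<integral>s. max (W s) (?c n * u s) \<partial>\<mu>) - (\<integral>s. max (W s) (1 * u s) \<partial>\<mu>)) =
     (\<integral>s. real (Suc n) * (max (W s) (?c n * u s) - max (W s) (u s)) \<partial>\<mu>)" for n
    using u(1) W by simp
  have bound: "\<bar>real (Suc n) * (max (W s) (?c n * u s) - max (W s) (u s))\<bar> \<le> u s" for n s
  proof -
    have "?c n * u s = u s + u s / real (Suc n)" by (simp add: field_simps)
    moreover have "0 \<le> u s / real (Suc n)" using u(2) by simp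
    ultimately have "\<bar>max (W s) (?c n * u s) - max (W s) (u s)\<bar> \<le> u s / real (Suc n)" by auto
    then have "real (Suc n) * \<bar>max (W s) (?c n * u s) - max (W s) (u s)\<bar> \<le> real (Suc n) * (u s / real (Suc n))"
      by (rule mult_left_mono) simp
    then show ?thesis by (simp add: abs_mult)
  qed
  have lim: "(\<lambda>n. real (Suc n) * (max (W s) (?c n * u s) - max (W s) (u s))) \<longlonglongrightarrow> u s * indicator {s. W s \<le> u s} s" for s
  proof (cases "W s \<le> u s")
    case True
    have "real (Suc n) * (max (W s) (?c n * u s) - max (W s) (u s)) = u s" for n
    proof -
      have "?c n * u s = u s + u s / real (Suc n)" by (simp add: field_simps)
      moreover have "0 \<le> u s / real (Suc n)" using u(2) by simp
      ultimately have "max (W s) (?c n * u s) - max (W s) (u s) = u s / real (Suc n)" using True by auto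
      then show ?thesis by simp
    qed
    then show ?thesis using True by simp
  next
    case False
    have "(\<lambda>n. ?c n * u s) \<longlonglongrightarrow> (1 + 0) * u s"
      by (intro tendsto_intros LIMSEQ_Suc[OF lim_1_over_n])
    then have "\<forall>\<^sub>F n in sequentially. ?c n * u s < W s"
      using False by (auto intro: order_tendstoD)
    then have "\<forall>\<^sub>F n in sequentially. real (Suc n) * (max (W s) (?c n * u s) - max (W s) (u s)) = 0"
      by eventually_elim (use False in auto)
    then show ?thesis using False by (simp add: tendsto_eventually)
  qed
  show ?thesis
    unfolding eq
  proof (rule integral_dominated_convergence[where w=u])
    show "AE s in \<mu>. norm (real (Suc n) * (max (W s) (?c n * u s) - max (W s) (u s))) \<le> u s" for n
      using bound by simp
    show "AE s in \<mu>. (\<lambda>n. real (Suc n) * (max (W s) (?c n * u s) - max (W s) (u s))) \<longlonglongrightarrow> u s * indicator {s. W s \<le> u s} s"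
      using lim by simp
    show "(\<lambda>s. u s * indicator {s. W s \<le> u s} s) \<in> borel_measurable \<mu>"
      unfolding indicator_def by measurable
  qed (use u in auto)
qed

text \<open>
  The integrals of \<open>max W (c u)\<close> are limits of exponents, hence equal for the two families; so are
  their derivatives in \<open>c\<close>.
\<close>

lemma reference_halfspaces_eq:
  fixes f :: "'t \<Rightarrow> 's \<Rightarrow> real" and g :: "'t \<Rightarrow> 'r \<Rightarrow> real"
  assumes \<alpha>: "0 < \<alpha>"
    and f: "\<And>t. t \<in> T \<Longrightarrow> f t \<in> Lplus \<alpha> \<mu>" and g: "\<And>t. t \<in> T \<Longrightarrow> g t \<in> Lplus \<alpha> \<nu>"
    and eq: "\<And>F x. finite F \<Longrightarrow> F \<subseteq> T \<Longrightarrow> (\<And>t. t \<in> F \<Longrightarrow> 0 < x t) \<Longrightarrow> exponent \<alpha> \<mu> f F x = exponent \<alpha> \<nu> g F x"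
    and \<tau>: "\<And>i. \<tau> i \<in> T" and b: "\<And>i. 0 < b i"
    and sf: "summable (\<lambda>i. b i * (\<integral>s. f (\<tau> i) s powr \<alpha> \<partial>\<mu>))"
    and sg: "summable (\<lambda>i. b i * (\<integral>s. g (\<tau> i) s powr \<alpha> \<partial>\<nu>))"
    and F: "finite F" "F \<subseteq> T" and y: "\<And>t. t \<in> F \<Longrightarrow> 0 < y t"
  defines "u \<equiv> reference \<alpha> b \<tau> f" and "v \<equiv> reference \<alpha> b \<tau> g"
  shows "(\<integral>s. u s * indicator {s. max0 F (\<lambda>t. y t * f t s powr \<alpha>) \<le> u s} s \<partial>\<mu>) =
    (\<integral>s. v s * indicator {s. max0 F (\<lambda>t. y t * g t s powr \<alpha>) \<le> v s} s \<partial>\<nu>)"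
proof -
  let ?Wf = "\<lambda>s. max0 F (\<lambda>t. y t * f t s powr \<alpha>)" and ?Wg = "\<lambda>s. max0 F (\<lambda>t. y t * g t s powr \<alpha>)"
  have E: "(\<integral>s. max (?Wf s) (c * u s) \<partial>\<mu>) = (\<integral>s. max (?Wg s) (c * v s) \<partial>\<nu>)" if c: "0 < c" for c
  proof -
    have "(\<integral>s. max0 (F <+> {..<n}) (\<lambda>j. case_sum y (\<lambda>i. c * b i) j * f (case_sum id \<tau> j) s powr \<alpha>) \<partial>\<mu>) =
      (\<integral>s. max0 (F <+> {..<n}) (\<lambda>j. case_sum y (\<lambda>i. c * b i) j * g (case_sum id \<tau> j) s powr \<alpha>) \<partial>\<nu>)" for n
      by (rule weighted_exponent_eq[OF \<alpha> eq]) (use F \<tau> y b c in auto)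
    then show ?thesis
      using reference_max_limit[where f=f, OF f \<tau> b sf F c, of y] reference_max_limit[where f=g, OF g \<tau> b sg F c, of y]
      unfolding u_def v_def by (simp add: LIMSEQ_unique)
  qed
  have W: "integrable \<mu> ?Wf" "integrable \<nu> ?Wg"
    using exponent_integrable[of F f \<alpha> \<mu> y] exponent_integrable[of F g \<alpha> \<nu> y] F f g by auto
  have u: "integrable \<mu> u" "\<And>s. 0 \<le> u s" 
    unfolding u_def using reference_properties(1)[where f=f, OF f[OF \<tau>] b sf] by auto
  have v: "integrable \<nu> v" "\<And>s. 0 \<le> v s"
    unfolding v_def using reference_properties(1)[where f=g, OF g[OF \<tau>] b sg] by auto
  have c: "0 < 1 + 1 / real (Suc n)" for n by (intro add_pos_pos) auto
  show ?thesis
    using reference_indicator_limit[OF u W(1)] reference_indicator_limit[OF v W(2)]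
    unfolding E[OF c] E[OF zero_less_one] by (rule LIMSEQ_unique)
qed

text \<open>
  The value of this map at \<open>s\<close> is the direction of \<open>(f\<^sub>t(s)\<^sup>\<alpha>)\<^sub>t\<close>, normalized by the function \<open>u\<close>.
\<close>

definition ratio_map :: "real \<Rightarrow> 't set \<Rightarrow> ('t \<Rightarrow> 's \<Rightarrow> real) \<Rightarrow> ('s \<Rightarrow> real) \<Rightarrow> 's \<Rightarrow> 't \<Rightarrow> real" where
  "ratio_map \<alpha> T f u s = (\<lambda>t\<in>T. f t s powr \<alpha> / u s)"

definition spectral_measure :: "real \<Rightarrow> 't set \<Rightarrow> 's measure \<Rightarrow> ('t \<Rightarrow> 's \<Rightarrow> real) \<Rightarrow> ('s \<Rightarrow> real) \<Rightarrow> ('t \<Rightarrow> real) measure" where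
  "spectral_measure \<alpha> T \<mu> f u = distr (density \<mu> (\<lambda>s. ennreal (u s))) (PiM T (\<lambda>_. borel)) (ratio_map \<alpha> T f u)"

lemma ratio_map_measurable:
  assumes "\<And>t. t \<in> T \<Longrightarrow> f t \<in> borel_measurable \<mu>" "u \<in> borel_measurable \<mu>"
  shows "ratio_map \<alpha> T f u \<in> measurable \<mu> (PiM T (\<lambda>_. borel))"
  unfolding ratio_map_def [abs_def] using assms
  by (intro measurable_restrict) measurable

text \<open>
  The distribution function of the normalized powers at \<open>x\<close> is the quantity determined by the
  derivative above, with weights \<open>1 / x t\<close>.
\<close>

lemma measure_density_halfspace:
  fixes f :: "'t \<Rightarrow> 's \<Rightarrow> real"
  assumes f: "\<And>t. t \<in> F \<Longrightarrow> f t \<in> borel_measurable \<mu>" and F: "finite F" and x: "\<And>t. t \<in> F \<Longrightarrow> 0 < x t"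
    and u: "integrable \<mu> u" "AE s in \<mu>. 0 < u s"
  shows "measure (density \<mu> (\<lambda>s. ennreal (u s))) {s \<in> space (density \<mu> (\<lambda>s. ennreal (u s))). \<forall>t\<in>F. f t s powr \<alpha> / u s \<le> x t} =
    (\<integral>s. u s * indicator {s. max0 F (\<lambda>t. inverse (x t) * f t s powr \<alpha>) \<le> u s} s \<partial>\<mu>)"
proof -
  let ?m = "density \<mu> (\<lambda>s. ennreal (u s))"
  let ?A = "{s \<in> space \<mu>. \<forall>t\<in>F. f t s powr \<alpha> / u s \<le> x t}"
  have um [measurable]: "u \<in> borel_measurable \<mu>" using u by auto
  have A: "?A \<in> sets \<mu>"
  proof (rule sets_all_le[OF F])
    fix t assume "t \<in> F"
    then have [measurable]: "f t \<in> borel_measurable \<mu>" using f by auto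
    show "(\<lambda>s. f t s powr \<alpha> / u s) \<in> borel_measurable \<mu>" by measurable
  qed
  have "measure ?m ?A = (\<integral>s. indicator ?A s \<partial>?m)"
    using A by (simp add: Int_absorb2)
  also have "\<dots> = (\<integral>s. u s *\<^sub>R indicator ?A s \<partial>\<mu>)"
    using A u(2) by (intro integral_density) (auto elim: eventually_mono)
  also have "\<dots> = (\<integral>s. u s * indicator {s. max0 F (\<lambda>t. inverse (x t) * f t s powr \<alpha>) \<le> u s} s \<partial>\<mu>)"
  proof (rule integral_cong_AE)
    show "AE s in \<mu>. u s *\<^sub>R indicator ?A s = u s * indicator {s. max0 F (\<lambda>t. inverse (x t) * f t s powr \<alpha>) \<le> u s} s"
      using u(2) AE_space
    proof eventually_elim
      case (elim s)
      have "f t s powr \<alpha> / u s \<le> x t \<longleftrightarrow> inverse (x t) * f t s powr \<alpha> \<le> u s" if "t \<in> F" for t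
        using elim(1) x[OF that] by (simp add: field_simps)
      then have "s \<in> ?A \<longleftrightarrow> max0 F (\<lambda>t. inverse (x t) * f t s powr \<alpha>) \<le> u s"
        using elim F by (simp add: max0_le_iff)
      then show ?case by (simp add: indicator_def)
    qed
    show "(\<lambda>s. u s *\<^sub>R (indicator ?A s :: real)) \<in> borel_measurable \<mu>"
      unfolding real_scaleR_def by (rule borel_measurable_times[OF um borel_measurable_indicator[OF A]])
    have "(\<lambda>s. max0 F (\<lambda>t. inverse (x t) * f t s powr \<alpha>)) \<in> borel_measurable \<mu>"
      using F f by (intro max0_measurable) auto
    then show "(\<lambda>s. u s * indicator {s. max0 F (\<lambda>t. inverse (x t) * f t s powr \<alpha>) \<le> u s} s) \<in> borel_measurable \<mu>"
      unfolding indicator_def by measurable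
  qed
  finally show ?thesis by simp
qed

lemma finite_measure_density:
  assumes "integrable \<mu> u" "\<And>s. 0 \<le> u s"
  shows "finite_measure (density \<mu> (\<lambda>s. ennreal (u s)))"
proof (rule finite_measureI)
  have "emeasure (density \<mu> (\<lambda>s. ennreal (u s))) (space \<mu>) = (\<integral>\<^sup>+s. ennreal (u s) \<partial>\<mu>)"
    using assms by (subst emeasure_density) (auto intro!: nn_integral_cong)
  also have "\<dots> = ennreal (\<integral>s. u s \<partial>\<mu>)" using assms by (intro nn_integral_eq_integral) auto
  finally show "emeasure (density \<mu> (\<lambda>s. ennreal (u s))) (space (density \<mu> (\<lambda>s. ennreal (u s)))) \<noteq> \<infinity>" by simp
qed

text \<open>
  The countable sets that carry the supports of the two families are joined, and the same sequence of
  indices and weights is used for both reference functions. The weights make the series of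
  integrals converge for both families, because single integrals agree. Equality of the exponents then
  forces the normalized spectral measures to agree.
\<close>

lemma spectral_measure_eq:
  fixes f :: "'t \<Rightarrow> 's \<Rightarrow> real" and g :: "'t \<Rightarrow> 'r \<Rightarrow> real"
  assumes \<alpha>: "0 < \<alpha>"
    and f: "\<And>t. t \<in> T \<Longrightarrow> f t \<in> Lplus \<alpha> \<mu>" and g: "\<And>t. t \<in> T \<Longrightarrow> g t \<in> Lplus \<alpha> \<nu>"
    and supp: "is_support \<alpha> \<mu> T f (space \<mu>)" "is_support \<alpha> \<nu> T g (space \<nu>)"
    and eq: "\<And>F x. finite F \<Longrightarrow> F \<subseteq> T \<Longrightarrow> (\<And>t. t \<in> F \<Longrightarrow> 0 < x t) \<Longrightarrow> exponent \<alpha> \<mu> f F x = exponent \<alpha> \<nu> g F x"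
  obtains u v where "integrable \<mu> u" "\<And>s. 0 \<le> u s" "AE s in \<mu>. 0 < u s"
    "integrable \<nu> v" "\<And>s. 0 \<le> v s" "AE s in \<nu>. 0 < v s"
    "spectral_measure \<alpha> T \<mu> f u = spectral_measure \<alpha> T \<nu> g v"
proof -
  obtain Tf where Tf: "countable Tf" "Tf \<noteq> {}" "Tf \<subseteq> T" "AE s in \<mu>. \<exists>t\<in>Tf. 0 < f t s"
    using support_countable_cover[OF \<alpha> f supp(1)] by blast
  obtain Tg where Tg: "countable Tg" "Tg \<noteq> {}" "Tg \<subseteq> T" "AE s in \<nu>. \<exists>t\<in>Tg. 0 < g t s"
    using support_countable_cover[OF \<alpha> g supp(2)] by blast
  define \<tau> where "\<tau> = from_nat_into (Tf \<union> Tg)"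
  have range: "range \<tau> = Tf \<union> Tg" unfolding \<tau>_def using Tf Tg by (intro range_from_nat_into) auto
  have \<tau>: "\<tau> i \<in> T" for i using rangeI[of \<tau> i] Tf(3) Tg(3) unfolding range by blast
  have e: "(\<integral>s. g t s powr \<alpha> \<partial>\<nu>) = (\<integral>s. f t s powr \<alpha> \<partial>\<mu>)" if "t \<in> T" for t
  proof -
    have "(\<integral>s. max0 {t} (\<lambda>j. 1 * f j s powr \<alpha>) \<partial>\<mu>) = (\<integral>s. max0 {t} (\<lambda>j. 1 * g j s powr \<alpha>) \<partial>\<nu>)"
      by (rule weighted_exponent_eq[where \<sigma>="\<lambda>t. t" and w="\<lambda>_. 1", OF \<alpha> eq]) (use that in auto)
    then show ?thesis by (simp add: max0_insert)
  qed
  let ?e = "\<lambda>i. \<integral>s. f (\<tau> i) s powr \<alpha> \<partial>\<mu>"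
  have e0: "0 \<le> ?e i" for i by (intro integral_nonneg_AE) auto
  \<comment> \<open>Any positive weights with a convergent series of integrals would do.\<close>
  define b where "b i = (1 / 2) ^ i / (1 + ?e i)" for i
  have b: "0 < b i" for i unfolding b_def using e0[of i] by (intro divide_pos_pos add_pos_nonneg) auto
  have sf: "summable (\<lambda>i. b i * ?e i)"
  proof (rule summable_comparison_test'[of "\<lambda>i. (1 / 2) ^ i" 0])
    show "norm (b i * ?e i) \<le> (1 / 2) ^ i" for i
    proof -
      have "b i * ?e i = (1 / 2) ^ i * (?e i / (1 + ?e i))" by (simp add: b_def)
      also have "\<dots> \<le> (1 / 2) ^ i * 1"
      proof (rule mult_left_mono)
        have "0 < 1 + ?e i" using e0 by (rule add_pos_nonneg[OF zero_less_one])
        then show "?e i / (1 + ?e i) \<le> 1" by (subst divide_le_eq_1_pos) auto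
      qed simp
      finally show ?thesis using b[of i] e0[of i] by simp
    qed
  qed (simp add: summable_geometric)
  then have sg: "summable (\<lambda>i. b i * (\<integral>s. g (\<tau> i) s powr \<alpha> \<partial>\<nu>))" by (simp add: e[OF \<tau>])
  let ?u = "reference \<alpha> b \<tau> f" and ?v = "reference \<alpha> b \<tau> g"
  note rf = reference_properties[where f=f, OF f[OF \<tau>] b sf]
  note rg = reference_properties[where f=g, OF g[OF \<tau>] b sg]
  have u_pos: "AE s in \<mu>. 0 < ?u s"
    using Tf(4) rf(2)
  proof eventually_elim
    case (elim s)
    then obtain t where t: "t \<in> Tf" "0 < f t s" by auto
    then have "t \<in> range \<tau>" unfolding range by simp
    then obtain i where "\<tau> i = t" by auto
    then have "0 < b i * f (\<tau> i) s powr \<alpha>" using b t by simp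
    then show ?case using elim(2) by (meson order.strict_trans2)
  qed
  have v_pos: "AE s in \<nu>. 0 < ?v s"
    using Tg(4) rg(2)
  proof eventually_elim
    case (elim s)
    then obtain t where t: "t \<in> Tg" "0 < g t s" by auto
    then have "t \<in> range \<tau>" unfolding range by simp
    then obtain i where "\<tau> i = t" by auto
    then have "0 < b i * g (\<tau> i) s powr \<alpha>" using b t by simp
    then show ?case using elim(2) by (meson order.strict_trans2)
  qed
  have "spectral_measure \<alpha> T \<mu> f ?u = spectral_measure \<alpha> T \<nu> g ?v"
    unfolding spectral_measure_def ratio_map_def [abs_def]
  proof (rule nonneg_process_law_eqI)
    show "finite_measure (density \<mu> (\<lambda>s. ennreal (?u s)))" "finite_measure (density \<nu> (\<lambda>s. ennreal (?v s)))"
      using rf(1) rg(1) by (auto intro: finite_measure_density)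
    show "(\<lambda>s. f t s powr \<alpha> / ?u s) \<in> borel_measurable (density \<mu> (\<lambda>s. ennreal (?u s)))" if "t \<in> T" for t
      using LplusD(1)[OF f[OF that]] rf(1) by simp
    show "(\<lambda>s. g t s powr \<alpha> / ?v s) \<in> borel_measurable (density \<nu> (\<lambda>s. ennreal (?v s)))" if "t \<in> T" for t
      using LplusD(1)[OF g[OF that]] rg(1) by simp
    fix F and x :: "'t \<Rightarrow> real" assume F: "finite F" "F \<subseteq> T" and x: "\<And>t. t \<in> F \<Longrightarrow> 0 < x t"
    have fm: "f t \<in> borel_measurable \<mu>" and gm: "g t \<in> borel_measurable \<nu>" if "t \<in> F" for t
      using that F LplusD(1)[OF f] LplusD(1)[OF g] by auto
    have "measure (density \<mu> (\<lambda>s. ennreal (?u s))) {s \<in> space (density \<mu> (\<lambda>s. ennreal (?u s))). \<forall>t\<in>F. f t s powr \<alpha> / ?u s \<le> x t} =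
        (\<integral>s. ?u s * indicator {s. max0 F (\<lambda>t. inverse (x t) * f t s powr \<alpha>) \<le> ?u s} s \<partial>\<mu>)"
      by (rule measure_density_halfspace[OF fm F(1) x rf(1) u_pos])
    also have "\<dots> = (\<integral>s. ?v s * indicator {s. max0 F (\<lambda>t. inverse (x t) * g t s powr \<alpha>) \<le> ?v s} s \<partial>\<nu>)"
      by (rule reference_halfspaces_eq[OF \<alpha> f g eq \<tau> b sf sg F]) (use x in auto)
    also have "\<dots> = measure (density \<nu> (\<lambda>s. ennreal (?v s))) {s \<in> space (density \<nu> (\<lambda>s. ennreal (?v s))). \<forall>t\<in>F. g t s powr \<alpha> / ?v s \<le> x t}"
      by (rule measure_density_halfspace[OF gm F(1) x rg(1) v_pos, symmetric])
    finally show "measure (density \<mu> (\<lambda>s. ennreal (?u s))) {s \<in> space (density \<mu> (\<lambda>s. ennreal (?u s))). \<forall>t\<in>F. f t s powr \<alpha> / ?u s \<le> x t} =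
      measure (density \<nu> (\<lambda>s. ennreal (?v s))) {s \<in> space (density \<nu> (\<lambda>s. ennreal (?v s))). \<forall>t\<in>F. g t s powr \<alpha> / ?v s \<le> x t}" .
  qed auto
  then show thesis using that[of ?u ?v] rf(1) rg(1) u_pos v_pos by auto
qed

text \<open>
  Where \<open>u > 0\<close> the ratios \<open>f\<^sub>t / f\<^sub>t\<^sub>'\<close> are functions of the normalized powers, so each set of the ratio
  \<open>\<sigma>\<close>-field is a preimage there.
\<close>

lemma ratio_sigma_field_pullback:
  fixes f :: "'t \<Rightarrow> 's \<Rightarrow> real"
  assumes \<alpha>: "0 < \<alpha>" and f: "\<And>t s. t \<in> T \<Longrightarrow> s \<in> space \<mu> \<Longrightarrow> 0 \<le> f t s"
    and A: "A \<in> ratio_sigma_field \<mu> T f"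
  shows "\<exists>C\<in>sets (PiM T (\<lambda>_. borel)). \<forall>s\<in>space \<mu>. 0 < u s \<longrightarrow> (s \<in> A \<longleftrightarrow> ratio_map \<alpha> T f u s \<in> C)"
  using A unfolding ratio_sigma_field_def
proof (induction rule: sigma_sets.induct)
  case (Basic A)
  then obtain t t' B where tB: "t \<in> T" "t' \<in> T" "B \<in> sets borel"
    and A: "A = (\<lambda>s. ennreal (f t s) / ennreal (f t' s)) -` B \<inter> space \<mu>" by auto
  let ?Pi = "PiM T (\<lambda>_. borel :: real measure)"
  let ?r = "\<lambda>z :: 't \<Rightarrow> real. ennreal (z t powr (1 / \<alpha>)) / ennreal (z t' powr (1 / \<alpha>))"
  have [measurable]: "(\<lambda>z. z t) \<in> borel_measurable ?Pi" "(\<lambda>z. z t') \<in> borel_measurable ?Pi"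
    using tB by (auto intro: measurable_component_singleton)
  have "?r \<in> borel_measurable ?Pi" by measurable
  then have "?r -` B \<inter> space ?Pi \<in> sets ?Pi" using tB(3) by (rule measurable_sets)
  moreover have "s \<in> A \<longleftrightarrow> ratio_map \<alpha> T f u s \<in> ?r -` B \<inter> space ?Pi" if s: "s \<in> space \<mu>" "0 < u s" for s
  proof -
    let ?k = "u s powr (1 / \<alpha>)"
    have k: "0 < ?k" using s by simp
    have root: "(f r s powr \<alpha> / u s) powr (1 / \<alpha>) = f r s / ?k" if "r \<in> T" for r
      using f[OF that s(1)] s \<alpha> by (simp add: powr_divide powr_powr)
    have "?r (ratio_map \<alpha> T f u s) = ennreal (f t s / ?k) / ennreal (f t' s / ?k)"
      using tB by (simp add: ratio_map_def root)
    also have "\<dots> = ennreal (f t s) / ennreal (f t' s)"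
    proof (cases "f t' s = 0")
      case True
      have "f t s = 0 \<or> 0 < f t s" using f[OF tB(1) s(1)] by auto
      then show ?thesis using True k by (auto simp: ennreal_divide_zero)
    next
      case False
      then have "0 < f t' s" using f[OF tB(2) s(1)] by simp
      then show ?thesis using k f[OF tB(1) s(1)] by (simp add: divide_ennreal)
    qed
    finally have "?r (ratio_map \<alpha> T f u s) = ennreal (f t s) / ennreal (f t' s)" .
    moreover have "ratio_map \<alpha> T f u s \<in> space ?Pi" by (simp add: ratio_map_def space_PiM)
    ultimately show ?thesis using s by (simp add: A)
  qed
  ultimately show ?case by blast
next
  case Empty
  show ?case by (intro bexI[of _ "{}"]) auto
next
  case (Compl A)
  let ?Pi = "PiM T (\<lambda>_. borel :: real measure)"
  obtain C where C: "C \<in> sets ?Pi" "\<forall>s\<in>space \<mu>. 0 < u s \<longrightarrow> (s \<in> A \<longleftrightarrow> ratio_map \<alpha> T f u s \<in> C)"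
    using Compl.IH by blast
  have "ratio_map \<alpha> T f u s \<in> space ?Pi" for s by (simp add: ratio_map_def space_PiM)
  with C show ?case by (intro bexI[of _ "space ?Pi - C"]) auto
next
  case (Union A)
  let ?Pi = "PiM T (\<lambda>_. borel :: real measure)"
  have "\<forall>i. \<exists>C. C \<in> sets ?Pi \<and> (\<forall>s\<in>space \<mu>. 0 < u s \<longrightarrow> (s \<in> A i \<longleftrightarrow> ratio_map \<alpha> T f u s \<in> C))"
    using Union.IH by blast
  then obtain C where C: "\<And>i. C i \<in> sets ?Pi" "\<And>i s. s \<in> space \<mu> \<Longrightarrow> 0 < u s \<Longrightarrow> s \<in> A i \<longleftrightarrow> ratio_map \<alpha> T f u s \<in> C i"
    by (simp only: choice_iff) blast
  then show ?case by (intro bexI[of _ "\<Union>i. C i"]) auto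
qed

text \<open>
  This is how minimality is used: up to null sets the ratio map loses no information about the base
  space.
\<close>

lemma minimal_rep_pullback:
  assumes \<alpha>: "0 < \<alpha>" and X: "minimal_rep P \<alpha> T X \<mu> f" and u: "AE s in \<mu>. 0 < u s" and B: "B \<in> sets \<mu>"
  shows "\<exists>C\<in>sets (PiM T (\<lambda>_. borel)). AE s in \<mu>. s \<in> B \<longleftrightarrow> ratio_map \<alpha> T f u s \<in> C"
proof -
  obtain A where A: "A \<in> ratio_sigma_field \<mu> T f" "sym_diff A B \<in> null_sets \<mu>"
    using X B unfolding minimal_rep_def by blast
  have "0 \<le> f t s" if "t \<in> T" "s \<in> space \<mu>" for t s
    using X that unfolding minimal_rep_def spectral_rep_def by (auto intro: LplusD(2))
  from ratio_sigma_field_pullback[where u=u, OF \<alpha> this A(1)]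
  obtain C where C: "C \<in> sets (PiM T (\<lambda>_. borel))" "\<forall>s\<in>space \<mu>. 0 < u s \<longrightarrow> (s \<in> A \<longleftrightarrow> ratio_map \<alpha> T f u s \<in> C)"
    by blast
  have "AE s in \<mu>. s \<in> B \<longleftrightarrow> ratio_map \<alpha> T f u s \<in> C"
    using u AE_not_in[OF A(2)] AE_space
  proof eventually_elim
    case (elim s)
    then show ?case using C(2) by auto
  qed
  with C(1) show ?thesis by blast
qed

text \<open>
  The density is almost everywhere positive, so null sets of the spectral measure are exactly the sets
  with null preimage.
\<close>

lemma AE_spectral_measure_iff:
  assumes f: "\<And>t. t \<in> T \<Longrightarrow> f t \<in> borel_measurable \<mu>" and u: "u \<in> borel_measurable \<mu>" "AE s in \<mu>. 0 < u s"
    and C: "C \<in> sets (PiM T (\<lambda>_. borel))"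
  shows "(AE z in spectral_measure \<alpha> T \<mu> f u. z \<notin> C) \<longleftrightarrow> (AE s in \<mu>. ratio_map \<alpha> T f u s \<notin> C)"
proof -
  have m: "ratio_map \<alpha> T f u \<in> measurable (density \<mu> (\<lambda>s. ennreal (u s))) (PiM T (\<lambda>_. borel))"
    using ratio_map_measurable[OF f u(1)] by simp
  have "{z \<in> space (PiM T (\<lambda>_. borel)). z \<notin> C} = space (PiM T (\<lambda>_. borel)) - C" by auto
  then have "{z \<in> space (PiM T (\<lambda>_. borel)). z \<notin> C} \<in> sets (PiM T (\<lambda>_. borel))" using C by auto
  then have "(AE z in spectral_measure \<alpha> T \<mu> f u. z \<notin> C) \<longleftrightarrow> (AE s in density \<mu> (\<lambda>s. ennreal (u s)). ratio_map \<alpha> T f u s \<notin> C)"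
    unfolding spectral_measure_def by (rule AE_distr_iff[OF m])
  also have "\<dots> \<longleftrightarrow> (AE s in \<mu>. 0 < ennreal (u s) \<longrightarrow> ratio_map \<alpha> T f u s \<notin> C)"
    using u(1) by (intro AE_density) auto
  also have "\<dots> \<longleftrightarrow> (AE s in \<mu>. ratio_map \<alpha> T f u s \<notin> C)"
  proof
    assume "AE s in \<mu>. 0 < ennreal (u s) \<longrightarrow> ratio_map \<alpha> T f u s \<notin> C"
    with u(2) show "AE s in \<mu>. ratio_map \<alpha> T f u s \<notin> C" by eventually_elim simp
  qed (auto elim: eventually_mono)
  finally show ?thesis .
qed

text \<open>
  The density and the normalization cancel.
\<close>

lemma exponent_restrict_spectral_measure:
  fixes f :: "'t \<Rightarrow> 's \<Rightarrow> real"
  assumes f: "\<And>t. t \<in> T \<Longrightarrow> f t \<in> Lplus \<alpha> \<mu>"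
    and u: "integrable \<mu> u" "\<And>s. 0 \<le> u s" "AE s in \<mu>. 0 < u s"
    and D: "D \<in> sets \<mu>" and C: "C \<in> sets (PiM T (\<lambda>_. borel))" "AE s in \<mu>. s \<in> D \<longleftrightarrow> ratio_map \<alpha> T f u s \<in> C"
    and F: "finite F" "F \<subseteq> T"
  shows "exponent \<alpha> (restrict_space \<mu> D) f F x =
    (\<integral>z. indicator C z * max0 F (\<lambda>t. inverse (x t) powr \<alpha> * z t) \<partial>spectral_measure \<alpha> T \<mu> f u)"
proof -
  let ?Pi = "PiM T (\<lambda>_. borel :: real measure)"
  let ?h = "\<lambda>z :: 't \<Rightarrow> real. indicator C z * max0 F (\<lambda>t. inverse (x t) powr \<alpha> * z t) :: real"
  let ?\<phi> = "ratio_map \<alpha> T f u"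
  have um [measurable]: "u \<in> borel_measurable \<mu>" using u by auto
  have \<phi> [measurable]: "?\<phi> \<in> measurable \<mu> ?Pi" using f by (intro ratio_map_measurable um) (auto intro: LplusD)
  have comp: "(\<lambda>z. z t) \<in> borel_measurable ?Pi" if "t \<in> F" for t
    using that F by (intro measurable_component_singleton) auto
  have "(\<lambda>z. max0 F (\<lambda>t. inverse (x t) powr \<alpha> * z t)) \<in> borel_measurable ?Pi"
    using F comp by (intro max0_measurable borel_measurable_times) auto
  then have hm [measurable]: "?h \<in> borel_measurable ?Pi"
    using C(1) by (intro borel_measurable_times borel_measurable_indicator)
  have h\<phi>: "(\<lambda>s. ?h (?\<phi> s)) \<in> borel_measurable \<mu>" by (rule measurable_compose[OF \<phi> hm])
  have "(\<integral>z. ?h z \<partial>spectral_measure \<alpha> T \<mu> f u) = (\<integral>s. ?h (?\<phi> s) \<partial>density \<mu> (\<lambda>s. ennreal (u s)))"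
    unfolding spectral_measure_def by (rule integral_distr[OF _ hm]) (simp add: \<phi>)
  also have "\<dots> = (\<integral>s. u s *\<^sub>R ?h (?\<phi> s) \<partial>\<mu>)"
    by (rule integral_density[OF h\<phi> um]) (simp add: u(2))
  also have "\<dots> = (\<integral>s. indicator D s * max0 F (\<lambda>t. inverse (x t) powr \<alpha> * f t s powr \<alpha>) \<partial>\<mu>)"
  proof (rule integral_cong_AE)
    show "(\<lambda>s. u s *\<^sub>R ?h (?\<phi> s)) \<in> borel_measurable \<mu>"
      by (rule borel_measurable_scaleR[OF um h\<phi>])
    have "(\<lambda>s. max0 F (\<lambda>t. inverse (x t) powr \<alpha> * f t s powr \<alpha>)) \<in> borel_measurable \<mu>"
      by (rule borel_measurable_integrable, rule exponent_integrable[OF F(1)]) (use F(2) f in blast)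
    then show "(\<lambda>s. indicator D s * max0 F (\<lambda>t. inverse (x t) powr \<alpha> * f t s powr \<alpha>)) \<in> borel_measurable \<mu>"
      using D by (intro borel_measurable_times borel_measurable_indicator)
    show "AE s in \<mu>. u s *\<^sub>R ?h (?\<phi> s) = indicator D s * max0 F (\<lambda>t. inverse (x t) powr \<alpha> * f t s powr \<alpha>)"
      using C(2) u(3)
    proof eventually_elim
      case (elim s)
      have "u s * max0 F (\<lambda>t. inverse (x t) powr \<alpha> * ?\<phi> s t) = max0 F (\<lambda>t. u s * (inverse (x t) powr \<alpha> * ?\<phi> s t))"
        using F elim by (simp add: max0_mult)
      also have "\<dots> = max0 F (\<lambda>t. inverse (x t) powr \<alpha> * f t s powr \<alpha>)"
        using F elim by (intro max0_cong) (auto simp: ratio_map_def)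
      finally show ?case using elim(1) by (auto simp: indicator_def)
    qed
  qed
  also have "\<dots> = exponent \<alpha> (restrict_space \<mu> D) f F x"
    by (rule exponent_restrict[OF D F(1), symmetric])
  finally show ?thesis by simp
qed

section \<open>The atomic part is intrinsic\<close>

text \<open>
  The rationals already determine a real value by the sides on which it lies, and countably many
  exceptional null sets can be united.
\<close>

lemma AE_eq_const_of_dichotomy:
  fixes r :: "'a \<Rightarrow> real"
  assumes dich: "\<And>q. (AE s in \<nu>. R s \<longrightarrow> r s \<le> q) \<or> (AE s in \<nu>. R s \<longrightarrow> q < r s)"
  shows "\<exists>q. AE s in \<nu>. R s \<longrightarrow> r s = q"
proof -
  \<comment> \<open>A Dedekind cut: every rational lies in \<open>L\<close> or in \<open>U\<close>, so the cut admits at most one value.\<close>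
  define L where "L = {q \<in> \<rat>. AE s in \<nu>. R s \<longrightarrow> q < r s}"
  define U where "U = {q \<in> \<rat>. AE s in \<nu>. R s \<longrightarrow> r s \<le> q}"
  have LU: "q \<in> L \<or> q \<in> U" if "q \<in> \<rat>" for q using dich[of q] that by (auto simp: L_def U_def)
  have cLU: "countable L" "countable U"
    unfolding L_def U_def using countable_rat by (auto intro: countable_subset)
  have "AE s in \<nu>. \<forall>q\<in>L. R s \<longrightarrow> q < r s" "AE s in \<nu>. \<forall>q\<in>U. R s \<longrightarrow> r s \<le> q"
    unfolding AE_ball_countable[OF cLU(1)] AE_ball_countable[OF cLU(2)] by (simp_all add: L_def U_def)
  then have good: "AE s in \<nu>. R s \<longrightarrow> (\<forall>q\<in>L. q < r s) \<and> (\<forall>q\<in>U. r s \<le> q)"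
    by eventually_elim auto
  have lt: "\<not> r s < r s'" if cut: "\<forall>q\<in>L. q < r s" "\<forall>q\<in>U. r s' \<le> q" for s s'
  proof
    assume "r s < r s'"
    then obtain q where "q \<in> \<rat>" "r s < q" "q < r s'" using Rats_dense_in_real by blast
    then show False using LU[of q] cut by force
  qed
  show ?thesis
  proof (cases "\<exists>s0. (\<forall>q\<in>L. q < r s0) \<and> (\<forall>q\<in>U. r s0 \<le> q)")
    case True
    then obtain s0 where s0: "\<forall>q\<in>L. q < r s0" "\<forall>q\<in>U. r s0 \<le> q" by blast
    have "AE s in \<nu>. R s \<longrightarrow> r s = r s0"
      using good
    proof eventually_elim
      case (elim s)
      then show ?case using lt[of s s0] lt[of s0 s] s0 by force
    qed
    then show ?thesis by blast
  next
    case False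
    have "AE s in \<nu>. R s \<longrightarrow> r s = 0"
      using good by eventually_elim (use False in auto)
    then show ?thesis by blast
  qed
qed

text \<open>
  A set \<open>C\<close> whose preimage under \<open>\<phi>\<close> is at most one point cannot be split: for every
  measurable \<open>B\<close>, one of \<open>C \<inter> B\<close> and \<open>C - B\<close> is null. Null sets being common, the preimage under
  \<open>\<psi>\<close> cannot be split by any half-line either, so it is a single point up to a null set.
  Outside \<open>D\<close> points are null.
\<close>

lemma point_image_atomic:
  fixes \<nu> :: "real measure" and \<phi> :: "'s \<Rightarrow> 'z" and \<psi> :: "real \<Rightarrow> 'z"
  assumes null: "\<And>C. C \<in> sets V \<Longrightarrow> (AE s in \<mu>. \<phi> s \<notin> C) \<longleftrightarrow> (AE s in \<nu>. \<psi> s \<notin> C)"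
    and gen: "\<And>B. B \<in> sets \<nu> \<Longrightarrow> \<exists>C\<in>sets V. AE s in \<nu>. s \<in> B \<longleftrightarrow> \<psi> s \<in> C"
    and D: "D \<in> sets \<nu>" "\<And>q. q \<notin> D \<Longrightarrow> AE s in \<nu>. s \<noteq> q"
    and ray: "\<And>q. {s \<in> space \<nu>. s \<le> q} \<in> sets \<nu>"
    and C: "C \<in> sets V" "AE s in \<mu>. \<phi> s \<in> C \<longrightarrow> s = p"
  shows "AE s in \<nu>. \<psi> s \<in> C \<longrightarrow> s \<in> D"
proof -
  obtain CD where CD: "CD \<in> sets V" "AE s in \<nu>. s \<in> D \<longleftrightarrow> \<psi> s \<in> CD" using gen[OF D(1)] by blast
  \<comment> \<open>The part of \<open>C\<close> that would have to sit in the diffuse part.\<close>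
  define E where "E = C - CD"
  have E: "E \<in> sets V" using C CD by (auto simp: E_def)
  have "(AE s in \<nu>. \<psi> s \<in> E \<longrightarrow> s \<le> q) \<or> (AE s in \<nu>. \<psi> s \<in> E \<longrightarrow> q < s)" for q
  proof -
    obtain Cq where Cq: "Cq \<in> sets V" "AE s in \<nu>. s \<in> {s \<in> space \<nu>. s \<le> q} \<longleftrightarrow> \<psi> s \<in> Cq"
      using gen[OF ray] by blast
    show ?thesis
    proof (cases "\<phi> p \<in> Cq")
      case True
      have "AE s in \<mu>. \<phi> s \<notin> E - Cq"
        using C(2) by eventually_elim (use True in \<open>auto simp: E_def\<close>)
      then have "AE s in \<nu>. \<psi> s \<notin> E - Cq" using null[of "E - Cq"] E Cq by auto
      then have "AE s in \<nu>. \<psi> s \<in> E \<longrightarrow> s \<le> q" using Cq(2) by eventually_elim auto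
      then show ?thesis ..
    next
      case False
      have "AE s in \<mu>. \<phi> s \<notin> E \<inter> Cq"
        using C(2) by eventually_elim (use False in \<open>auto simp: E_def\<close>)
      then have "AE s in \<nu>. \<psi> s \<notin> E \<inter> Cq" using null[of "E \<inter> Cq"] E Cq by auto
      then have "AE s in \<nu>. \<psi> s \<in> E \<longrightarrow> q < s" using Cq(2) AE_space by eventually_elim auto
      then show ?thesis ..
    qed
  qed
  then obtain q where q: "AE s in \<nu>. \<psi> s \<in> E \<longrightarrow> s = q"
    using AE_eq_const_of_dichotomy[where \<nu>=\<nu> and R="\<lambda>s. \<psi> s \<in> E" and r="\<lambda>s. s"] by blast
  show ?thesis
  proof (cases "q \<in> D")
    case True
    show ?thesis using q CD(2) by eventually_elim (use True in \<open>auto simp: E_def\<close>)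
  next
    case False
    show ?thesis using q CD(2) D(2)[OF False] by eventually_elim (auto simp: E_def)
  qed
qed

text \<open>
  Since \<open>D'\<close> is countable, \<open>C\<close> is covered, up to a null set, by countably many sets whose preimage
  is a single point.
\<close>

lemma atomic_image_subset:
  fixes \<mu> \<nu> :: "real measure"
  assumes null: "\<And>C. C \<in> sets V \<Longrightarrow> (AE s in \<mu>. \<phi> s \<notin> C) \<longleftrightarrow> (AE s in \<nu>. \<psi> s \<notin> C)"
    and gen\<mu>: "\<And>B. B \<in> sets \<mu> \<Longrightarrow> \<exists>C\<in>sets V. AE s in \<mu>. s \<in> B \<longleftrightarrow> \<phi> s \<in> C"
    and gen\<nu>: "\<And>B. B \<in> sets \<nu> \<Longrightarrow> \<exists>C\<in>sets V. AE s in \<nu>. s \<in> B \<longleftrightarrow> \<psi> s \<in> C"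
    and D: "D \<in> sets \<nu>" "\<And>q. q \<notin> D \<Longrightarrow> AE s in \<nu>. s \<noteq> q"
    and ray: "\<And>q. {s \<in> space \<nu>. s \<le> q} \<in> sets \<nu>"
    and D': "countable D'" "\<And>p. p \<in> D' \<Longrightarrow> {p} \<in> sets \<mu>"
    and C: "C \<in> sets V" "AE s in \<mu>. \<phi> s \<in> C \<longrightarrow> s \<in> D'"
  shows "AE s in \<nu>. \<psi> s \<in> C \<longrightarrow> s \<in> D"
proof -
  have "\<forall>p\<in>D'. \<exists>Cp. Cp \<in> sets V \<and> (AE s in \<mu>. s \<in> {p} \<longleftrightarrow> \<phi> s \<in> Cp)" using gen\<mu> D'(2) by blast
  then obtain Cp where Cp: "\<And>p. p \<in> D' \<Longrightarrow> Cp p \<in> sets V" "\<And>p. p \<in> D' \<Longrightarrow> AE s in \<mu>. s \<in> {p} \<longleftrightarrow> \<phi> s \<in> Cp p"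
    by (simp only: bchoice_iff) blast
  have "AE s in \<mu>. \<forall>p\<in>D'. s \<in> {p} \<longleftrightarrow> \<phi> s \<in> Cp p"
    using Cp(2) by (subst AE_ball_countable[OF D'(1)]) auto
  then have "AE s in \<mu>. \<phi> s \<notin> C - (\<Union>p\<in>D'. Cp p)" using C(2) by eventually_elim auto
  moreover have "C - (\<Union>p\<in>D'. Cp p) \<in> sets V" using C(1) Cp(1) D'(1) by (intro sets.Diff sets.countable_UN') auto
  ultimately have 1: "AE s in \<nu>. \<psi> s \<notin> C - (\<Union>p\<in>D'. Cp p)" using null by blast
  have "AE s in \<nu>. \<psi> s \<in> Cp p \<longrightarrow> s \<in> D" if "p \<in> D'" for p
  proof (rule point_image_atomic[where \<mu>=\<mu> and \<phi>=\<phi> and p=p, OF null gen\<nu> D ray Cp(1)[OF that]])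
    show "AE s in \<mu>. \<phi> s \<in> Cp p \<longrightarrow> s = p" using Cp(2)[OF that] by eventually_elim auto
  qed
  then have "AE s in \<nu>. \<forall>p\<in>D'. \<psi> s \<in> Cp p \<longrightarrow> s \<in> D" by (subst AE_ball_countable[OF D'(1)]) auto
  with 1 show ?thesis by eventually_elim auto
qed

text \<open>
  One measurable set of the image space describes the atomic parts of both base spaces, so the
  decomposition into an atomic and a diffuse part depends on the image measure alone.
\<close>

lemma common_atomic_part:
  fixes \<mu> \<nu> :: "real measure"
  assumes null: "\<And>C. C \<in> sets V \<Longrightarrow> (AE s in \<mu>. \<phi> s \<notin> C) \<longleftrightarrow> (AE s in \<nu>. \<psi> s \<notin> C)"
    and gen\<mu>: "\<And>B. B \<in> sets \<mu> \<Longrightarrow> \<exists>C\<in>sets V. AE s in \<mu>. s \<in> B \<longleftrightarrow> \<phi> s \<in> C"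
    and gen\<nu>: "\<And>B. B \<in> sets \<nu> \<Longrightarrow> \<exists>C\<in>sets V. AE s in \<nu>. s \<in> B \<longleftrightarrow> \<psi> s \<in> C"
    and D: "D \<in> sets \<mu>" "\<And>q. q \<notin> D \<Longrightarrow> AE s in \<mu>. s \<noteq> q" "\<And>q. {s \<in> space \<mu>. s \<le> q} \<in> sets \<mu>"
      "countable D" "\<And>p. p \<in> D \<Longrightarrow> {p} \<in> sets \<mu>"
    and E: "E \<in> sets \<nu>" "\<And>q. q \<notin> E \<Longrightarrow> AE s in \<nu>. s \<noteq> q" "\<And>q. {s \<in> space \<nu>. s \<le> q} \<in> sets \<nu>"
      "countable E" "\<And>p. p \<in> E \<Longrightarrow> {p} \<in> sets \<nu>"
  shows "\<exists>C\<in>sets V. (AE s in \<mu>. s \<in> D \<longleftrightarrow> \<phi> s \<in> C) \<and> (AE s in \<nu>. s \<in> E \<longleftrightarrow> \<psi> s \<in> C)"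
proof -
  obtain C where C: "C \<in> sets V" "AE s in \<mu>. s \<in> D \<longleftrightarrow> \<phi> s \<in> C" using gen\<mu>[OF D(1)] by blast
  obtain C' where C': "C' \<in> sets V" "AE s in \<nu>. s \<in> E \<longleftrightarrow> \<psi> s \<in> C'" using gen\<nu>[OF E(1)] by blast
  have "AE s in \<nu>. \<psi> s \<in> C \<longrightarrow> s \<in> E"
  proof (rule atomic_image_subset[where \<mu>=\<mu> and \<phi>=\<phi>, OF null gen\<mu> gen\<nu> E(1,2,3) D(4,5) C(1)])
    show "AE s in \<mu>. \<phi> s \<in> C \<longrightarrow> s \<in> D" using C(2) by eventually_elim auto
  qed
  moreover have "AE s in \<mu>. \<phi> s \<in> C' \<longrightarrow> s \<in> D"
  proof (rule atomic_image_subset[where \<mu>=\<nu> and \<phi>=\<psi>, OF null[symmetric] gen\<nu> gen\<mu> D(1,2,3) E(4,5) C'(1)])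
    show "AE s in \<nu>. \<psi> s \<in> C' \<longrightarrow> s \<in> E" using C'(2) by eventually_elim auto
  qed
  then have "AE s in \<mu>. \<phi> s \<notin> C' - C" using C(2) by eventually_elim auto
  then have "AE s in \<nu>. \<psi> s \<notin> C' - C" using null[of "C' - C"] C(1) C'(1) by auto
  ultimately have "AE s in \<nu>. s \<in> E \<longleftrightarrow> \<psi> s \<in> C" using C'(2) by eventually_elim auto
  with C show ?thesis by blast
qed

section \<open>Standardized supports and the decomposition\<close>

lemma std_support_cont_eq: "std_support_cont I N = std_support I 0"
  by (auto simp: std_support_cont_def std_support_def zero_enat_def)

lemma std_support_disc_eq: "std_support_disc I N = std_support False N"
  by (auto simp: std_support_disc_def std_support_def)

lemma std_support_parts:
  "std_support_cont I N \<inter> std_support_disc I N = {}"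
  "std_support_cont I N \<union> std_support_disc I N = std_support I N"
  by (auto simp: std_support_cont_def std_support_disc_def std_support_def)

lemma sets_std_measure: "A \<in> sets (std_measure I N) \<longleftrightarrow> A \<subseteq> std_support I N \<and> A \<in> sets borel"
  unfolding std_measure_def by (subst sets_restrict_space_iff) auto

lemma std_support_parts_sets:
  "std_support_cont I N \<in> sets (std_measure I N)" "std_support_disc I N \<in> sets (std_measure I N)"
  using std_support_parts(2)[of I N]
  by (auto simp: sets_std_measure std_support_cont_eq std_support_disc_eq)

lemma restrict_std_measure:
  assumes "std_support J K \<subseteq> std_support I N"
  shows "restrict_space (std_measure I N) (std_support J K) = std_measure J K"
proof -
  have "restrict_space (std_measure I N) (std_support J K) = restrict_space leb_count (std_support I N \<inter> std_support J K)"
    unfolding std_measure_def by (rule restrict_restrict_space) auto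
  then show ?thesis using assms by (simp add: std_measure_def Int_absorb1)
qed

lemma std_measure_cont_eq: "std_measure_cont I N = std_measure I 0"
  unfolding std_measure_cont_def std_support_cont_eq
  using std_support_parts(2)[of I N] by (intro restrict_std_measure) (auto simp: std_support_cont_eq)

lemma std_measure_disc_eq: "std_measure_disc I N = std_measure False N"
  unfolding std_measure_disc_def std_support_disc_eq
  using std_support_parts(2)[of I N] by (intro restrict_std_measure) (auto simp: std_support_disc_eq)

text \<open>
  A point of \<open>(0,1)\<close> is Lebesgue null, and other points outside the discrete part are not in the space.
\<close>

lemma std_measure_nonatomic:
  assumes "q \<notin> std_support_disc I N"
  shows "AE s in std_measure I N. s \<noteq> q"
proof (cases "q \<in> std_support I N")
  case True
  then have q: "q \<in> {0<..<1}" using assms std_support_parts(2)[of I N] by (auto simp: std_support_cont_def)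
  have "emeasure (std_measure I N) {q} = emeasure lborel ({q} \<inter> {0<..<1}) + emeasure (count_space UNIV) ({q} \<inter> real ` {1..})"
    using True by (intro emeasure_std_measure) auto
  also have "{q} \<inter> real ` {1..} = {}" using q by auto
  also have "{q} \<inter> {0<..<1} = {q}" using q by auto
  finally have "{q} \<in> null_sets (std_measure I N)"
    using True by (simp add: null_sets_def sets_std_measure)
  then show ?thesis by (auto dest: AE_not_in)
next
  case False
  then show ?thesis by (intro AE_I2) auto
qed

lemma std_measure_atoms:
  "std_support_disc I N \<in> sets (std_measure I N)"
  "\<And>q. q \<notin> std_support_disc I N \<Longrightarrow> AE s in std_measure I N. s \<noteq> q"
  "\<And>q. {s \<in> space (std_measure I N). s \<le> q} \<in> sets (std_measure I N)"
  "countable (std_support_disc I N)"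
  "\<And>p. p \<in> std_support_disc I N \<Longrightarrow> {p} \<in> sets (std_measure I N)"
proof -
  show "{s \<in> space (std_measure I N). s \<le> q} \<in> sets (std_measure I N)" for q
  proof -
    have "{s \<in> std_support I N. s \<le> q} = std_support I N \<inter> {..q}" by auto
    also have "\<dots> \<in> sets borel" by (intro sets.Int std_support_borel) simp
    finally show ?thesis by (simp add: sets_std_measure)
  qed
  show "countable (std_support_disc I N)"
    unfolding std_support_disc_def by (rule countable_subset[of _ "range real"]) auto
  show "{p} \<in> sets (std_measure I N)" if "p \<in> std_support_disc I N" for p
    using that std_support_parts(2)[of I N] by (auto simp: sets_std_measure)
qed (fact std_support_parts_sets std_measure_nonatomic)+

text \<open>
  The two representations have the same normalized spectral measure, and a single set of that image
  space singles out the discrete part on both sides. So the discrete exponents agree, and the continuous ones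
  by subtraction.
\<close>

lemma exponent_parts_unique:
  fixes f g :: "'t \<Rightarrow> real \<Rightarrow> real"
  assumes \<alpha>: "0 < \<alpha>" and P: "prob_space P"
    and f: "minimal_rep P \<alpha> T X (std_measure I N) f" and g: "minimal_rep P \<alpha> T X (std_measure J K) g"
    and F: "finite F" "F \<subseteq> T" "\<And>t. t \<in> F \<Longrightarrow> 0 < x t"
  shows "exponent \<alpha> (std_measure_disc I N) f F x = exponent \<alpha> (std_measure_disc J K) g F x"
    and "exponent \<alpha> (std_measure_cont I N) f F x = exponent \<alpha> (std_measure_cont J K) g F x"
proof -
  let ?\<mu> = "std_measure I N" and ?\<nu> = "std_measure J K"
  let ?D = "std_support_disc I N" and ?E = "std_support_disc J K"
  have sf: "spectral_rep P \<alpha> T X ?\<mu> f" "is_support \<alpha> ?\<mu> T f (space ?\<mu>)"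
    and sg: "spectral_rep P \<alpha> T X ?\<nu> g" "is_support \<alpha> ?\<nu> T g (space ?\<nu>)"
    using f g by (auto simp: minimal_rep_def)
  note fL = spectral_repD(1)[OF P \<alpha> sf(1)] and gL = spectral_repD(1)[OF P \<alpha> sg(1)]
  have eq: "exponent \<alpha> ?\<mu> f G y = exponent \<alpha> ?\<nu> g G y" if "finite G" "G \<subseteq> T" "\<And>t. t \<in> G \<Longrightarrow> 0 < y t" for G y
    using spectral_repD(4)[OF P \<alpha> sf(1) that] spectral_repD(4)[OF P \<alpha> sg(1) that] by simp
  obtain u v where u: "integrable ?\<mu> u" "\<And>s. 0 \<le> u s" "AE s in ?\<mu>. 0 < u s"
    and v: "integrable ?\<nu> v" "\<And>s. 0 \<le> v s" "AE s in ?\<nu>. 0 < v s"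
    and uv: "spectral_measure \<alpha> T ?\<mu> f u = spectral_measure \<alpha> T ?\<nu> g v"
    using spectral_measure_eq[OF \<alpha> fL gL sf(2) sg(2) eq] by blast
  have null: "(AE s in ?\<mu>. ratio_map \<alpha> T f u s \<notin> C) \<longleftrightarrow> (AE s in ?\<nu>. ratio_map \<alpha> T g v s \<notin> C)"
    if "C \<in> sets (PiM T (\<lambda>_. borel))" for C
    using AE_spectral_measure_iff[where f=f, OF LplusD(1)[OF fL] borel_measurable_integrable[OF u(1)] u(3) that, of \<alpha>]
      AE_spectral_measure_iff[where f=g, OF LplusD(1)[OF gL] borel_measurable_integrable[OF v(1)] v(3) that, of \<alpha>]
    unfolding uv by blast
  obtain C where C: "C \<in> sets (PiM T (\<lambda>_. borel))"
    "AE s in ?\<mu>. s \<in> ?D \<longleftrightarrow> ratio_map \<alpha> T f u s \<in> C" "AE s in ?\<nu>. s \<in> ?E \<longleftrightarrow> ratio_map \<alpha> T g v s \<in> C"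
    using common_atomic_part[OF null minimal_rep_pullback[OF \<alpha> f u(3)] minimal_rep_pullback[OF \<alpha> g v(3)]
      std_measure_atoms std_measure_atoms] by blast
  have "exponent \<alpha> (std_measure_disc I N) f F x =
      (\<integral>z. indicator C z * max0 F (\<lambda>t. inverse (x t) powr \<alpha> * z t) \<partial>spectral_measure \<alpha> T ?\<mu> f u)"
    unfolding std_measure_disc_def
    by (rule exponent_restrict_spectral_measure[OF fL u std_support_parts_sets(2) C(1,2) F(1,2)])
  also have "\<dots> = exponent \<alpha> (std_measure_disc J K) g F x"
    unfolding std_measure_disc_def uv
    by (rule exponent_restrict_spectral_measure[OF gL v std_support_parts_sets(2) C(1,3) F(1,2), symmetric])
  finally show disc: "exponent \<alpha> (std_measure_disc I N) f F x = exponent \<alpha> (std_measure_disc J K) g F x" .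
  have split: "exponent \<alpha> (std_measure L H) h F x = exponent \<alpha> (std_measure_cont L H) h F x + exponent \<alpha> (std_measure_disc L H) h F x"
    if "\<And>t. t \<in> T \<Longrightarrow> h t \<in> Lplus \<alpha> (std_measure L H)" for L H and h :: "'t \<Rightarrow> real \<Rightarrow> real"
    unfolding std_measure_cont_def std_measure_disc_def
    using that F(2) by (intro exponent_split std_support_parts_sets F(1)) (auto simp: std_support_parts)
  have "exponent \<alpha> ?\<mu> f F x = exponent \<alpha> ?\<nu> g F x" using F by (rule eq)
  moreover have "exponent \<alpha> ?\<mu> f F x = exponent \<alpha> (std_measure_cont I N) f F x + exponent \<alpha> (std_measure_disc I N) f F x"
    using fL by (rule split)
  moreover have "exponent \<alpha> ?\<nu> g F x = exponent \<alpha> (std_measure_cont J K) g F x + exponent \<alpha> (std_measure_disc J K) g F x"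
    using gL by (rule split)
  ultimately show "exponent \<alpha> (std_measure_cont I N) f F x = exponent \<alpha> (std_measure_cont J K) g F x"
    using disc by simp
qed

lemma spectral_rep_law_eq:
  assumes \<alpha>: "0 < \<alpha>" and P: "prob_space P" and Q: "prob_space Q"
    and X: "spectral_rep P \<alpha> T X \<mu> f" and Y: "spectral_rep Q \<alpha> T Y \<nu> g"
    and eq: "\<And>F x. finite F \<Longrightarrow> F \<subseteq> T \<Longrightarrow> (\<And>t. t \<in> F \<Longrightarrow> 0 < x t) \<Longrightarrow> exponent \<alpha> \<mu> f F x = exponent \<alpha> \<nu> g F x"
  shows "process_law P T X = process_law Q T Y"
  unfolding process_law_def
proof (rule nonneg_process_law_eqI)
  show "finite_measure P" "finite_measure Q" using P Q by (auto intro: prob_space.finite_measure)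
  fix F and x :: "_ \<Rightarrow> real" assume F: "finite F" "F \<subseteq> T" "\<And>t. t \<in> F \<Longrightarrow> 0 < x t"
  show "measure P {\<omega> \<in> space P. \<forall>t\<in>F. X t \<omega> \<le> x t} = measure Q {\<omega> \<in> space Q. \<forall>t\<in>F. Y t \<omega> \<le> x t}"
    using spectral_repD(4)[OF P \<alpha> X F] spectral_repD(4)[OF Q \<alpha> Y F] eq[OF F] by simp
qed (fact spectral_repD[OF P \<alpha> X] spectral_repD[OF Q \<alpha> Y])+

lemma std_components_spectral_rep:
  assumes \<alpha>: "0 < \<alpha>" and Q: "prob_space Q" and c: "std_components Q \<alpha> T I N f M XI XN"
  shows "spectral_rep Q \<alpha> T XI (std_measure_cont I N) (cont_part I N f)"
    and "spectral_rep Q \<alpha> T XN (std_measure_disc I N) (disc_part I N f)"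
proof -
  have M: "random_sup_measure Q \<alpha> (std_measure I N) M"
    and XI: "\<And>t. t \<in> T \<Longrightarrow> has_extremal_integral Q \<alpha> (std_measure_cont I N) M (cont_part I N f t) (XI t)"
    and XN: "\<And>t. t \<in> T \<Longrightarrow> has_extremal_integral Q \<alpha> (std_measure_disc I N) M (disc_part I N f t) (XN t)"
    using c by (auto simp: std_components_def)
  show "spectral_rep Q \<alpha> T XI (std_measure_cont I N) (cont_part I N f)"
    by (rule extremal_integrals_spectral_rep[OF Q \<alpha> _ XI])
      (simp add: std_measure_cont_def random_sup_measure_restrict[OF M std_support_parts_sets(1)])
  show "spectral_rep Q \<alpha> T XN (std_measure_disc I N) (disc_part I N f)"
    by (rule extremal_integrals_spectral_rep[OF Q \<alpha> _ XN])
      (simp add: std_measure_disc_def random_sup_measure_restrict[OF M std_support_parts_sets(2)])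
qed

text \<open>
  On its own part of the space each cut-off function is the original one.
\<close>

lemma exponent_part_functions:
  "exponent \<alpha> (std_measure_cont I N) (cont_part I N f) F x = exponent \<alpha> (std_measure_cont I N) f F x"
  "exponent \<alpha> (std_measure_disc I N) (disc_part I N f) F x = exponent \<alpha> (std_measure_disc I N) f F x"
  by (rule exponent_cong; simp add: std_measure_cont_eq std_measure_disc_eq cont_part_def disc_part_def
      std_support_cont_eq std_support_disc_eq)+

lemma std_components_joint:
  assumes \<alpha>: "0 < \<alpha>" and Q: "prob_space Q" and c: "std_components Q \<alpha> T I N f M XI XN"
    and F: "finite F" "F \<subseteq> T" "\<And>t. t \<in> F \<Longrightarrow> 0 < x t" and G: "finite G" "G \<subseteq> T" "\<And>t. t \<in> G \<Longrightarrow> 0 < y t"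
  shows "measure Q {\<omega> \<in> space Q. (\<forall>t\<in>F. XI t \<omega> \<le> x t) \<and> (\<forall>t\<in>G. XN t \<omega> \<le> y t)} =
     exp (- (exponent \<alpha> (std_measure_cont I N) f F x + exponent \<alpha> (std_measure_disc I N) f G y))"
proof -
  have "measure Q {\<omega> \<in> space Q. (\<forall>t\<in>F. XI t \<omega> \<le> x t) \<and> (\<forall>t\<in>G. XN t \<omega> \<le> y t)} =
     exp (- (exponent \<alpha> (std_measure_cont I N) (cont_part I N f) F x + exponent \<alpha> (std_measure_disc I N) (disc_part I N f) G y))"
    unfolding std_measure_cont_def std_measure_disc_def
    by (rule extremal_integrals_disjoint[OF Q \<alpha> _ std_support_parts_sets std_support_parts(1) _ _ _ _ F G])
      (use c in \<open>auto simp: std_components_def std_measure_cont_def std_measure_disc_def cont_part_def disc_part_def\<close>)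
  then show ?thesis by (simp only: exponent_part_functions)
qed

theorem theorem5p1:
  fixes \<alpha> :: real
    and T :: "'t set"
    and P :: "'p measure" and X :: "'t \<Rightarrow> 'p \<Rightarrow> real"
    and I :: bool and N :: enat and f :: "'t \<Rightarrow> real \<Rightarrow> real"
    and Q :: "'q measure" and M :: "real set \<Rightarrow> 'q \<Rightarrow> ennreal"
    and XI XN :: "'t \<Rightarrow> 'q \<Rightarrow> real"
  assumes "0 < \<alpha>"
    and "prob_space P"
    and "frechet_process P \<alpha> T X"
    and "minimal_rep P \<alpha> T X (std_measure I N) f"
    and "prob_space Q"
    and "std_components Q \<alpha> T I N f M XI XN"
  shows
    "process_law P T X = process_law Q T (\<lambda>t \<omega>. max (XI t \<omega>) (XN t \<omega>))
     \<and> (\<forall>J K (g :: 't \<Rightarrow> real \<Rightarrow> real) (R :: 'r measure) M' YI YN.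
          minimal_rep P \<alpha> T X (std_measure J K) g \<and>
          prob_space R \<and> std_components R \<alpha> T J K g M' YI YN \<longrightarrow>
          process_law R T YI = process_law Q T XI \<and>
          process_law R T YN = process_law Q T XN)
     \<and> indep_processes Q T XI XN
     \<and> has_standardized_support Q \<alpha> T XI (std_support_cont I N)
     \<and> has_standardized_support Q \<alpha> T XN (std_support_disc I N)
     \<and> minimal_rep Q \<alpha> T XI (std_measure_cont I N) (cont_part I N f)
     \<and> minimal_rep Q \<alpha> T XN (std_measure_disc I N) (disc_part I N f)"
proof -
  note \<alpha> = assms(1) and P = assms(2) and f = assms(4) and Q = assms(5) and c = assms(6)
  let ?\<mu> = "std_measure I N"
  note XI = std_components_spectral_rep(1)[OF \<alpha> Q c] and XN = std_components_spectral_rep(2)[OF \<alpha> Q c]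
  note XIp = spectral_repD(2,3)[OF Q \<alpha> XI] and XNp = spectral_repD(2,3)[OF Q \<alpha> XN]
  have X: "spectral_rep P \<alpha> T X ?\<mu> f" using f by (simp add: minimal_rep_def)
  have law_max: "process_law P T X = process_law Q T (\<lambda>t \<omega>. max (XI t \<omega>) (XN t \<omega>))"
    unfolding process_law_def
  proof (rule nonneg_process_law_eqI)
    show "finite_measure P" "finite_measure Q" using P Q by (auto intro: prob_space.finite_measure)
    show "(\<lambda>\<omega>. max (XI t \<omega>) (XN t \<omega>)) \<in> borel_measurable Q" if "t \<in> T" for t
      using XIp(1)[OF that] XNp(1)[OF that] by simp
    show "AE \<omega> in Q. 0 \<le> max (XI t \<omega>) (XN t \<omega>)" if "t \<in> T" for t
      using XIp(2)[OF that] by eventually_elim simp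
    fix F and x :: "'t \<Rightarrow> real" assume F: "finite F" "F \<subseteq> T" "\<And>t. t \<in> F \<Longrightarrow> 0 < x t"
    have "exponent \<alpha> ?\<mu> f F x = exponent \<alpha> (std_measure_cont I N) f F x + exponent \<alpha> (std_measure_disc I N) f F x"
      unfolding std_measure_cont_def std_measure_disc_def
      using spectral_repD(1)[OF P \<alpha> X] F(2)
      by (intro exponent_split std_support_parts_sets F(1)) (auto simp: std_support_parts)
    then have "measure P {\<omega> \<in> space P. \<forall>t\<in>F. X t \<omega> \<le> x t} =
        measure Q {\<omega> \<in> space Q. (\<forall>t\<in>F. XI t \<omega> \<le> x t) \<and> (\<forall>t\<in>F. XN t \<omega> \<le> x t)}"
      using spectral_repD(4)[OF P \<alpha> X F] std_components_joint[OF \<alpha> Q c F F] by simp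
    also have "{\<omega> \<in> space Q. (\<forall>t\<in>F. XI t \<omega> \<le> x t) \<and> (\<forall>t\<in>F. XN t \<omega> \<le> x t)} =
        {\<omega> \<in> space Q. \<forall>t\<in>F. max (XI t \<omega>) (XN t \<omega>) \<le> x t}" by auto
    finally show "measure P {\<omega> \<in> space P. \<forall>t\<in>F. X t \<omega> \<le> x t} =
        measure Q {\<omega> \<in> space Q. \<forall>t\<in>F. max (XI t \<omega>) (XN t \<omega>) \<le> x t}" .
  qed (fact spectral_repD[OF P \<alpha> X])+
  have unique: "process_law R T YI = process_law Q T XI \<and> process_law R T YN = process_law Q T XN"
    if g: "minimal_rep P \<alpha> T X (std_measure J K) g" and R: "prob_space R" and c': "std_components R \<alpha> T J K g M' YI YN"
    for J K and g :: "'t \<Rightarrow> real \<Rightarrow> real" and R :: "'r measure" and M' YI YN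
    using spectral_rep_law_eq[OF \<alpha> R Q std_components_spectral_rep(1)[OF \<alpha> R c'] XI]
      spectral_rep_law_eq[OF \<alpha> R Q std_components_spectral_rep(2)[OF \<alpha> R c'] XN]
      exponent_parts_unique[OF \<alpha> P g f]
    unfolding exponent_part_functions by blast
  have indep: "indep_processes Q T XI XN"
  proof (rule indep_processesI[OF Q XIp XNp])
    fix F G and x y :: "'t \<Rightarrow> real"
    assume F: "finite F" "F \<subseteq> T" and G: "finite G" "G \<subseteq> T"
      and x: "\<And>t. t \<in> F \<Longrightarrow> 0 < x t" and y: "\<And>t. t \<in> G \<Longrightarrow> 0 < y t"
    show "measure Q {\<omega> \<in> space Q. (\<forall>t\<in>F. XI t \<omega> \<le> x t) \<and> (\<forall>t\<in>G. XN t \<omega> \<le> y t)} =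
       measure Q {\<omega> \<in> space Q. \<forall>t\<in>F. XI t \<omega> \<le> x t} * measure Q {\<omega> \<in> space Q. \<forall>t\<in>G. XN t \<omega> \<le> y t}"
      using std_components_joint[OF \<alpha> Q c F x G y] spectral_repD(4)[OF Q \<alpha> XI F x] spectral_repD(4)[OF Q \<alpha> XN G y]
      by (simp add: exponent_part_functions exp_add[symmetric])
  qed
  have min_I: "minimal_rep Q \<alpha> T XI (std_measure_cont I N) (cont_part I N f)"
    using minimal_rep_restrict[OF \<alpha> std_support_parts_sets(1) f, of Q XI] XI
    unfolding std_measure_cont_def cont_part_def [abs_def] by blast
  have min_N: "minimal_rep Q \<alpha> T XN (std_measure_disc I N) (disc_part I N f)"
    using minimal_rep_restrict[OF \<alpha> std_support_parts_sets(2) f, of Q XN] XN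
    unfolding std_measure_disc_def disc_part_def [abs_def] by blast
  have "has_standardized_support Q \<alpha> T XI (std_support_cont I N)"
    using min_I unfolding has_standardized_support_def std_support_cont_eq std_measure_cont_eq by blast
  moreover have "has_standardized_support Q \<alpha> T XN (std_support_disc I N)"
    using min_N unfolding has_standardized_support_def std_support_disc_eq std_measure_disc_eq by blast
  ultimately show ?thesis using law_max unique indep min_I min_N by blast
qed

end
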